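(* Let $\mathcal{B}$ be a separable Hilbert space. Assume that there are constants $0<l\le L$ with $l\le K(u)\le L$ for $0\le u\le1$ and $K(u)=0$ for $u>1$; that $h_n>0$, $h_n\to0$ and $n\phi(\mathbf{x},h_n)\to\infty$ as $n\to\infty$; and that for some $\nu>2$ the quantity $\mathbb{E}\big[\|G(\mathbf{Y})-\mathbb{E}[G(\mathbf{Y})\mid\mathbf{X}=\mathbf{z}]\|^\nu\mid\mathbf{X}=\mathbf{z}\big]$ is uniformly bounded for $\mathbf{z}$ in a neighborhood of $\mathbf{x}$. Assume further that the covariance operator $\mathbb{D}(\cdot,\cdot\mid\mathbf{z}):\mathcal{B}\times\mathcal{B}\to\mathbb{R}$, $$\mathbb{D}(\mathbf{u},\mathbf{v}\mid\mathbf{z})=\mathbb{E}\big[\langle\mathbf{u},\mathbb{L}_{\mathbf{x}}(G(\mathbf{Y})-\mathbb{E}[G(\mathbf{Y})\mid\mathbf{X}=\mathbf{z}])\rangle\,\langle\mathbf{v},\mathbb{L}_{\mathbf{x}}(G(\mathbf{Y})-\mathbb{E}[G(\mathbf{Y})\mid\mathbf{X}=\mathbf{z}])\rangle\,\big|\,\mathbf{X}=\mathbf{z}\big],$$ converges to $\mathbb{D}(\cdot,\cdot\mid\mathbf{x})$ in the trace norm as $\mathbf{z}\to\mathbf{x}$, and that $\mathbb{D}(\cdot,\cdot\mid\mathbf{x})$ is a bounded positive definite operator. Let $$V_n(\mathbf{x})=\mathbb{L}_{\mathbf{x}}\left(\frac{\sum_{i=1}^{n}\big[G(\mathbf{Y}_i)-\mathbb{E}[G(\mathbf{Y}_i)\mid\mathbf{X}_i]\big]K(h_n^{-1}d(\mathbf{x},\mathbf{X}_i))}{\sum_{i=1}^{n}K(h_n^{-1}d(\mathbf{x},\mathbf{X}_i))}\right),\qquad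 E_n^{(j)}(\mathbf{x})=\frac{\mathbb{E}\big[K^j(h_n^{-1}d(\mathbf{x},\mathbf{X}))\big]}{\phi(\mathbf{x},h_n)}\quad(j=1,2).$$ Then $$[n\phi(\mathbf{x},h_n)]^{1/2}\,[E_n^{(2)}(\mathbf{x})]^{-1/2}\,E_n^{(1)}(\mathbf{x})\,V_n(\mathbf{x})\longrightarrow\mathbf{W}$$ in distribution as $n\to\infty$, where $\mathbf{W}$ is a zero-mean Gaussian random element of $\mathcal{B}$ with covariance operator $\mathbb{D}(\cdot,\cdot\mid\mathbf{x})$.
   Context: $(\mathcal{C},d)$ is a complete separable metric space, $\mathcal{R}$ is a measurable space, $(\mathbf{X},\mathbf{Y})$ is a random element of $\mathcal{C}\times\mathcal{R}$, and $(\mathbf{X}_i,\mathbf{Y}_i)$, $i\ge1$, are i.i.d. copies. A regular conditional distribution of $\mathbf{Y}$ given $\mathbf{X}=\mathbf{z}$ is fixed and $\mathbb{E}[\,\cdot\mid\mathbf{X}=\mathbf{z}]$ is taken with respect to it; Banach-space-valued expectations are in the Bochner sense. $\mathbf{x}\in\mathcal{C}$ is fixed, $\phi(\mathbf{x},h)=\mathbb{P}[d(\mathbf{x},\mathbf{X})\le h]$, $K:[0,\infty)\to[0,\infty)$ is a measurable kernel, $\{h_n\}$ is a deterministic bandwidth sequence. $\mathcal{G}$ is a separable Banach space, $G:\mathcal{R}\to\mathcal{G}$ is measurable and $\mathbb{L}_{\mathbf{x}}:\mathcal{G}\to\mathcal{B}$ is a continuous linear map. Quotients with zero denominator are read as $0$.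 *)

theory Defs
  imports "HOL-Probability.Probability"
begin

(* The last condition determines the joint law because rectangles generate the product
   sigma-algebra. *)
definition regular_conditional_distribution ::
    "'a measure \<Rightarrow> 'c measure \<Rightarrow> ('a \<Rightarrow> 'c) \<Rightarrow> 'r measure \<Rightarrow> ('a \<Rightarrow> 'r) \<Rightarrow> ('c \<Rightarrow> 'r measure) \<Rightarrow> bool"
  where
  "regular_conditional_distribution M C X R Y \<kappa> \<longleftrightarrow>
     \<kappa> \<in> C \<rightarrow>\<^sub>M prob_algebra R \<and>
     (\<forall>A\<in>sets C. \<forall>B\<in>sets R.
        emeasure M {\<omega>\<in>space M. X \<omega> \<in> A \<and> Y \<omega> \<in> B} =
        (\<integral>\<^sup>+z\<in>A. emeasure (\<kappa> z) B \<partial>(distr M C X)))"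

definition iid_copies ::
    "'a measure \<Rightarrow> 's measure \<Rightarrow> ('a \<Rightarrow> 's) \<Rightarrow> (nat \<Rightarrow> 'a \<Rightarrow> 's) \<Rightarrow> bool" where
  "iid_copies M S Z Zs \<longleftrightarrow>
     prob_space.indep_vars M (\<lambda>_. S) Zs {1..} \<and>
     (\<forall>i\<ge>1. distr M S (Zs i) = distr M S Z)"

definition small_ball :: "'a measure \<Rightarrow> ('a \<Rightarrow> 'c::metric_space) \<Rightarrow> 'c \<Rightarrow> real \<Rightarrow> real" where
  "small_ball M X x h = measure M {\<omega>\<in>space M. dist x (X \<omega>) \<le> h}"

definition cond_mean ::
    "('c \<Rightarrow> 'r measure) \<Rightarrow> ('r \<Rightarrow> 'g::{banach,second_countable_topology}) \<Rightarrow> 'c \<Rightarrow> 'g" where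
  "cond_mean \<kappa> G z = (\<integral>y. G y \<partial>\<kappa> z)"

definition cond_cov ::
    "('c \<Rightarrow> 'r measure) \<Rightarrow> ('r \<Rightarrow> 'g::{banach,second_countable_topology}) \<Rightarrow>
     ('g \<Rightarrow> 'b::real_inner) \<Rightarrow> 'c \<Rightarrow> 'b \<Rightarrow> 'b \<Rightarrow> real" where
  "cond_cov \<kappa> G L z u v =
     (\<integral>y. inner u (L (G y - cond_mean \<kappa> G z)) * inner v (L (G y - cond_mean \<kappa> G z)) \<partial>\<kappa> z)"

(* The quotient is 0 when the denominator is 0, since inverse 0 = 0. *)
definition V_stat ::
    "('c::metric_space \<Rightarrow> 'r measure) \<Rightarrow> ('r \<Rightarrow> 'g::{banach,second_countable_topology}) \<Rightarrow>
     ('g \<Rightarrow> 'b) \<Rightarrow> (real \<Rightarrow> real) \<Rightarrow> (nat \<Rightarrow> real) \<Rightarrow> 'c \<Rightarrow>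
     (nat \<Rightarrow> 'a \<Rightarrow> 'c) \<Rightarrow> (nat \<Rightarrow> 'a \<Rightarrow> 'r) \<Rightarrow> nat \<Rightarrow> 'a \<Rightarrow> 'b" where
  "V_stat \<kappa> G L K h x Xs Ys n \<omega> =
     L ((\<Sum>i=1..n. K (dist x (Xs i \<omega>) / h n) *\<^sub>R (G (Ys i \<omega>) - cond_mean \<kappa> G (Xs i \<omega>))) /\<^sub>R
        (\<Sum>i=1..n. K (dist x (Xs i \<omega>) / h n)))"

definition E_stat ::
    "'a measure \<Rightarrow> ('a \<Rightarrow> 'c::metric_space) \<Rightarrow> (real \<Rightarrow> real) \<Rightarrow> (nat \<Rightarrow> real) \<Rightarrow> 'c \<Rightarrow>
     nat \<Rightarrow> nat \<Rightarrow> real" where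
  "E_stat M X K h x j n =
     (\<integral>\<omega>. K (dist x (X \<omega>) / h n) ^ j \<partial>M) / small_ball M X x (h n)"

definition orthonormal_basis :: "'b::real_inner set \<Rightarrow> bool" where
  "orthonormal_basis E \<longleftrightarrow>
     (\<forall>e\<in>E. norm e = 1) \<and> (\<forall>e\<in>E. \<forall>f\<in>E. e \<noteq> f \<longrightarrow> inner e f = 0) \<and>
     closure (span E) = UNIV"

(* P = |T|, the positive self-adjoint square root of T*T; the equation P P = T*T is stated weakly
   so that the adjoint of T need not be named. *)
definition operator_modulus :: "('b::real_inner \<Rightarrow> 'b) \<Rightarrow> ('b \<Rightarrow> 'b) \<Rightarrow> bool" where
  "operator_modulus T P \<longleftrightarrow>
     bounded_linear P \<and> (\<forall>u v. inner (P u) v = inner u (P v)) \<and> (\<forall>u. 0 \<le> inner (P u) u) \<and>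
     (\<forall>u v. inner (P (P u)) v = inner (T u) (T v))"

(* t = tr |T| for the bounded operator T that represents the form A. The relation fails for every t
   when A is not a bounded bilinear form or T is not of trace class. *)
definition has_trace_norm :: "('b::real_inner \<Rightarrow> 'b \<Rightarrow> real) \<Rightarrow> real \<Rightarrow> bool" where
  "has_trace_norm A t \<longleftrightarrow>
     (\<exists>T P E. bounded_linear T \<and> (\<forall>u v. A u v = inner (T u) v) \<and>
        operator_modulus T P \<and> orthonormal_basis E \<and>
        ((\<lambda>e. inner (P e) e) has_sum t) E)"

definition tendsto_trace_norm ::
    "('c \<Rightarrow> 'b::real_inner \<Rightarrow> 'b \<Rightarrow> real) \<Rightarrow> ('b \<Rightarrow> 'b \<Rightarrow> real) \<Rightarrow> 'c filter \<Rightarrow> bool" where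
  "tendsto_trace_norm A A0 F \<longleftrightarrow>
     (\<forall>\<epsilon>>0. \<forall>\<^sub>F z in F. \<exists>t<\<epsilon>. has_trace_norm (\<lambda>u v. A z u v - A0 u v) t)"

(* Point masses count as (degenerate) Gaussian laws, as is needed for Gaussian elements whose
   covariance may vanish in some direction. *)
definition gaussian_law :: "real measure \<Rightarrow> bool" where
  "gaussian_law \<mu> \<longleftrightarrow>
     (\<exists>m. \<mu> = return borel m) \<or>
     (\<exists>m \<sigma>. 0 < \<sigma> \<and> \<mu> = density lborel (\<lambda>t. ennreal (normal_density m \<sigma> t)))"

definition gaussian_element :: "'w measure \<Rightarrow> ('w \<Rightarrow> 'b::real_inner) \<Rightarrow> bool" where
  "gaussian_element N W \<longleftrightarrow>
     prob_space N \<and> W \<in> borel_measurable N \<and>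
     (\<forall>u. gaussian_law (distr N borel (\<lambda>\<omega>. inner u (W \<omega>))))"

definition has_mean ::
    "'w measure \<Rightarrow> ('w \<Rightarrow> 'b::{banach,second_countable_topology}) \<Rightarrow> 'b \<Rightarrow> bool" where
  "has_mean N W m \<longleftrightarrow> integrable N W \<and> integral\<^sup>L N W = m"

definition has_covariance ::
    "'w measure \<Rightarrow> ('w \<Rightarrow> 'b::{real_inner,banach,second_countable_topology}) \<Rightarrow>
     ('b \<Rightarrow> 'b \<Rightarrow> real) \<Rightarrow> bool" where
  "has_covariance N W A \<longleftrightarrow>
     (\<forall>u v. has_bochner_integral N
        (\<lambda>\<omega>. inner u (W \<omega> - integral\<^sup>L N W) * inner v (W \<omega> - integral\<^sup>L N W)) (A u v))"

definition converges_in_distribution ::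
    "'a measure \<Rightarrow> (nat \<Rightarrow> 'a \<Rightarrow> 'b::metric_space) \<Rightarrow> 'w measure \<Rightarrow> ('w \<Rightarrow> 'b) \<Rightarrow> bool" where
  "converges_in_distribution M Z N W \<longleftrightarrow>
     (\<forall>n. Z n \<in> borel_measurable M) \<and> W \<in> borel_measurable N \<and>
     (\<forall>f::'b \<Rightarrow> real. continuous_on UNIV f \<and> bounded (range f) \<longrightarrow>
        (\<lambda>n. \<integral>\<omega>. f (Z n \<omega>) \<partial>M) \<longlonglongrightarrow> (\<integral>\<omega>. f (W \<omega>) \<partial>N))"

end

theory Submission
  imports Defs
begin

text \<open>Write \<open>w\<^sub>i = K (d (x, X\<^sub>i) / h\<^sub>n)\<close> and let \<open>r\<^sub>i\<close> be \<open>L\<close> applied to the \<open>i\<close>-th residual. The normalised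
  statistic equals \<open>S\<^sub>n / T\<^sub>n\<close> with \<open>S\<^sub>n = (\<Sum>\<^sub>i w\<^sub>i r\<^sub>i) / sqrt (n E w\<^sup>2)\<close> and \<open>T\<^sub>n = (\<Sum>\<^sub>i w\<^sub>i) / (n E w)\<close>.
  Since \<open>n \<phi> \<rightarrow> \<infinity>\<close>, \<open>T\<^sub>n \<rightarrow> 1\<close> in mean square and \<open>S\<^sub>n\<close> satisfies Lyapunov's condition, so the
  characteristic functions of \<open>S\<^sub>n\<close> converge. Trace norm convergence of the covariances gives
  \<open>E \<parallel>S\<^sub>n\<parallel>\<^sup>2 \<rightarrow> tr D\<close>, which together with \<open>E \<langle>v, S\<^sub>n\<rangle>\<^sup>2 \<rightarrow> D v v\<close> makes the tails of \<open>S\<^sub>n\<close> uniformly small, so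
  that finite-dimensional convergence is enough. The Gaussian limit is built from a Cholesky
  factorisation \<open>D v v = (\<Sum>\<^sub>k \<langle>a\<^sub>k, v\<rangle>\<^sup>2)\<close> along an orthonormal sequence; the same factorisation
  shows that the trace of a positive operator does not depend on the basis.\<close>

section \<open>Orthonormal families in separable inner product spaces\<close>

text \<open>The trace norm hypothesis speaks of a modulus \<open>P\<close> of an operator
  \<open>T\<close> along some orthonormal basis, whereas the limit argument needs sums of diagonal
  entries along arbitrary finite orthonormal families. The bridge is that the quadratic form of
  \<open>T\<close> is dominated by that of \<open>P\<close>, for \<open>T\<close> and for
  \<open>- T\<close>; it is proved with approximate eigenvectors, without functional calculus.

  Tightness is not a separate step. By Pythagoras the mean square distance of
  \<open>S\<^sub>n\<close> from a finite-dimensional subspace is the mean squared norm minus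
  finitely many directional variances. All of these converge, so the distance tends to that of the
  Gaussian limit, which is small once the dimension is large. On the projected part, expectations of
  trigonometric polynomials are combinations of characteristic functions.

  All rates come from the bounds \<open>l\<close> and \<open>u\<close> for \<open>K\<close>: every
  moment of the weight is comparable with \<phi>. Hence the mean square of
  \<open>T\<^sub>n - 1\<close> is at most a constant times \<open>1 / (n * \<phi>)\<close>, and the
  Lyapunov sum of order \<open>p\<close> at most a constant times
  \<open>(n * \<phi>) powr (1 - p / 2)\<close>.\<close>

text \<open>Zero vectors are allowed, so that the Gram-Schmidt process yields a sequence indexed by
  \<^typ>\<open>nat\<close> also in finite dimension.\<close>

definition ortho_family :: "('i \<Rightarrow> 'b::real_inner) \<Rightarrow> 'i set \<Rightarrow> bool" where
  "ortho_family e I \<longleftrightarrow>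
     (\<forall>i\<in>I. e i = 0 \<or> norm (e i) = 1) \<and> (\<forall>i\<in>I. \<forall>j\<in>I. i \<noteq> j \<longrightarrow> inner (e i) (e j) = 0)"

definition total_family :: "('i \<Rightarrow> 'b::real_inner) \<Rightarrow> 'i set \<Rightarrow> bool" where
  "total_family e I \<longleftrightarrow> ortho_family e I \<and> closure (span (e ` I)) = UNIV"

text \<open>For an \<open>ortho_family\<close> this is the orthogonal projection onto the span of
  the \<open>e i\<close> with \<open>i \<in> F\<close>; zero vectors contribute nothing.\<close>

definition fproj :: "('i \<Rightarrow> 'b::real_inner) \<Rightarrow> 'i set \<Rightarrow> 'b \<Rightarrow> 'b" where
  "fproj e F v = (\<Sum>i\<in>F. inner (e i) v *\<^sub>R e i)"

lemma ortho_family_subset: "ortho_family e I \<Longrightarrow> F \<subseteq> I \<Longrightarrow> ortho_family e F"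
  by (simp add: ortho_family_def subset_iff)

lemma total_family_ortho: "total_family e I \<Longrightarrow> ortho_family e I"
  by (simp add: total_family_def)

lemma inner_fproj:
  assumes "finite F" "ortho_family e F" "j \<in> F"
  shows "inner (e j) (fproj e F v) = inner (e j) v"
proof -
  have "inner (e j) (fproj e F v) = (\<Sum>i\<in>F. inner (e i) v * inner (e j) (e i))"
    by (simp add: fproj_def inner_sum_right)
  also have "... = (\<Sum>i\<in>F. if i = j then inner (e j) v else 0)"
  proof (rule sum.cong)
    fix i assume "i \<in> F"
    \<comment> \<open>Both sides vanish when \<open>e j = 0\<close>, so the zero vectors allowed in
      the family do no harm.\<close>
    moreover have "e j = 0 \<or> inner (e j) (e j) = 1"
      using assms by (auto simp: ortho_family_def dot_square_norm)
    ultimately show "inner (e i) v * inner (e j) (e i) = (if i = j then inner (e j) v else 0)"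
      using assms by (auto simp: ortho_family_def)
  qed simp
  finally show ?thesis using assms by simp
qed

lemma fproj_in_span: "fproj e F v \<in> span (e ` F)"
  unfolding fproj_def by (intro span_sum span_scale span_base) auto

lemma inner_span_fproj:
  assumes "finite F" "ortho_family e F" "w \<in> span (e ` F)"
  shows "inner w (v - fproj e F v) = 0"
  using assms(3)
proof (induction rule: span_induct_alt)
  case (step c x y)
  then show ?case using inner_fproj[OF assms(1,2)]
    by (auto simp: inner_add_left inner_diff_right)
qed simp

lemma inner_fproj_self:
  assumes "finite F" "ortho_family e F"
  shows "inner (fproj e F v) (fproj e F v) = (\<Sum>i\<in>F. (inner (e i) v)^2)"
  using inner_fproj[OF assms, of _ v]
  by (subst (1) fproj_def) (simp add: inner_sum_left power2_eq_square)

lemma norm_diff_fproj: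
  assumes "finite F" "ortho_family e F"
  shows "(norm (v - fproj e F v))^2 = (norm v)^2 - (\<Sum>i\<in>F. (inner (e i) v)^2)"
proof -
  have "inner (fproj e F v) (v - fproj e F v) = 0"
    by (rule inner_span_fproj[OF assms fproj_in_span])
  then show ?thesis
    using inner_fproj_self[OF assms, of v]
    by (simp add: power2_norm_eq_inner inner_diff_left inner_diff_right inner_commute)
qed

lemma Bessel_inequality:
  assumes "finite F" "ortho_family e F"
  shows "(\<Sum>i\<in>F. (inner (e i) v)^2) \<le> (norm v)^2"
  using norm_diff_fproj[OF assms, of v] by (smt (verit) zero_le_power2)

lemma fproj_best_approximation:
  assumes "finite F" "ortho_family e F" "w \<in> span (e ` F)"
  shows "norm (v - fproj e F v) \<le> norm (v - w)"
proof -
  have "fproj e F v - w \<in> span (e ` F)"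
    by (intro span_diff fproj_in_span assms)
  then have 0: "inner (fproj e F v - w) (v - fproj e F v) = 0"
    by (rule inner_span_fproj[OF assms(1,2)])
  have "v - w = (v - fproj e F v) + (fproj e F v - w)" by simp
  then have "(norm (v - w))^2 = (norm (v - fproj e F v))^2 + (norm (fproj e F v - w))^2"
    using 0 by (simp only: power2_norm_eq_inner inner_add_left inner_add_right)
      (simp add: inner_commute)
  then have "(norm (v - fproj e F v))^2 \<le> (norm (v - w))^2" by simp
  then show ?thesis by (rule power2_le_imp_le) simp
qed

text \<open>Density speaks of the span of a set of vectors, projections of finite sets of indices. A
  linear combination involves finitely many vectors, and finitely many indices name them.\<close>

lemma total_family_approx:
  assumes "total_family e I" "0 < \<epsilon>"
  obtains F w where "finite F" "F \<subseteq> I" "w \<in> span (e ` F)" "norm (v - w) < \<epsilon>"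
proof -
  have "v \<in> closure (span (e ` I))" using assms by (simp add: total_family_def)
  then obtain w where w: "w \<in> span (e ` I)" "dist w v < \<epsilon>"
    using assms(2) by (meson closure_approachable)
  obtain T r where T: "finite T" "T \<subseteq> e ` I" "w = (\<Sum>a\<in>T. r a *\<^sub>R a)"
    using w(1) unfolding span_explicit by blast
  then have "w \<in> span T" by (auto intro: span_sum span_scale span_base)
  obtain F where "F \<subseteq> I" "finite F" "T = e ` F"
    using finite_subset_image[OF T(1,2)] by blast
  with \<open>w \<in> span T\<close> w show thesis by (intro that[of F w]) (auto simp: dist_norm norm_minus_commute)
qed

text \<open>Once finitely many indices span a vector within \<open>sqrt \<epsilon>\<close> of
  \<open>v\<close>, best approximation keeps the projection error below
  \<open>sqrt \<epsilon>\<close> for every larger finite index set, and the squared error is the gap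
  in Bessel's inequality. The unordered sum is used because the basis in the definition of the trace
  norm is a set without enumeration.\<close>

lemma Parseval_has_sum:
  assumes "total_family e I"
  shows "((\<lambda>i. (inner (e i) v)^2) has_sum (norm v)^2) I"
  unfolding has_sum_def tendsto_iff eventually_finite_subsets_at_top
proof (intro allI impI)
  fix \<epsilon> :: real assume "0 < \<epsilon>"
  then obtain F w where F: "finite F" "F \<subseteq> I" "w \<in> span (e ` F)" "norm (v - w) < sqrt \<epsilon>"
    using total_family_approx[OF assms, of "sqrt \<epsilon>" v] by (metis real_sqrt_gt_zero)
  show "\<exists>A. finite A \<and> A \<subseteq> I \<and> (\<forall>B. finite B \<and> A \<subseteq> B \<and> B \<subseteq> I \<longrightarrow>
      dist (sum (\<lambda>i. (inner (e i) v)^2) B) ((norm v)^2) < \<epsilon>)"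
  proof (intro exI conjI allI impI)
    fix B assume B: "finite B \<and> F \<subseteq> B \<and> B \<subseteq> I"
    have o: "ortho_family e B" using assms B ortho_family_subset total_family_ortho by metis
    have "w \<in> span (e ` B)" using F(3) B by (meson image_mono span_mono subsetD)
    then have "norm (v - fproj e B v) < sqrt \<epsilon>"
      using fproj_best_approximation[OF _ o, of w v] B F(4) by linarith
    then have "(norm (v - fproj e B v))^2 < \<epsilon>"
      using \<open>0 < \<epsilon>\<close> by (metis norm_ge_zero real_less_rsqrt real_sqrt_abs abs_of_nonneg real_sqrt_less_iff)
    then show "dist (\<Sum>i\<in>B. (inner (e i) v)^2) ((norm v)^2) < \<epsilon>"
      using norm_diff_fproj[OF _ o, of v] B Bessel_inequality[OF _ o, of v] by (simp add: dist_real_def)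
  qed (use F in auto)
qed

lemma Parseval_sums:
  fixes e :: "nat \<Rightarrow> 'b::real_inner"
  assumes "total_family e UNIV"
  shows "(\<lambda>i. (inner (e i) v)^2) sums (norm v)^2"
  by (rule has_sum_imp_sums[OF Parseval_has_sum[OF assms]])

lemma fproj_tendsto:
  fixes e :: "nat \<Rightarrow> 'b::real_inner"
  assumes "total_family e UNIV"
  shows "(\<lambda>k. fproj e {..<k} v) \<longlonglongrightarrow> v"
proof -
  have o: "ortho_family e {..<k}" for k
    using assms ortho_family_subset total_family_ortho by (metis subset_UNIV)
  have "(\<lambda>k. (norm v)^2 - (\<Sum>i<k. (inner (e i) v)^2)) \<longlonglongrightarrow> (norm v)^2 - (norm v)^2"
    by (intro tendsto_diff tendsto_const Parseval_sums[OF assms, unfolded sums_def])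
  then have "(\<lambda>k. (norm (v - fproj e {..<k} v))^2) \<longlonglongrightarrow> 0"
    using norm_diff_fproj[OF _ o] by simp
  then have "(\<lambda>k. norm (v - fproj e {..<k} v)) \<longlonglongrightarrow> 0"
    by (rule power_tendsto_0_iff[THEN iffD1, rotated]) simp
  then have "(\<lambda>k. v - fproj e {..<k} v) \<longlonglongrightarrow> 0"
    by (rule tendsto_norm_zero_cancel)
  from tendsto_diff[OF tendsto_const[of v] this] show ?thesis by simp
qed

section \<open>Gram-Schmidt orthonormalisation of a dense sequence\<close>

text \<open>\<open>sgn\<close> normalises a nonzero remainder and keeps a zero one, so an element
  that depends on its predecessors yields the zero vector instead of being skipped.\<close>

fun gram_schmidt :: "(nat \<Rightarrow> 'b::real_inner) \<Rightarrow> nat \<Rightarrow> 'b" where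
  "gram_schmidt d n = sgn (d n - (\<Sum>i<n. inner (gram_schmidt d i) (d n) *\<^sub>R gram_schmidt d i))"

declare gram_schmidt.simps [simp del]

lemma ortho_gram_schmidt: "ortho_family (gram_schmidt d) {..<n}"
proof (induction n)
  case 0
  then show ?case by (simp add: ortho_family_def)
next
  case (Suc n)
  let ?e = "gram_schmidt d"
  have eq: "?e n = sgn (d n - fproj ?e {..<n} (d n))"
    by (subst gram_schmidt.simps) (simp add: fproj_def)
  have "inner (?e i) (?e n) = 0" if "i < n" for i
    unfolding eq sgn_div_norm
    using inner_span_fproj[OF _ Suc, of "?e i" "d n"] that by (auto simp: span_base)
  then have "inner (?e n) (?e i) = 0" if "i < n" for i using that by (simp add: inner_commute)
  moreover have "?e n = 0 \<or> norm (?e n) = 1" unfolding eq by (auto simp: norm_sgn sgn_zero_iff)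
  ultimately show ?case
    using Suc \<open>\<And>i. i < n \<Longrightarrow> inner (?e i) (?e n) = 0\<close>
    unfolding ortho_family_def lessThan_Suc by auto
qed

lemma gram_schmidt_span: "d n \<in> span (range (gram_schmidt d))"
proof -
  let ?e = "gram_schmidt d"
  let ?r = "d n - fproj ?e {..<n} (d n)"
  have "?e n = sgn ?r" by (subst gram_schmidt.simps) (simp add: fproj_def)
  then have "?r = norm ?r *\<^sub>R ?e n" by (cases "?r = 0") (simp_all add: sgn_div_norm)
  then have "d n = fproj ?e {..<n} (d n) + norm ?r *\<^sub>R ?e n" by (simp add: algebra_simps)
  moreover have "fproj ?e {..<n} (d n) \<in> span (range ?e)"
    using fproj_in_span[of ?e "{..<n}" "d n"] span_mono[of "?e ` {..<n}" "range ?e"] by blast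
  ultimately show ?thesis
    by (metis rangeI span_add span_base span_scale)
qed

text \<open>Every member of an enumerated countable dense set lies in the span of the Gram-Schmidt
  output, so that span is dense.\<close>

lemma exists_total_family:
  "\<exists>e :: nat \<Rightarrow> 'b::{real_inner,second_countable_topology}. total_family e UNIV"
proof -
  obtain D :: "'b set" where D: "countable D" "\<And>X. open X \<Longrightarrow> X \<noteq> {} \<Longrightarrow> \<exists>d\<in>D. d \<in> X"
    using countable_dense_exists by blast
  then have "D \<noteq> {}" by (metis empty_iff open_UNIV UNIV_not_empty)
  define e where "e = gram_schmidt (from_nat_into D)"
  have "D \<subseteq> span (range e)"
    using gram_schmidt_span[of "from_nat_into D"] range_from_nat_into[OF \<open>D \<noteq> {}\<close> D(1)]
    unfolding e_def by (metis image_subset_iff)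
  moreover have "closure D = UNIV"
  proof -
    have "x \<in> closure D" for x
      unfolding closure_iff_nhds_not_empty
      using D(2) by (metis (no_types, lifting) disjoint_iff empty_iff subsetD)
    then show ?thesis by blast
  qed
  ultimately have "closure (span (range e)) = UNIV"
    by (metis UNIV_I closure_mono subsetI subset_antisym subset_UNIV)
  moreover have "ortho_family e UNIV"
  proof -
    have "i \<in> {..<Suc (max i j)}" "j \<in> {..<Suc (max i j)}" for i j :: nat by auto
    then show ?thesis
      using ortho_gram_schmidt[of "from_nat_into D"] unfolding ortho_family_def e_def by blast
  qed
  ultimately show ?thesis unfolding total_family_def by blast
qed

section \<open>Positive operators and the trace norm\<close>

text \<open>Only algebraic linearity is asked for, so that the property passes to Cholesky residuals
  without norm estimates; boundedness is added where limits are taken.\<close>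

definition positive_operator :: "('b::real_inner \<Rightarrow> 'b) \<Rightarrow> bool" where
  "positive_operator P \<longleftrightarrow>
     linear P \<and> (\<forall>u v. inner (P u) v = inner u (P v)) \<and> (\<forall>u. 0 \<le> inner (P u) u)"

lemma positive_operator_Cauchy_Schwarz:
  assumes "positive_operator P"
  shows "(inner (P u) v)^2 \<le> inner (P u) u * inner (P v) v"
proof -
  let ?a = "inner (P v) v" and ?b = "inner (P u) v" and ?c = "inner (P u) u"
  have lin: "linear P" and sym: "\<And>u v. inner (P u) v = inner u (P v)"
    and nn: "\<And>u. 0 \<le> inner (P u) u"
    using assms by (auto simp: positive_operator_def)
  have q: "0 \<le> ?c - 2 * t * ?b + t^2 * ?a" for t
  proof -
    have "inner (P v) u = ?b" by (metis inner_commute sym)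
    then have "inner (P (u - t *\<^sub>R v)) (u - t *\<^sub>R v) = ?c - 2 * t * ?b + t^2 * ?a"
      by (simp add: linear_diff[OF lin] linear_scale[OF lin] inner_diff_left inner_diff_right
          power2_eq_square algebra_simps)
    then show ?thesis using nn[of "u - t *\<^sub>R v"] by simp
  qed
  show ?thesis
  proof (cases "?a = 0")
    case True
    have "?b = 0"
    proof (rule ccontr)
      assume "?b \<noteq> 0"
      \<comment> \<open>If \<open>inner (P v) v = 0\<close>, the polynomial \<open>q\<close> is
        affine in \<open>t\<close>; at this \<open>t\<close> its value would be
        \<open>-1\<close>.\<close>
      then show False using q[of "(?c + 1) / (2 * ?b)"] True by simp
    qed
    then show ?thesis using True by simp
  next
    case False
    then have "0 < ?a" using nn[of v] by simp
    \<comment> \<open>The minimiser of the quadratic polynomial is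
      \<open>t = ?b / ?a\<close>.\<close>
    have "0 \<le> ?c - 2 * (?b / ?a) * ?b + (?b / ?a)^2 * ?a" by (rule q)
    also have "... = ?c - ?b^2 / ?a" using False by (simp add: field_simps power2_eq_square)
    finally show ?thesis using \<open>0 < ?a\<close> by (simp add: pos_divide_le_eq)
  qed
qed

text \<open>This is the elimination step of the Cholesky factorisation. If the pivot vanishes, then so does
  the subtracted term, because \<open>c / 0 = 0\<close>; this is correct by the Cauchy-Schwarz inequality.\<close>

primrec chol_residual :: "('b::real_inner \<Rightarrow> 'b) \<Rightarrow> (nat \<Rightarrow> 'b) \<Rightarrow> nat \<Rightarrow> 'b \<Rightarrow> 'b" where
  "chol_residual P e 0 = P"
| "chol_residual P e (Suc k) = (\<lambda>v. chol_residual P e k v -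
     (inner (chol_residual P e k (e k)) v / inner (chol_residual P e k (e k)) (e k)) *\<^sub>R
       chol_residual P e k (e k))"

text \<open>A column of the Cholesky factor: its outer product with itself is the term that the step
  from \<open>k\<close> to \<open>Suc k\<close> subtracts. A zero pivot gives the zero vector,
  because \<open>inverse 0 = 0\<close>.\<close>

definition chol_vector :: "('b::real_inner \<Rightarrow> 'b) \<Rightarrow> (nat \<Rightarrow> 'b) \<Rightarrow> nat \<Rightarrow> 'b" where
  "chol_vector P e k =
     chol_residual P e k (e k) /\<^sub>R sqrt (inner (chol_residual P e k (e k)) (e k))"

section \<open>The Cholesky factorisation of a positive operator\<close>

context
  fixes P :: "'b::real_inner \<Rightarrow> 'b" and e :: "nat \<Rightarrow> 'b"
  assumes P: "positive_operator P"
begin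

lemma inner_chol_residual_Suc:
  assumes "positive_operator (chol_residual P e k)"
  shows "inner (chol_residual P e (Suc k) v) v =
    inner (chol_residual P e k v) v - (inner (chol_vector P e k) v)^2"
proof -
  have "0 \<le> inner (chol_residual P e k (e k)) (e k)"
    using assms by (auto simp: positive_operator_def)
  then show ?thesis
    by (simp add: chol_vector_def inner_diff_left power_mult_distrib power_divide divide_inverse
        power_inverse) (simp add: power2_eq_square)
qed

text \<open>That the subtracted rank-one term does not exceed the quadratic form is the
  Cauchy-Schwarz inequality of the current residual, applied to \<open>e k\<close>.\<close>

lemma positive_chol_residual: "positive_operator (chol_residual P e k)"
proof (induction k)
  case 0
  then show ?case using P by simp
next
  case (Suc k)
  let ?Q = "chol_residual P e k"
  have lin: "linear ?Q" and sym: "\<And>u v. inner (?Q u) v = inner u (?Q v)"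
    and nn: "\<And>u. 0 \<le> inner (?Q u) u"
    using Suc by (auto simp: positive_operator_def)
  have "0 \<le> inner (chol_residual P e (Suc k) u) u" for u
  proof (cases "inner (?Q (e k)) (e k) = 0")
    case True
    then show ?thesis using nn by simp
  next
    case False
    then have "(inner (?Q (e k)) u)^2 / inner (?Q (e k)) (e k) \<le> inner (?Q u) u"
      using positive_operator_Cauchy_Schwarz[OF Suc, of "e k" u] nn[of "e k"]
      by (subst pos_divide_le_eq) (auto simp: mult.commute order_less_le)
    then show ?thesis by (simp add: inner_diff_left power2_eq_square)
  qed
  moreover have "linear (chol_residual P e (Suc k))"
    by (rule linearI) (simp_all add: linear_add[OF lin] linear_scale[OF lin] inner_add_right
        add_divide_distrib scaleR_add_left scaleR_diff_right)
  moreover have "inner (chol_residual P e (Suc k) u) v = inner u (chol_residual P e (Suc k) v)" for u v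
    using sym[of u v] sym[of "e k" u] sym[of "e k" v]
    by (simp add: inner_diff_left inner_diff_right inner_commute)
  ultimately show ?case by (simp add: positive_operator_def)
qed

lemma inner_chol_vector_sum:
  "inner (chol_residual P e n v) v = inner (P v) v - (\<Sum>k<n. (inner (chol_vector P e k) v)^2)"
  by (induction n) (simp_all add: inner_chol_residual_Suc[OF positive_chol_residual] del: chol_residual.simps(2))

lemma sum_chol_vector_le: "(\<Sum>k<n. (inner (chol_vector P e k) v)^2) \<le> inner (P v) v"
  using inner_chol_vector_sum[of n v] positive_chol_residual[of n]
  by (simp add: positive_operator_def) (metis diff_ge_0_iff_ge)

text \<open>Step \<open>k\<close> annihilates \<open>e k\<close>; if the pivot is 0, the residual
  already vanishes there by Cauchy-Schwarz. Vectors annihilated earlier stay so, since by symmetry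
  the pivot column is orthogonal to them.\<close>

lemma chol_residual_eq_0: "j < k \<Longrightarrow> chol_residual P e k (e j) = 0"
proof (induction k)
  case (Suc k)
  let ?Q = "chol_residual P e k"
  show ?case
  proof (cases "j = k")
    case True
    show ?thesis
    proof (cases "inner (?Q (e k)) (e k) = 0")
      case 0: True
      have "(inner (?Q (e k)) v)^2 \<le> 0" for v
        using positive_operator_Cauchy_Schwarz[OF positive_chol_residual, of k "e k" v] 0 by simp
      then have "?Q (e k) = 0" by (metis inner_eq_zero_iff power2_less_eq_zero_iff)
      then show ?thesis using True by simp
    qed (simp add: True)
  next
    case False
    then have "?Q (e j) = 0" using Suc by simp
    moreover have "inner (?Q (e k)) (e j) = inner (e k) (?Q (e j))"
      using positive_chol_residual[of k] by (auto simp: positive_operator_def)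
    ultimately show ?thesis by simp
  qed
qed simp

text \<open>Triangularity of the factor. It makes each coordinate of the Gaussian vector constructed
  below a finite sum.\<close>

lemma inner_chol_vector_eq_0: "j < k \<Longrightarrow> inner (chol_vector P e k) (e j) = 0"
proof -
  assume "j < k"
  have "inner (chol_residual P e k (e k)) (e j) = inner (e k) (chol_residual P e k (e j))"
    using positive_chol_residual[of k] by (auto simp: positive_operator_def)
  then show ?thesis using chol_residual_eq_0[OF \<open>j < k\<close>] by (simp add: chol_vector_def)
qed

lemma chol_residual_span:
  assumes "w \<in> span (e ` {..<n})" "n \<le> k"
  shows "chol_residual P e k w = 0"
  using assms(1)
proof (induction rule: span_induct_alt)
  case base
  then show ?case using positive_chol_residual[of k] linear_0 by (auto simp: positive_operator_def)
next
  case (step c x y)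
  have "linear (chol_residual P e k)"
    using positive_chol_residual[of k] by (auto simp: positive_operator_def)
  then show ?case using step chol_residual_eq_0 assms(2) by (auto simp: linear_add linear_scale)
qed

lemma chol_finite:
  assumes "w \<in> span (e ` {..<n})"
  shows "inner (P w) w = (\<Sum>k<n. (inner (chol_vector P e k) w)^2)"
  using inner_chol_vector_sum[of n w] chol_residual_span[OF assms order_refl] by simp

text \<open>The residual form is dominated by that of \<open>P\<close> and vanishes on the span of
  the first vectors. Approximating \<open>v\<close> by an element \<open>w\<close> of that span
  leaves a remainder of at most \<open>B * (norm (v - w))^2\<close>.\<close>

lemma chol_sums:
  assumes "bounded_linear P" and e: "total_family e UNIV"
  shows "(\<lambda>k. (inner (chol_vector P e k) v)^2) sums inner (P v) v"
  unfolding sums_def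
proof (rule LIMSEQ_I)
  fix \<epsilon> :: real assume "0 < \<epsilon>"
  obtain B where B: "0 < B" "\<And>u. norm (P u) \<le> norm u * B"
    using bounded_linear.pos_bounded[OF assms(1)] by blast
  obtain F w where F: "finite F" "w \<in> span (e ` F)" "norm (v - w) < sqrt (\<epsilon> / B)"
    using total_family_approx[OF e, of "sqrt (\<epsilon> / B)" v] B(1) \<open>0 < \<epsilon>\<close> by auto
  obtain N where "F \<subseteq> {..<N}" using F(1) finite_nat_iff_bounded by blast
  then have w: "w \<in> span (e ` {..<N})" using F(2) by (meson image_mono span_mono subsetD)
  show "\<exists>N. \<forall>n\<ge>N. norm ((\<Sum>k<n. (inner (chol_vector P e k) v)^2) - inner (P v) v) < \<epsilon>"
  proof (intro exI allI impI)
    fix n assume "N \<le> n"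
    let ?Q = "chol_residual P e n"
    have lin: "linear ?Q" and sym: "\<And>u v. inner (?Q u) v = inner u (?Q v)"
      and nn: "\<And>u. 0 \<le> inner (?Q u) u"
      using positive_chol_residual[of n] by (auto simp: positive_operator_def)
    have "?Q w = 0" by (rule chol_residual_span[OF w \<open>N \<le> n\<close>])
    \<comment> \<open>The residual is symmetric and annihilates \<open>w\<close>, so its form does
      not distinguish \<open>v\<close> from \<open>v - w\<close>.\<close>
    then have "inner (?Q v) v = inner (?Q (v - w)) (v - w)"
      by (simp add: linear_diff[OF lin] inner_diff_right sym)
    also have "... \<le> inner (P (v - w)) (v - w)"
      unfolding inner_chol_vector_sum by (simp add: sum_nonneg)
    also have "... \<le> norm (P (v - w)) * norm (v - w)" by (rule norm_cauchy_schwarz)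
    also have "... \<le> (norm (v - w) * B) * norm (v - w)" by (intro mult_right_mono B) simp
    also have "... = (norm (v - w))^2 * B" by (simp add: power2_eq_square)
    also have "... < (sqrt (\<epsilon> / B))^2 * B"
      using F(3) B(1) by (intro mult_strict_right_mono power_strict_mono) auto
    also have "... = \<epsilon>" using B(1) \<open>0 < \<epsilon>\<close> by simp
    finally show "norm ((\<Sum>k<n. (inner (chol_vector P e k) v)^2) - inner (P v) v) < \<epsilon>"
      using inner_chol_vector_sum[of n v] nn[of v] by simp
  qed
qed

end

section \<open>Traces of positive operators and the bound by the trace norm\<close>

lemma has_sum_finite_sum:
  fixes f :: "'k \<Rightarrow> 'i \<Rightarrow> 'b::topological_comm_monoid_add"
  assumes "finite F" "\<And>k. k \<in> F \<Longrightarrow> (f k has_sum s k) I"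
  shows "((\<lambda>i. \<Sum>k\<in>F. f k i) has_sum (\<Sum>k\<in>F. s k)) I"
  using assms by (induction F rule: finite_induct) (auto intro: has_sum_add)

text \<open>The Cholesky vectors \<open>a k\<close> stand in for the square root of
  \<open>P\<close>. Along the family \<open>f\<close> the sum is the double sum of
  \<open>(inner (a k) (f j))^2\<close>, at most the sum of \<open>(norm (a k))^2\<close> by Bessel.
  Parseval expands the latter along \<open>e\<close>, where each finite sum over \<open>k\<close> is
  dominated by the form of \<open>P\<close>, hence in total by \<open>t\<close>.\<close>

lemma positive_trace_le:
  fixes P :: "'b::{real_inner,second_countable_topology} \<Rightarrow> 'b"
  assumes P: "positive_operator P" "bounded_linear P" and E: "total_family e I"
    and t: "((\<lambda>i. inner (P (e i)) (e i)) has_sum t) I"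
    and f: "finite J" "ortho_family f J"
  shows "(\<Sum>j\<in>J. inner (P (f j)) (f j)) \<le> t"
proof -
  obtain d :: "nat \<Rightarrow> 'b" where d: "total_family d UNIV" using exists_total_family by blast
  let ?a = "chol_vector P d"
  have *: "(\<Sum>k<n. (norm (?a k))^2) \<le> t" for n
  proof (rule has_sum_mono)
    show "((\<lambda>i. \<Sum>k<n. (inner (e i) (?a k))^2) has_sum (\<Sum>k<n. (norm (?a k))^2)) I"
      by (intro has_sum_finite_sum Parseval_has_sum[OF E]) simp
    show "(\<Sum>k<n. (inner (e i) (?a k))^2) \<le> inner (P (e i)) (e i)" for i
      using sum_chol_vector_le[OF P(1), where v="e i" and e=d and n=n] by (simp add: inner_commute)
  qed (rule t)
  have "(\<lambda>k. \<Sum>j\<in>J. (inner (?a k) (f j))^2) sums (\<Sum>j\<in>J. inner (P (f j)) (f j))"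
    by (intro sums_sum chol_sums[OF P d])
  then have "(\<lambda>n. \<Sum>k<n. \<Sum>j\<in>J. (inner (?a k) (f j))^2) \<longlonglongrightarrow> (\<Sum>j\<in>J. inner (P (f j)) (f j))"
    by (simp add: sums_def)
  then show ?thesis
  proof (rule LIMSEQ_le_const2, intro exI allI impI)
    fix n
    have "(\<Sum>k<n. \<Sum>j\<in>J. (inner (?a k) (f j))^2) \<le> (\<Sum>k<n. (norm (?a k))^2)"
      by (intro sum_mono) (simp add: inner_commute[of "?a _"] Bessel_inequality[OF f])
    then show "(\<Sum>k<n. \<Sum>j\<in>J. (inner (?a k) (f j))^2) \<le> t" using *[of n] by simp
  qed
qed

text \<open>If \<open>\<lambda>\<close>, the supremum of the quadratic form of \<open>T - P\<close> on the unit sphere, were positive, then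
  an approximate eigenvector \<open>v\<close> would give \<open>T v \<approx> P v + \<lambda> v\<close>, hence \<open>\<parallel>T v\<parallel> > \<parallel>P v\<parallel>\<close>.\<close>

lemma inner_le_of_norm_eq:
  fixes T P :: "'b::real_inner \<Rightarrow> 'b"
  assumes T: "bounded_linear T" "\<And>u v. inner (T u) v = inner u (T v)"
    and P: "bounded_linear P" "positive_operator P"
    and eq: "\<And>v. norm (T v) = norm (P v)"
  shows "inner (T v) v \<le> inner (P v) v"
proof (rule ccontr)
  assume "\<not> inner (T v) v \<le> inner (P v) v"
  then have pos: "0 < inner (T v - P v) v" by (simp add: inner_diff_left)
  then have "v \<noteq> 0" by auto
  define D where "D w = T w - P w" for w
  have D: "bounded_linear D" unfolding D_def by (intro bounded_linear_sub T P)
  have linD: "linear D" by (rule bounded_linear.linear[OF D])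
  have symP: "inner (P u) v = inner u (P v)" for u v using P(2) by (auto simp: positive_operator_def)
  have symD: "inner (D u) v = inner u (D v)" for u v
    by (simp add: D_def inner_diff_left inner_diff_right T symP)
  obtain B where B: "0 < B" "\<And>u. norm (D u) \<le> norm u * B"
    using bounded_linear.pos_bounded[OF D] by blast
  define \<Lambda> where "\<Lambda> = (SUP w\<in>sphere 0 1. inner (D w) w)"
  have bdd: "bdd_above ((\<lambda>w. inner (D w) w) ` sphere 0 1)"
  proof (rule bdd_aboveI2)
    fix w :: 'b assume "w \<in> sphere 0 1"
    then show "inner (D w) w \<le> B" using B(2)[of w] norm_cauchy_schwarz[of "D w" w] by simp
  qed
  have le: "inner (D w) w \<le> \<Lambda> * (norm w)^2" for w
  proof (cases "w = 0")
    case False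
    have "inner (D (sgn w)) (sgn w) \<le> \<Lambda>"
      unfolding \<Lambda>_def by (intro cSUP_upper bdd) (simp add: norm_sgn False)
    moreover have "inner (D (sgn w)) (sgn w) = inner (D w) w / (norm w)^2"
      by (simp add: sgn_div_norm linear_scale[OF linD] power2_eq_square divide_inverse)
    ultimately show ?thesis using False by (simp add: pos_divide_le_eq)
  qed (simp add: linear_0[OF linD])
  have "0 < \<Lambda>" using pos le[of v] \<open>v \<noteq> 0\<close>
    by (metis D_def less_le_trans mult_le_0_iff not_le zero_le_power2 less_eq_real_def)
  define S where "S w = \<Lambda> *\<^sub>R w - D w" for w
  have S: "bounded_linear S" unfolding S_def
    by (intro bounded_linear_sub bounded_linear_scaleR_right D)
  have "positive_operator S" unfolding positive_operator_def
    using le bounded_linear.linear[OF S]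
    by (simp add: S_def inner_diff_left inner_diff_right symD power2_norm_eq_inner)
  obtain C where C: "0 < C" "\<And>u. norm (S u) \<le> norm u * C"
    using bounded_linear.pos_bounded[OF S] by blast
  obtain A where A: "0 < A" "\<And>u. norm (T u) \<le> norm u * A"
    using bounded_linear.pos_bounded[OF T(1)] by blast
  \<comment> \<open>The two bounds keep \<open>2 * A * norm (S w)\<close> below
    \<open>\<Lambda>^2 / 2\<close> and \<open>(norm (S w))^2\<close> at most
    \<open>\<Lambda>^2 / 4\<close>, whereas the final estimate demands that they add up to
    \<open>\<Lambda>^2\<close>.\<close>
  define \<epsilon> where "\<epsilon> = min (\<Lambda>^2 / (4 * A)) (\<Lambda> / 2)"
  have "0 < \<epsilon>" using \<open>0 < \<Lambda>\<close> A by (simp add: \<epsilon>_def)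
  have "\<exists>w\<in>sphere 0 1. \<Lambda> - \<epsilon>^2 / C < inner (D w) w"
  proof -
    have "sphere (0::'b) 1 \<noteq> {}" using \<open>v \<noteq> 0\<close> norm_sgn[of v] by (metis empty_iff mem_sphere_0)
    moreover have "\<Lambda> - \<epsilon>^2 / C < (SUP w\<in>sphere 0 1. inner (D w) w)"
      using \<open>0 < \<epsilon>\<close> C by (simp add: \<Lambda>_def[symmetric])
    ultimately show ?thesis using less_cSUP_iff[OF _ bdd] by blast
  qed
  then obtain w where w: "norm w = 1" "\<Lambda> - \<epsilon>^2 / C < inner (D w) w" by auto
  have "inner (S w) w < \<epsilon>^2 / C"
    using w by (simp add: S_def inner_diff_left dot_square_norm)
  \<comment> \<open>Cauchy-Schwarz for the form of \<open>S\<close> gives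
    \<open>(norm (S w))^2 \<le> C * inner (S w) w\<close>; this is why \<open>w\<close> was chosen
    with tolerance \<open>\<epsilon>^2 / C\<close>.\<close>
  have "(inner (S w) (S w))^2 \<le> inner (S w) w * inner (S (S w)) (S w)"
    by (rule positive_operator_Cauchy_Schwarz) fact
  also have "... \<le> inner (S w) w * (C * (norm (S w))^2)"
  proof (rule mult_left_mono)
    have "inner (S (S w)) (S w) \<le> norm (S (S w)) * norm (S w)" by (rule norm_cauchy_schwarz)
    also have "... \<le> (norm (S w) * C) * norm (S w)" by (intro mult_right_mono C) simp
    finally show "inner (S (S w)) (S w) \<le> C * (norm (S w))^2"
      by (simp add: power2_eq_square algebra_simps)
  qed (use \<open>positive_operator S\<close> in \<open>auto simp: positive_operator_def\<close>)
  finally have "(norm (S w))^2 * (norm (S w))^2 \<le> (inner (S w) w * C) * (norm (S w))^2"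
    by (simp add: dot_square_norm power2_eq_square algebra_simps)
  then have "S w = 0 \<or> (norm (S w))^2 \<le> inner (S w) w * C"
    using mult_right_le_imp_le[of "(norm (S w))^2" "(norm (S w))^2"] by fastforce
  moreover have "inner (S w) w * C < \<epsilon>^2"
    using \<open>inner (S w) w < \<epsilon>^2 / C\<close> C by (simp add: pos_less_divide_eq)
  ultimately have "(norm (S w))^2 < \<epsilon>^2" using \<open>0 < \<epsilon>\<close> by auto
  then have Sw: "norm (S w) < \<epsilon>" using \<open>0 < \<epsilon>\<close> by (simp add: power2_less_imp_less)
  \<comment> \<open>The square of the right side is at least
    \<open>(norm (P w))^2 + \<Lambda>^2\<close>, as \<open>P\<close> is positive. The square of the
    left side exceeds \<open>(norm (T w))^2\<close>, which equals \<open>(norm (P w))^2\<close>, by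
    a quantity controlled by \<open>norm (S w)\<close>.\<close>
  have 1: "T w + S w = P w + \<Lambda> *\<^sub>R w" by (simp add: S_def D_def)
  have "(norm (P w + \<Lambda> *\<^sub>R w))^2 = (norm (P w))^2 + 2 * \<Lambda> * inner (P w) w + \<Lambda>^2"
    using w(1) by (simp only: power2_norm_eq_inner inner_add_left inner_add_right)
      (simp add: inner_commute dot_square_norm power2_eq_square)
  moreover have "0 \<le> inner (P w) w" using P(2) by (auto simp: positive_operator_def)
  ultimately have 2: "(norm (P w))^2 + \<Lambda>^2 \<le> (norm (T w + S w))^2"
    using \<open>0 < \<Lambda>\<close> 1 by simp
  have "(norm (T w + S w))^2 = (norm (T w))^2 + 2 * inner (T w) (S w) + (norm (S w))^2"
    by (simp only: power2_norm_eq_inner inner_add_left inner_add_right) (simp add: inner_commute)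
  also have "inner (T w) (S w) \<le> A * norm (S w)"
    using norm_cauchy_schwarz[of "T w" "S w"] mult_right_mono[OF A(2)[of w], of "norm (S w)"] w(1)
    by simp
  finally have 3: "\<Lambda>^2 \<le> 2 * (A * norm (S w)) + (norm (S w))^2" using 2 eq[of w] by simp
  have "2 * (A * norm (S w)) < \<Lambda>^2 / 2"
  proof -
    have "A * norm (S w) < A * \<epsilon>" using Sw A by simp
    also have "... \<le> A * (\<Lambda>^2 / (4 * A))" using A by (intro mult_left_mono) (auto simp: \<epsilon>_def)
    also have "... = \<Lambda>^2 / 4" using A by simp
    finally show ?thesis by simp
  qed
  moreover have "(norm (S w))^2 \<le> (\<Lambda> / 2)^2"
    using Sw by (intro power_mono) (auto simp: \<epsilon>_def)
  then have "(norm (S w))^2 \<le> \<Lambda>^2 / 4" by (simp add: power_divide)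
  moreover have "0 < \<Lambda>^2" using \<open>0 < \<Lambda>\<close> by simp
  ultimately show False using 3 by linarith
qed

text \<open>Symmetry of \<open>A\<close> makes \<open>T\<close> self-adjoint. Then \<open>T\<close>
  and \<open>- T\<close> are both dominated by the modulus \<open>P\<close> as quadratic forms, and
  the diagonal sum of \<open>P\<close> along \<open>f\<close> is at most its trace, whichever basis
  computes the trace.\<close>

lemma trace_norm_bound:
  fixes A :: "'b::{real_inner,second_countable_topology} \<Rightarrow> 'b \<Rightarrow> real"
  assumes "has_trace_norm A t" and sym: "\<And>u v. A u v = A v u"
    and f: "finite J" "ortho_family f J"
  shows "\<bar>\<Sum>j\<in>J. A (f j) (f j)\<bar> \<le> t"
proof -
  obtain T P E where T: "bounded_linear T" "\<And>u v. A u v = inner (T u) v"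
    and P: "operator_modulus T P" and E: "orthonormal_basis E"
    and t: "((\<lambda>e. inner (P e) e) has_sum t) E"
    using assms(1) unfolding has_trace_norm_def by blast
  have bP: "bounded_linear P" and pP: "positive_operator P"
    and eq: "norm (T v) = norm (P v)" for v
    using P bounded_linear.linear
    by (auto simp: operator_modulus_def positive_operator_def norm_eq_sqrt_inner)
  \<comment> \<open>The basis is a bare set, treated as a family indexed by itself.\<close>
  have tot: "total_family (\<lambda>e. e) E"
    using E by (auto simp: orthonormal_basis_def total_family_def ortho_family_def)
  have tr: "(\<Sum>j\<in>J. inner (P (f j)) (f j)) \<le> t"
    by (rule positive_trace_le[OF pP bP tot _ f]) (use t in simp)
  have symT: "inner (T u) v = inner u (T v)" for u v
    using sym[of u v] by (simp add: T inner_commute)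
  have "inner (T v) v \<le> inner (P v) v" for v
    by (rule inner_le_of_norm_eq[OF T(1) symT bP pP eq])
  moreover have "inner (- T v) v \<le> inner (P v) v" for v
    by (rule inner_le_of_norm_eq[OF bounded_linear_minus[OF T(1)] _ bP pP]) (simp_all add: symT eq)
  ultimately have "\<bar>A v v\<bar> \<le> inner (P v) v" for v
    by (smt (verit) T(2) inner_minus_left)
  then have "\<bar>\<Sum>j\<in>J. A (f j) (f j)\<bar> \<le> (\<Sum>j\<in>J. inner (P (f j)) (f j))"
    by (intro order_trans[OF sum_abs] sum_mono)
  with tr show ?thesis by linarith
qed

text \<open>The one-element family \<open>sgn v\<close> shows that the trace norm dominates the
  numerical radius of a symmetric form.\<close>

lemma trace_norm_bound_quadratic:
  fixes A :: "'b::{real_inner,second_countable_topology} \<Rightarrow> 'b \<Rightarrow> real"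
  assumes "has_trace_norm A t" and "\<And>u v. A u v = A v u"
  shows "\<bar>A v v\<bar> \<le> t * (norm v)^2"
proof (cases "v = 0")
  case True
  have "A 0 0 = 0" using assms(1) unfolding has_trace_norm_def by (metis inner_zero_right)
  then show ?thesis using True by simp
next
  case False
  have "\<bar>\<Sum>j\<in>{()}. A (sgn v) (sgn v)\<bar> \<le> t"
    by (rule trace_norm_bound[OF assms]) (auto simp: ortho_family_def norm_sgn False)
  moreover have "A (sgn v) (sgn v) = A v v / (norm v)^2"
    using assms(1) unfolding has_trace_norm_def
    by (auto simp: sgn_div_norm linear_scale[OF bounded_linear.linear] power2_eq_square divide_inverse)
  ultimately show ?thesis using False by (simp add: pos_divide_le_eq)
qed

section \<open>Weak convergence: test functions\<close>

text \<open>The Pasch-Hausdorff envelope, the greatest \<open>k\<close>-Lipschitz minorant of a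
  function that is bounded below.\<close>

definition inf_convolution :: "('b::metric_space \<Rightarrow> real) \<Rightarrow> nat \<Rightarrow> 'b \<Rightarrow> real" where
  "inf_convolution f k x = (INF y. f y + real k * dist x y)"

context
  fixes f :: "'b::metric_space \<Rightarrow> real" and B :: real
  assumes B: "\<And>x. \<bar>f x\<bar> \<le> B"
begin

lemma inf_convolution_bdd: "bdd_below (range (\<lambda>y. f y + real k * dist x y))"
proof (rule bdd_belowI2)
  show "- B \<le> f y + real k * dist x y" for y
  proof -
    have "0 \<le> real k * dist x y" by simp
    then show ?thesis using abs_le_D2[OF B[of y]] by linarith
  qed
qed

lemma inf_convolution_lower: "- B \<le> inf_convolution f k x"
  unfolding inf_convolution_def
proof (rule cINF_greatest)
  show "- B \<le> f y + real k * dist x y" for y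
  proof -
    have "0 \<le> real k * dist x y" by simp
    then show ?thesis using abs_le_D2[OF B[of y]] by linarith
  qed
qed simp

lemma inf_convolution_le: "inf_convolution f k x \<le> f x"
  using cINF_lower[OF inf_convolution_bdd, of x k x] by (simp add: inf_convolution_def)

lemma abs_inf_convolution_le: "\<bar>inf_convolution f k x\<bar> \<le> B"
  using inf_convolution_lower[of k x] inf_convolution_le[of k x] B[of x] by (simp add: abs_le_iff)

lemma inf_convolution_lipschitz:
  "\<bar>inf_convolution f k x - inf_convolution f k z\<bar> \<le> real k * dist x z"
proof -
  have "inf_convolution f k a \<le> inf_convolution f k b + real k * dist a b" for a b
  proof -
    have "inf_convolution f k a - real k * dist a b \<le> inf_convolution f k b"
      unfolding inf_convolution_def[of f k b]
    proof (rule cINF_greatest)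
      fix y
      have "inf_convolution f k a \<le> f y + real k * dist a y"
        unfolding inf_convolution_def by (rule cINF_lower[OF inf_convolution_bdd]) simp
      also have "... \<le> f y + real k * (dist a b + dist b y)"
        by (intro add_left_mono mult_left_mono dist_triangle) simp
      finally show "inf_convolution f k a - real k * dist a b \<le> f y + real k * dist b y"
        by (simp add: algebra_simps)
    qed simp
    then show ?thesis by simp
  qed
  from this[of x z] this[of z x] show ?thesis by (simp add: abs_le_iff dist_commute)
qed

lemma inf_convolution_tendsto:
  assumes "continuous_on UNIV f"
  shows "(\<lambda>k. inf_convolution f k x) \<longlonglongrightarrow> f x"
proof (rule LIMSEQ_I)
  fix \<epsilon> :: real assume "0 < \<epsilon>"
  have "isCont f x" using assms by (simp add: continuous_on_eq_continuous_at)
  then obtain d where d: "0 < d" "\<And>y. dist y x < d \<Longrightarrow> dist (f y) (f x) < \<epsilon> / 2"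
    using \<open>0 < \<epsilon>\<close> unfolding continuous_at_eps_delta by (metis half_gt_zero)
  \<comment> \<open>From \<open>N\<close> on, the penalty for leaving the ball of radius
    \<open>d\<close> exceeds the oscillation \<open>2 * B\<close>, so only points where
    \<open>f\<close> is close to \<open>f x\<close> can lower the infimum.\<close>
  obtain N :: nat where N: "2 * B / d < real N" using reals_Archimedean2 by blast
  show "\<exists>N. \<forall>k\<ge>N. norm (inf_convolution f k x - f x) < \<epsilon>"
  proof (intro exI allI impI)
    fix k assume "N \<le> k"
    have "f x - \<epsilon> / 2 \<le> inf_convolution f k x"
      unfolding inf_convolution_def
    proof (rule cINF_greatest)
      fix y
      show "f x - \<epsilon> / 2 \<le> f y + real k * dist x y"
      proof (cases "dist y x < d")
        case True
        then have "\<bar>f y - f x\<bar> < \<epsilon> / 2" using d(2)[of y] by (simp add: dist_real_def dist_commute)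
        then have "f x - \<epsilon> / 2 \<le> f y" by linarith
        moreover have "0 \<le> real k * dist x y" by simp
        ultimately show ?thesis by linarith
      next
        case False
        have "2 * B \<le> real N * d" using N d(1) by (simp add: pos_divide_less_eq)
        also have "... \<le> real k * dist x y"
          using \<open>N \<le> k\<close> False d(1) by (intro mult_mono) (auto simp: dist_commute)
        finally show ?thesis using B[of x] B[of y] \<open>0 < \<epsilon>\<close> by (simp add: abs_le_iff)
      qed
    qed simp
    then show "norm (inf_convolution f k x - f x) < \<epsilon>"
      using inf_convolution_le[of k x] \<open>0 < \<epsilon>\<close> by simp
  qed
qed

end

lemma lipschitz_imp_continuous_on:
  fixes f :: "'b::metric_space \<Rightarrow> real"
  assumes "\<And>x y. \<bar>f x - f y\<bar> \<le> C * dist x y"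
  shows "continuous_on UNIV f"
proof -
  have "(max C 0)-lipschitz_on UNIV f"
  proof (rule lipschitz_onI)
    show "dist (f x) (f y) \<le> max C 0 * dist x y" for x y
      using assms[of x y] mult_right_mono[of C "max C 0" "dist x y"] by (simp add: dist_real_def)
  qed simp
  then show ?thesis by (rule lipschitz_on_continuous_on)
qed

lemma (in prob_space) integrable_continuous_bounded:
  fixes f :: "'b::topological_space \<Rightarrow> real"
  assumes "continuous_on UNIV f" "\<And>x. \<bar>f x\<bar> \<le> B" "Z \<in> borel_measurable M"
  shows "integrable M (\<lambda>w. f (Z w))"
  using assms by (intro integrable_const_bound[where B=B])
    (auto intro!: measurable_compose[OF assms(3)] borel_measurable_continuous_onI)

text \<open>The envelopes lie below \<open>f\<close> and tend to it pointwise, which bounds the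
  lower limit of the integrals from below. The same argument for \<open>- f\<close> bounds the upper
  limit from above.\<close>

lemma converges_in_distribution_lipschitz:
  fixes Z :: "nat \<Rightarrow> 'a \<Rightarrow> 'b::metric_space"
  assumes "prob_space M" "prob_space N"
    and Z: "\<And>n. Z n \<in> borel_measurable M" and W: "W \<in> borel_measurable N"
    and lip: "\<And>(f :: 'b \<Rightarrow> real) B C. (\<And>x. \<bar>f x\<bar> \<le> B) \<Longrightarrow> (\<And>x y. \<bar>f x - f y\<bar> \<le> C * dist x y) \<Longrightarrow>
      (\<lambda>n. \<integral>w. f (Z n w) \<partial>M) \<longlonglongrightarrow> (\<integral>w. f (W w) \<partial>N)"
  shows "converges_in_distribution M Z N W"
proof -
  interpret M: prob_space M by fact
  interpret N: prob_space N by fact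
  have lower: "eventually (\<lambda>n. (\<integral>w. f (W w) \<partial>N) - \<epsilon> < (\<integral>w. f (Z n w) \<partial>M)) sequentially"
    if cont: "continuous_on UNIV f" and B: "\<And>x. \<bar>f x\<bar> \<le> B" and "0 < \<epsilon>"
    for f :: "'b \<Rightarrow> real" and B \<epsilon>
  proof -
    let ?f = "inf_convolution f"
    have contk: "continuous_on UNIV (?f k)" for k
      by (rule lipschitz_imp_continuous_on[OF inf_convolution_lipschitz[OF B]])
    have "(\<lambda>k. \<integral>w. ?f k (W w) \<partial>N) \<longlonglongrightarrow> (\<integral>w. f (W w) \<partial>N)"
    proof (rule integral_dominated_convergence[where w="\<lambda>_. B"])
      show "AE w in N. (\<lambda>k. ?f k (W w)) \<longlonglongrightarrow> f (W w)"
        using inf_convolution_tendsto[OF B cont] by simp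
      show "AE w in N. norm (?f k (W w)) \<le> B" for k
        using abs_inf_convolution_le[where f=f, OF B] by simp
    qed (auto intro!: measurable_compose[OF W] borel_measurable_continuous_onI cont contk)
    then have "eventually (\<lambda>k. (\<integral>w. f (W w) \<partial>N) - \<epsilon> < (\<integral>w. ?f k (W w) \<partial>N)) sequentially"
      using \<open>0 < \<epsilon>\<close> by (intro order_tendstoD) auto
    then obtain k where k: "(\<integral>w. f (W w) \<partial>N) - \<epsilon> < (\<integral>w. ?f k (W w) \<partial>N)"
      by (auto simp: eventually_sequentially)
    have "(\<lambda>n. \<integral>w. ?f k (Z n w) \<partial>M) \<longlonglongrightarrow> (\<integral>w. ?f k (W w) \<partial>N)"
      by (rule lip[OF abs_inf_convolution_le[OF B] inf_convolution_lipschitz[OF B]])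
    then have "eventually (\<lambda>n. (\<integral>w. f (W w) \<partial>N) - \<epsilon> < (\<integral>w. ?f k (Z n w) \<partial>M)) sequentially"
      using k by (rule order_tendstoD)
    moreover have "(\<integral>w. ?f k (Z n w) \<partial>M) \<le> (\<integral>w. f (Z n w) \<partial>M)" for n
      by (intro integral_mono M.integrable_continuous_bounded[OF contk abs_inf_convolution_le[OF B]]
          M.integrable_continuous_bounded[OF cont B] Z inf_convolution_le[OF B])
    ultimately show ?thesis by (auto elim!: eventually_mono intro: less_le_trans)
  qed
  have "(\<lambda>n. \<integral>w. f (Z n w) \<partial>M) \<longlonglongrightarrow> (\<integral>w. f (W w) \<partial>N)"
    if cont: "continuous_on UNIV f" and bdd: "bounded (range f)" for f :: "'b \<Rightarrow> real"
  proof (rule tendstoI)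
    fix \<epsilon> :: real assume "0 < \<epsilon>"
    obtain B where B: "\<And>x. \<bar>f x\<bar> \<le> B"
      using bdd by (auto simp: bounded_iff)
    have "eventually (\<lambda>n. (\<integral>w. - f (W w) \<partial>N) - \<epsilon> < (\<integral>w. - f (Z n w) \<partial>M)) sequentially"
      by (rule lower) (use cont B \<open>0 < \<epsilon>\<close> in \<open>auto intro: continuous_on_minus\<close>)
    with lower[OF cont B \<open>0 < \<epsilon>\<close>]
    show "eventually (\<lambda>n. dist (\<integral>w. f (Z n w) \<partial>M) (\<integral>w. f (W w) \<partial>N) < \<epsilon>) sequentially"
      by eventually_elim (simp add: dist_real_def abs_less_iff)
  qed
  then show ?thesis using Z W by (simp add: converges_in_distribution_def)
qed

section \<open>Trigonometric polynomials on an inner product space\<close>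

text \<open>With complex coefficients, closure under products is just the multiplicativity of
  \<open>cis\<close>. Real test functions \<open>g\<close> enter through
  \<open>complex_of_real (g x)\<close>.\<close>

inductive trig_poly :: "('b::real_inner \<Rightarrow> complex) \<Rightarrow> bool" where
  trig_poly_cis: "trig_poly (\<lambda>x. c * cis (inner u x))"
| trig_poly_add: "trig_poly f \<Longrightarrow> trig_poly g \<Longrightarrow> trig_poly (\<lambda>x. f x + g x)"

lemma trig_poly_const: "trig_poly (\<lambda>x. c)"
  using trig_poly_cis[of c 0] by simp

lemma trig_poly_mult:
  assumes "trig_poly f" "trig_poly g"
  shows "trig_poly (\<lambda>x. f x * g x)"
  using assms(1)
proof (induction rule: trig_poly.induct)
  case (trig_poly_cis c u)
  show ?case using assms(2)
  proof (induction rule: trig_poly.induct)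
    case (trig_poly_cis d v)
    have "(\<lambda>x. c * cis (inner u x) * (d * cis (inner v x))) =
        (\<lambda>x. (c * d) * cis (inner (u + v) x))"
      by (simp add: inner_add_left cis_mult[symmetric] fun_eq_iff)
    then show ?case using trig_poly.trig_poly_cis by metis
  next
    case (trig_poly_add f g)
    then show ?case using trig_poly.trig_poly_add by (simp add: distrib_left)
  qed
next
  case (trig_poly_add f g)
  then show ?case using trig_poly.trig_poly_add by (simp add: distrib_right)
qed

lemma trig_poly_continuous: "trig_poly f \<Longrightarrow> continuous_on UNIV f"
  by (induction rule: trig_poly.induct) (auto intro!: continuous_intros)

lemma trig_poly_bounded: "trig_poly f \<Longrightarrow> \<exists>B. \<forall>x. norm (f x) \<le> B"
proof (induction rule: trig_poly.induct)
  case (trig_poly_cis c u)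
  then show ?case by (intro exI[of _ "norm c"]) (simp add: norm_mult)
next
  case (trig_poly_add f g)
  then show ?case by (meson add_mono norm_triangle_le)
qed

text \<open>A self-adjoint map moves from the argument to the frequency. It is used for
  finite-dimensional projections.\<close>

lemma trig_poly_compose_adjoint:
  assumes "trig_poly f" "\<And>u x. inner u (Q x) = inner (Q u) x"
  shows "trig_poly (\<lambda>x. f (Q x))"
  using assms(1) by induction (auto simp: assms(2) intro: trig_poly.intros)

lemma trig_poly_separates:
  fixes x y :: "'b::real_inner"
  assumes "x \<noteq> y"
  shows "\<exists>f. trig_poly (\<lambda>z. complex_of_real (f z)) \<and> f x \<noteq> f y"
proof -
  \<comment> \<open>Scaled so that \<open>inner u x - inner u y = 1\<close>; then \<open>f\<close>
    takes the value \<open>sin 1 > 0\<close> at \<open>x\<close> and 0 at \<open>y\<close>.\<close>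
  define u where "u = (x - y) /\<^sub>R (norm (x - y))^2"
  define f where "f z = sin (inner u z - inner u y)" for z
  have "inner u x - inner u y = 1"
    using assms unfolding inner_diff_right[symmetric] by (simp add: u_def dot_square_norm)
  then have "f x \<noteq> f y"
    using sin_gt_zero[of "1::real"] pi_gt3 by (simp add: f_def)
  have "complex_of_real (f z) = (cis (- inner u y) / (2 * \<i>)) * cis (inner u z) +
      (- cis (inner u y) / (2 * \<i>)) * cis (inner (- u) z)" for z
  proof -
    have *: "complex_of_real (sin t) = (cis t - cis (- t)) / (2 * \<i>)" for t
      by (simp add: complex_eq_iff Re_divide Im_divide power2_eq_square)
    have "cis (inner u z - inner u y) = cis (inner u z) * cis (- inner u y)"
      "cis (- (inner u z - inner u y)) = cis (inner u y) * cis (inner (- u) z)"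
      by (simp_all add: cis_mult)
    then show ?thesis unfolding f_def * by (simp add: algebra_simps diff_divide_distrib)
  qed
  then have "trig_poly (\<lambda>z. complex_of_real (f z))"
    using trig_poly_add[OF trig_poly_cis[of "cis (- inner u y) / (2 * \<i>)" u]
        trig_poly_cis[of "- cis (inner u y) / (2 * \<i>)" "- u"]] by simp
  with \<open>f x \<noteq> f y\<close> show ?thesis by blast
qed

lemma trig_poly_real_polynomial:
  fixes q :: "real \<Rightarrow> real"
  assumes "real_polynomial_function q" "trig_poly (\<lambda>x. complex_of_real (g x))"
  shows "trig_poly (\<lambda>x. complex_of_real (q (g x)))"
  using assms(1)
proof (induction rule: real_polynomial_function.induct)
  case (linear f)
  have "f t = f 1 * t" for t
    using linear_scale[OF bounded_linear.linear[OF linear], of t 1] by simp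
  then have "(\<lambda>x. complex_of_real (f (g x))) = (\<lambda>x. of_real (f 1) * of_real (g x))"
    by (metis of_real_mult)
  then show ?case using trig_poly_mult[OF trig_poly_const assms(2)] by metis
next
  case (const c)
  then show ?case by (rule trig_poly_const)
next
  case (add f g)
  then show ?case using trig_poly_add by simp
next
  case (mult f g)
  then show ?case using trig_poly_mult by simp
qed

text \<open>The Stone-Weierstrass theorem controls the approximant only on the compact set; composing
  with a polynomial that is close to truncation at height \<open>B\<close> bounds it everywhere.\<close>

lemma trig_poly_approximation:
  fixes f :: "'b::real_inner \<Rightarrow> real"
  assumes "compact S" "continuous_on S f" and B: "\<And>x. x \<in> S \<Longrightarrow> \<bar>f x\<bar> \<le> B" "0 \<le> B" and "0 < \<epsilon>"
  obtains g where "trig_poly (\<lambda>x. complex_of_real (g x))"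
    "\<And>x. x \<in> S \<Longrightarrow> \<bar>f x - g x\<bar> < \<epsilon>" "\<And>x. \<bar>g x\<bar> \<le> B + \<epsilon>"
proof -
  have cont: "continuous_on A p" if "trig_poly (\<lambda>x. complex_of_real (p x))" for p :: "'b \<Rightarrow> real" and A
  proof -
    have "continuous_on A (\<lambda>x. Re (complex_of_real (p x)))"
      by (intro continuous_on_Re continuous_on_subset[OF trig_poly_continuous[OF that]]) simp
    then show ?thesis by simp
  qed
  have "\<exists>p. trig_poly (\<lambda>x. complex_of_real (p x)) \<and> (\<forall>x\<in>S. \<bar>f x - p x\<bar> < \<epsilon> / 2)"
    by (rule Stone_Weierstrass_HOL[where P="\<lambda>p. trig_poly (\<lambda>x. complex_of_real (p x))"])
      (use assms cont trig_poly_const trig_poly_separates trig_poly_add trig_poly_mult in auto)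
  then obtain p where p: "trig_poly (\<lambda>x. complex_of_real (p x))" "\<And>x. x \<in> S \<Longrightarrow> \<bar>f x - p x\<bar> < \<epsilon> / 2"
    by blast
  \<comment> \<open>Trigonometric polynomials are bounded on the whole space, so the truncation has
    to be approximated only on a compact interval.\<close>
  obtain K where K: "\<And>x. \<bar>p x\<bar> \<le> K" using trig_poly_bounded[OF p(1)] by auto
  define \<tau> where "\<tau> t = max (- B) (min B t)" for t :: real
  have "continuous_on {- K..K} \<tau>" unfolding \<tau>_def by (intro continuous_intros)
  then obtain q where q: "real_polynomial_function q" "\<And>t. t \<in> {- K..K} \<Longrightarrow> \<bar>\<tau> t - q t\<bar> < \<epsilon> / 2"
    using Stone_Weierstrass_real_polynomial_function[of "{- K..K}" \<tau> "\<epsilon> / 2"] \<open>0 < \<epsilon>\<close> by auto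
  have close: "\<bar>\<tau> (p x) - q (p x)\<bar> < \<epsilon> / 2" for x
    using q(2)[of "p x"] K[of x] by (simp add: abs_le_iff)
  show thesis
  proof
    show "trig_poly (\<lambda>x. complex_of_real (q (p x)))" by (rule trig_poly_real_polynomial[OF q(1) p(1)])
    show "\<bar>f x - q (p x)\<bar> < \<epsilon>" if "x \<in> S" for x
    proof -
      \<comment> \<open>On \<open>S\<close> the values of \<open>f\<close> lie between
        \<open>- B\<close> and \<open>B\<close>, so truncating \<open>p x\<close> can only bring it
        closer to \<open>f x\<close>.\<close>
      have "\<bar>f x - \<tau> (p x)\<bar> \<le> \<bar>f x - p x\<bar>" using B(1)[OF that] by (auto simp: \<tau>_def)
      then show ?thesis using close[of x] p(2)[OF that] by linarith
    qed
    have "\<bar>\<tau> t\<bar> \<le> B" for t using B(2) by (auto simp: \<tau>_def)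
    then have "\<bar>\<tau> (p x)\<bar> \<le> B" for x .
    then show "\<bar>q (p x)\<bar> \<le> B + \<epsilon>" for x
    proof -
      have "\<bar>\<tau> (p x)\<bar> \<le> B" "\<bar>\<tau> (p x) - q (p x)\<bar> < \<epsilon> / 2" by fact (rule close)
      then show ?thesis using \<open>0 < \<epsilon>\<close> by linarith
    qed
  qed
qed

lemma trig_poly_integral_tendsto:
  fixes S :: "nat \<Rightarrow> 'a \<Rightarrow> 'b::{real_inner,second_countable_topology}"
  assumes "prob_space M" "prob_space N"
    and S: "\<And>n. S n \<in> borel_measurable M" and W: "W \<in> borel_measurable N"
    and char: "\<And>u. (\<lambda>n. \<integral>w. cis (inner u (S n w)) \<partial>M) \<longlonglongrightarrow> (\<integral>w. cis (inner u (W w)) \<partial>N)"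
    and "trig_poly f"
  shows "(\<lambda>n. \<integral>w. f (S n w) \<partial>M) \<longlonglongrightarrow> (\<integral>w. f (W w) \<partial>N)"
proof -
  interpret M: prob_space M by fact
  interpret N: prob_space N by fact
  have intM: "integrable M (\<lambda>w. f (S n w))" if f: "trig_poly f" for f n
  proof -
    obtain B where "\<And>x. norm (f x) \<le> B" using trig_poly_bounded[OF f] by blast
    then show ?thesis
      by (intro M.integrable_const_bound[where B=B] measurable_compose[OF S]
          borel_measurable_continuous_onI trig_poly_continuous f) auto
  qed
  have intN: "integrable N (\<lambda>w. f (W w))" if f: "trig_poly f" for f
  proof -
    obtain B where "\<And>x. norm (f x) \<le> B" using trig_poly_bounded[OF f] by blast
    then show ?thesis
      by (intro N.integrable_const_bound[where B=B] measurable_compose[OF W]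
          borel_measurable_continuous_onI trig_poly_continuous f) auto
  qed
  show ?thesis using \<open>trig_poly f\<close>
  proof (induction rule: trig_poly.induct)
    case (trig_poly_cis c u)
    show ?case using tendsto_mult_left[OF char, of c u] by simp
  next
    case (trig_poly_add f g)
    then show ?case by (simp add: intM intN tendsto_add)
  qed
qed

section \<open>From characteristic functions and second moments to Lipschitz test functions\<close>

text \<open>Balls need not be relatively compact in infinite dimension, but their projections lie in
  the continuous image of a product of intervals, built up one coordinate at a time.\<close>

lemma compact_fproj_cball:
  assumes "ortho_family e {..<k}"
  shows "\<exists>T. compact T \<and> (\<forall>v. norm v \<le> r \<longrightarrow> fproj e {..<k::nat} v \<in> T)"
  using assms
proof (induction k)
  case 0
  then show ?case by (intro exI[of _ "{0}"]) (simp add: fproj_def)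
next
  case (Suc k)
  have "ortho_family e {..<k}" using Suc.prems by (rule ortho_family_subset) auto
  then obtain T where T: "compact T" "\<And>v. norm v \<le> r \<Longrightarrow> fproj e {..<k} v \<in> T"
    using Suc.IH by blast
  let ?T = "(\<lambda>(a, c). a + c *\<^sub>R e k) ` (T \<times> {- r..r})"
  show ?case
  proof (intro exI conjI allI impI)
    show "compact ?T"
      by (intro compact_continuous_image compact_Times T compact_Icc)
        (auto intro!: continuous_intros simp: case_prod_unfold)
    fix v :: 'a assume v: "norm v \<le> r"
    have "e k = 0 \<or> norm (e k) = 1" using Suc.prems by (auto simp: ortho_family_def)
    then have "norm (e k) \<le> 1" by auto
    then have "\<bar>inner (e k) v\<bar> \<le> r"
      using Cauchy_Schwarz_ineq2[of "e k" v] v mult_right_mono[of "norm (e k)" 1 "norm v"] by simp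
    then have "(fproj e {..<k} v, inner (e k) v) \<in> T \<times> {- r..r}" using T(2)[OF v] by auto
    moreover have "fproj e {..<Suc k} v = fproj e {..<k} v + inner (e k) v *\<^sub>R e k"
      by (simp add: fproj_def)
    ultimately show "fproj e {..<Suc k} v \<in> ?T" by force
  qed
qed

lemma (in prob_space) integral_abs_diff_le:
  fixes f g h :: "'a \<Rightarrow> real"
  assumes "integrable M f" "integrable M g" "integrable M h"
    and "\<And>w. \<bar>f w - g w\<bar> \<le> h w"
  shows "\<bar>(\<integral>w. f w \<partial>M) - (\<integral>w. g w \<partial>M)\<bar> \<le> (\<integral>w. h w \<partial>M)"
proof -
  have "(\<integral>w. f w \<partial>M) - (\<integral>w. g w \<partial>M) = (\<integral>w. f w - g w \<partial>M)" using assms by simp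
  also have "\<bar>...\<bar> \<le> (\<integral>w. \<bar>f w - g w\<bar> \<partial>M)" by (rule integral_abs_bound)
  also have "... \<le> (\<integral>w. h w \<partial>M)" using assms by (intro integral_mono) auto
  finally show ?thesis .
qed

lemma integrable_inner_square:
  fixes Z :: "'a \<Rightarrow> 'b::{real_inner,second_countable_topology}"
  assumes "Z \<in> borel_measurable M" "integrable M (\<lambda>w. (norm (Z w))^2)"
  shows "integrable M (\<lambda>w. (inner u (Z w))^2)"
proof (rule Bochner_Integration.integrable_bound)
  show "integrable M (\<lambda>w. (norm u)^2 * (norm (Z w))^2)" using assms by simp
  show "AE w in M. norm ((inner u (Z w))^2) \<le> norm ((norm u)^2 * (norm (Z w))^2)"
    using Cauchy_Schwarz_ineq2[of u] by (auto simp: power_mult_distrib[symmetric] intro!: power2_mono)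
qed (use assms in measurable)

text \<open>Pythagoras under the integral: the tail is expressed by the squared norm and finitely
  many directional variances, whose limits are known.\<close>

lemma norm_diff_fproj_integral:
  fixes Z :: "'a \<Rightarrow> 'b::{real_inner,second_countable_topology}"
  assumes "Z \<in> borel_measurable M" "integrable M (\<lambda>w. (norm (Z w))^2)"
    and "finite F" "ortho_family e F"
  shows "integrable M (\<lambda>w. (norm (Z w - fproj e F (Z w)))^2)"
    "(\<integral>w. (norm (Z w - fproj e F (Z w)))^2 \<partial>M) =
      (\<integral>w. (norm (Z w))^2 \<partial>M) - (\<Sum>i\<in>F. \<integral>w. (inner (e i) (Z w))^2 \<partial>M)"
  using integrable_inner_square[OF assms(1,2)] assms(2)
  by (simp_all add: norm_diff_fproj[OF assms(3,4)])

text \<open>Finite-dimensional projections capture \<open>S n\<close> uniformly in mean square, because the expected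
  squared norms converge to that of the limit; on a ball, the projections lie in a compact set.\<close>

lemma lipschitz_integral_tendsto:
  fixes S :: "nat \<Rightarrow> 'a \<Rightarrow> 'b::{real_inner,second_countable_topology}" and f :: "'b \<Rightarrow> real"
  assumes "prob_space M" "prob_space N"
    and S: "\<And>n. S n \<in> borel_measurable M" and W: "W \<in> borel_measurable N"
    and S2: "\<And>n. n0 \<le> n \<Longrightarrow> integrable M (\<lambda>w. (norm (S n w))^2)"
    and W2: "integrable N (\<lambda>w. (norm (W w))^2)"
    and char: "\<And>u. (\<lambda>n. \<integral>w. cis (inner u (S n w)) \<partial>M) \<longlonglongrightarrow> (\<integral>w. cis (inner u (W w)) \<partial>N)"
    and norm2: "(\<lambda>n. \<integral>w. (norm (S n w))^2 \<partial>M) \<longlonglongrightarrow> (\<integral>w. (norm (W w))^2 \<partial>N)"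
    and inner2: "\<And>u. (\<lambda>n. \<integral>w. (inner u (S n w))^2 \<partial>M) \<longlonglongrightarrow> (\<integral>w. (inner u (W w))^2 \<partial>N)"
    and B: "\<And>x. \<bar>f x\<bar> \<le> B" and C: "\<And>x y. \<bar>f x - f y\<bar> \<le> C * dist x y"
  shows "(\<lambda>n. \<integral>w. f (S n w) \<partial>M) \<longlonglongrightarrow> (\<integral>w. f (W w) \<partial>N)"
proof -
  interpret M: prob_space M by fact
  interpret N: prob_space N by fact
  obtain e :: "nat \<Rightarrow> 'b" where e: "total_family e UNIV" using exists_total_family by blast
  have o: "ortho_family e {..<k}" for k
    using e ortho_family_subset total_family_ortho by (metis subset_UNIV)
  have "0 \<le> B" using B[of 0] by linarith
  have contf: "continuous_on UNIV f" by (rule lipschitz_imp_continuous_on[OF C])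
  \<comment> \<open>The extra 1 puts \<open>V\<close> strictly above the limit, so that it
    eventually bounds the second moments of \<open>S n\<close>.\<close>
  define V where "V = (\<integral>w. (norm (W w))^2 \<partial>N) + 1"
  have "0 < V" unfolding V_def by (intro add_nonneg_pos Bochner_Integration.integral_nonneg) auto
  show ?thesis
  proof (rule tendstoI)
    fix \<epsilon>' :: real assume "0 < \<epsilon>'"
    \<comment> \<open>The total error is \<open>4 * \<epsilon>\<close> for \<open>S n\<close>,
      \<open>4 * \<epsilon>\<close> for \<open>W\<close> and \<open>\<epsilon>\<close> for the
      trigonometric polynomial; the divisor 13 leaves slack.\<close>
    define \<epsilon> where "\<epsilon> = \<epsilon>' / 13"
    have "0 < \<epsilon>" using \<open>0 < \<epsilon>'\<close> by (simp add: \<epsilon>_def)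
    \<comment> \<open>Chosen for \<open>C^2 / \<epsilon> * \<delta> \<le> \<epsilon>\<close>; the
      summand 1 covers \<open>C = 0\<close>.\<close>
    define \<delta> where "\<delta> = \<epsilon>^2 / (C^2 + 1)"
    have "0 < C^2 + 1" by (simp add: add_nonneg_pos)
    then have "0 < \<delta>" using \<open>0 < \<epsilon>\<close> by (simp add: \<delta>_def)
    have C\<delta>: "C^2 / \<epsilon> * \<delta> \<le> \<epsilon>"
    proof -
      have "C^2 * \<delta> \<le> (C^2 + 1) * \<delta>" using \<open>0 < \<delta>\<close> by (intro mult_right_mono) auto
      also have "... = \<epsilon>^2" using \<open>0 < C^2 + 1\<close> by (simp add: \<delta>_def)
      finally show ?thesis using \<open>0 < \<epsilon>\<close> by (simp add: pos_divide_le_eq power2_eq_square)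
    qed
    have "(\<lambda>k. \<integral>w. (norm (W w - fproj e {..<k} (W w)))^2 \<partial>N) \<longlonglongrightarrow> (\<integral>w. 0 \<partial>N)"
    proof (rule integral_dominated_convergence[where w="\<lambda>w. (norm (W w))^2"])
      have "(\<lambda>k. (norm (v - fproj e {..<k} v))^2) \<longlonglongrightarrow> (norm (v - v))^2" for v
        by (intro tendsto_intros fproj_tendsto[OF e])
      then show "AE w in N. (\<lambda>k. (norm (W w - fproj e {..<k} (W w)))^2) \<longlonglongrightarrow> 0" by simp
      show "AE w in N. norm ((norm (W w - fproj e {..<k} (W w)))^2) \<le> (norm (W w))^2" for k
      proof (rule AE_I2)
        show "norm ((norm (W w - fproj e {..<k} (W w)))^2) \<le> (norm (W w))^2" for w
          unfolding real_norm_def abs_of_nonneg[OF zero_le_power2]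
          using norm_diff_fproj[OF _ o, of k "W w"] by (simp add: sum_nonneg)
      qed
    qed (use W W2 in \<open>auto simp: fproj_def\<close>)
    then have "eventually (\<lambda>k. (\<integral>w. (norm (W w - fproj e {..<k} (W w)))^2 \<partial>N) < \<delta>) sequentially"
      using \<open>0 < \<delta>\<close> by (intro order_tendstoD) auto
    then obtain k where Wk: "(\<integral>w. (norm (W w - fproj e {..<k} (W w)))^2 \<partial>N) < \<delta>"
      by (auto simp: eventually_sequentially)
    let ?P = "fproj e {..<k}"
    have "(\<lambda>n. (\<integral>w. (norm (S n w))^2 \<partial>M) - (\<Sum>i<k. \<integral>w. (inner (e i) (S n w))^2 \<partial>M))
        \<longlonglongrightarrow> (\<integral>w. (norm (W w - ?P (W w)))^2 \<partial>N)"
      unfolding norm_diff_fproj_integral(2)[OF W W2 finite_lessThan o]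
      by (intro tendsto_intros norm2 inner2)
    then have Sk: "eventually (\<lambda>n. (\<integral>w. (norm (S n w))^2 \<partial>M) -
        (\<Sum>i<k. \<integral>w. (inner (e i) (S n w))^2 \<partial>M) < \<delta>) sequentially"
      using Wk by (intro order_tendstoD)
    have SV: "eventually (\<lambda>n. (\<integral>w. (norm (S n w))^2 \<partial>M) < V) sequentially"
      by (rule order_tendstoD(2)[OF norm2]) (simp add: V_def)
    \<comment> \<open>Chosen so that the mass outside the ball of radius \<open>r\<close> costs
      \<open>(2 * B + \<epsilon>) / r^2 * V = \<epsilon>\<close> in the Chebyshev manner.\<close>
    define r where "r = sqrt ((2 * B + \<epsilon>) * V / \<epsilon>)"
    have "0 < (2 * B + \<epsilon>) * V / \<epsilon>" using \<open>0 < \<epsilon>\<close> \<open>0 \<le> B\<close> \<open>0 < V\<close> by simp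
    then have "0 < r" and r2: "(2 * B + \<epsilon>) / r^2 * V = \<epsilon>"
      using \<open>0 < \<epsilon>\<close> \<open>0 \<le> B\<close> \<open>0 < V\<close> by (auto simp: r_def)
    obtain T where T: "compact T" "\<And>v. norm v \<le> r \<Longrightarrow> ?P v \<in> T"
      using compact_fproj_cball[OF o] by blast
    obtain g where g: "trig_poly (\<lambda>x. complex_of_real (g x))"
      "\<And>x. x \<in> T \<Longrightarrow> \<bar>f x - g x\<bar> < \<epsilon>" "\<And>x. \<bar>g x\<bar> \<le> B + \<epsilon>"
      using trig_poly_approximation[OF T(1) continuous_on_subset[OF contf subset_UNIV] B \<open>0 \<le> B\<close> \<open>0 < \<epsilon>\<close>]
      by blast
    define gP where "gP x = g (?P x)" for x
    have tgP: "trig_poly (\<lambda>x. complex_of_real (gP x))" unfolding gP_def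
    proof (rule trig_poly_compose_adjoint[OF g(1)])
      show "inner u (?P x) = inner (?P u) x" for u x
        by (simp add: fproj_def inner_sum_left inner_sum_right inner_commute mult.commute)
    qed
    have gPcont: "continuous_on UNIV gP"
      using continuous_on_Re[OF trig_poly_continuous[OF tgP]] by simp
    have gPB: "\<bar>gP x\<bar> \<le> B + \<epsilon>" for x by (simp add: gP_def g)
    \<comment> \<open>One pointwise inequality collects three errors: projection, approximation on
      the compact set, and the complement of the ball, where \<open>(norm v)^2 / r^2\<close> exceeds
      1. Only second moments remain to be integrated.\<close>
    have pw: "\<bar>f v - gP v\<bar> \<le>
        2 * \<epsilon> + C^2 / \<epsilon> * (norm (v - ?P v))^2 + (2 * B + \<epsilon>) / r^2 * (norm v)^2" for v
    proof -
      have "\<bar>f v - f (?P v)\<bar> \<le> C * norm (v - ?P v)" using C[of v "?P v"] by (simp add: dist_norm)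
      \<comment> \<open>The inequality \<open>a \<le> \<epsilon> + a^2 / \<epsilon>\<close> turns a
        first-order Lipschitz bound into one that sees only mean squares.\<close>
      also have "... \<le> \<epsilon> + C^2 / \<epsilon> * (norm (v - ?P v))^2"
      proof -
        have "0 \<le> C * norm (v - ?P v)"
          using C[of v "?P v"] abs_ge_zero[of "f v - f (?P v)"] unfolding dist_norm by linarith
        then have "0 \<le> (C * norm (v - ?P v) - \<epsilon>)^2 + C * norm (v - ?P v) * \<epsilon>"
          using \<open>0 < \<epsilon>\<close> by (intro add_nonneg_nonneg mult_nonneg_nonneg[of "C * _"]) auto
        then have "C * norm (v - ?P v) * \<epsilon> \<le> \<epsilon>^2 + C^2 * (norm (v - ?P v))^2"
          by (simp add: power2_eq_square algebra_simps)
        then show ?thesis using \<open>0 < \<epsilon>\<close> by (simp add: field_simps power2_eq_square)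
      qed
      finally have 1: "\<bar>f v - f (?P v)\<bar> \<le> \<epsilon> + C^2 / \<epsilon> * (norm (v - ?P v))^2" .
      have "\<bar>f (?P v) - gP v\<bar> \<le> \<epsilon> + (2 * B + \<epsilon>) / r^2 * (norm v)^2"
      proof (cases "norm v \<le> r")
        case True
        then have "\<bar>f (?P v) - gP v\<bar> \<le> \<epsilon>" using g(2)[OF T(2)] by (simp add: gP_def less_imp_le)
        moreover have "0 \<le> (2 * B + \<epsilon>) / r^2 * (norm v)^2" using \<open>0 \<le> B\<close> \<open>0 < \<epsilon>\<close> by simp
        ultimately show ?thesis by linarith
      next
        case False
        have "\<bar>f (?P v) - gP v\<bar> \<le> 2 * B + \<epsilon>" using B[of "?P v"] gPB[of v] by linarith
        also have "... = (2 * B + \<epsilon>) / r^2 * r^2" using \<open>0 < r\<close> by simp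
        also have "... \<le> (2 * B + \<epsilon>) / r^2 * (norm v)^2"
          using False \<open>0 < r\<close> \<open>0 \<le> B\<close> \<open>0 < \<epsilon>\<close> by (intro mult_left_mono power_mono) auto
        finally show ?thesis using \<open>0 < \<epsilon>\<close> by linarith
      qed
      with 1 show ?thesis by linarith
    qed
    \<comment> \<open>Stated for an arbitrary probability space, since it serves both
      \<open>S n\<close> on \<open>M\<close> and \<open>W\<close> on \<open>N\<close>.\<close>
    have approx: "\<bar>(\<integral>w. f (Z w) \<partial>Q) - (\<integral>w. gP (Z w) \<partial>Q)\<bar> \<le> 4 * \<epsilon>"
      if "prob_space Q" and Z: "Z \<in> borel_measurable Q" and Z2: "integrable Q (\<lambda>w. (norm (Z w))^2)"
        and ZV: "(\<integral>w. (norm (Z w))^2 \<partial>Q) \<le> V"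
        and Zk: "(\<integral>w. (norm (Z w - ?P (Z w)))^2 \<partial>Q) \<le> \<delta>"
      for Q :: "'q measure" and Z
    proof -
      interpret Q: prob_space Q by fact
      note ints = norm_diff_fproj_integral(1)[OF Z Z2 finite_lessThan o]
      have "\<bar>(\<integral>w. f (Z w) \<partial>Q) - (\<integral>w. gP (Z w) \<partial>Q)\<bar> \<le>
          (\<integral>w. 2 * \<epsilon> + C^2 / \<epsilon> * (norm (Z w - ?P (Z w)))^2 + (2 * B + \<epsilon>) / r^2 * (norm (Z w))^2 \<partial>Q)"
        by (rule Q.integral_abs_diff_le[OF Q.integrable_continuous_bounded[OF contf B Z]
              Q.integrable_continuous_bounded[OF gPcont gPB Z] _ pw])
          (intro Bochner_Integration.integrable_add integrable_mult_right ints Z2 Q.integrable_const)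
      also have "... = 2 * \<epsilon> + C^2 / \<epsilon> * (\<integral>w. (norm (Z w - ?P (Z w)))^2 \<partial>Q) +
          (2 * B + \<epsilon>) / r^2 * (\<integral>w. (norm (Z w))^2 \<partial>Q)"
        by (subst Bochner_Integration.integral_add Bochner_Integration.integral_add,
            (intro Bochner_Integration.integrable_add integrable_mult_right ints Z2 Q.integrable_const)+)+
          (simp add: Q.prob_space)
      also have "... \<le> 2 * \<epsilon> + C^2 / \<epsilon> * \<delta> + (2 * B + \<epsilon>) / r^2 * V"
        using \<open>0 \<le> B\<close> \<open>0 < \<epsilon>\<close> by (intro add_mono mult_left_mono Zk ZV order_refl) auto
      also have "... \<le> 2 * \<epsilon> + \<epsilon> + \<epsilon>"
        using C\<delta> r2 by (intro add_mono order_refl) auto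
      finally show ?thesis by simp
    qed
    have aW: "\<bar>(\<integral>w. f (W w) \<partial>N) - (\<integral>w. gP (W w) \<partial>N)\<bar> \<le> 4 * \<epsilon>"
      by (rule approx[OF \<open>prob_space N\<close> W W2]) (use Wk in \<open>auto simp: V_def\<close>)
    have "(\<lambda>n. \<integral>w. complex_of_real (gP (S n w)) \<partial>M) \<longlonglongrightarrow> (\<integral>w. complex_of_real (gP (W w)) \<partial>N)"
      by (rule trig_poly_integral_tendsto[OF assms(1,2) S W char tgP])
    then have "(\<lambda>n. \<integral>w. gP (S n w) \<partial>M) \<longlonglongrightarrow> (\<integral>w. gP (W w) \<partial>N)"
      by (simp add: tendsto_of_real_iff)
    then have gn: "eventually (\<lambda>n. dist (\<integral>w. gP (S n w) \<partial>M) (\<integral>w. gP (W w) \<partial>N) < \<epsilon>) sequentially"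
      using \<open>0 < \<epsilon>\<close> by (rule tendstoD)
    show "eventually (\<lambda>n. dist (\<integral>w. f (S n w) \<partial>M) (\<integral>w. f (W w) \<partial>N) < \<epsilon>') sequentially"
      using gn Sk SV eventually_ge_at_top[of n0]
    proof eventually_elim
      case (elim n)
      have "\<bar>(\<integral>w. f (S n w) \<partial>M) - (\<integral>w. gP (S n w) \<partial>M)\<bar> \<le> 4 * \<epsilon>"
        using elim norm_diff_fproj_integral(2)[OF S S2 finite_lessThan o]
        by (intro approx[OF \<open>prob_space M\<close> S S2]) auto
      then show ?case using aW elim \<open>0 < \<epsilon>'\<close> unfolding dist_real_def \<epsilon>_def by linarith
    qed
  qed
qed

section \<open>Division by random factors that tend to 1\<close>

text \<open>For \<open>t\<close> near 1 the Lipschitz bound applies; for other \<open>t\<close>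
  boundedness suffices, since \<open>(t - 1)^2 / \<eta>^2\<close> is at least 1. The sum of the two
  bounds holds everywhere and is integrated, so no exceptional event is split off.\<close>

lemma Slutsky_lipschitz:
  fixes S Z :: "nat \<Rightarrow> 'a \<Rightarrow> 'b::{real_inner,second_countable_topology}" and f :: "'b \<Rightarrow> real"
  assumes "prob_space M"
    and S: "\<And>n. S n \<in> borel_measurable M" and Z: "\<And>n. Z n \<in> borel_measurable M"
    and S2: "\<And>n. n0 \<le> n \<Longrightarrow> integrable M (\<lambda>w. (norm (S n w))^2)"
    and V: "\<And>n. n0 \<le> n \<Longrightarrow> (\<integral>w. (norm (S n w))^2 \<partial>M) \<le> V"
    and T2: "\<And>n. n0 \<le> n \<Longrightarrow> integrable M (\<lambda>w. (T n w - 1)^2)"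
    and T: "(\<lambda>n. \<integral>w. (T n w - 1)^2 \<partial>M) \<longlonglongrightarrow> 0"
    and eq: "\<And>n w. n0 \<le> n \<Longrightarrow> Z n w = S n w /\<^sub>R T n w"
    and B: "\<And>x. \<bar>f x\<bar> \<le> B" and C: "\<And>x y. \<bar>f x - f y\<bar> \<le> C * dist x y"
    and lim: "(\<lambda>n. \<integral>w. f (S n w) \<partial>M) \<longlonglongrightarrow> c"
  shows "(\<lambda>n. \<integral>w. f (Z n w) \<partial>M) \<longlonglongrightarrow> c"
proof -
  interpret M: prob_space M by fact
  have "0 \<le> B" using B[of 0] by linarith
  have contf: "continuous_on UNIV f" by (rule lipschitz_imp_continuous_on[OF C])
  have "0 \<le> V" using order_trans[OF Bochner_Integration.integral_nonneg V[OF order_refl]] by simp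
  define K where "K = \<bar>C\<bar>"
  have pw: "\<bar>f (s /\<^sub>R t) - f s\<bar> \<le> 2 * K * \<eta> * (1 + (norm s)^2) + 2 * B / \<eta>^2 * (t - 1)^2"
    if "0 < \<eta>" "\<eta> \<le> 1 / 2" for s and t \<eta> :: real
  proof (cases "\<bar>t - 1\<bar> \<le> \<eta>")
    case True
    then have "1 / 2 \<le> t" using that by linarith
    have "\<bar>f (s /\<^sub>R t) - f s\<bar> \<le> C * dist (s /\<^sub>R t) s" by (rule C)
    also have "... \<le> K * dist (s /\<^sub>R t) s" by (intro mult_right_mono) (auto simp: K_def)
    also have "s /\<^sub>R t - s = (inverse t - 1) *\<^sub>R s" by (simp add: scaleR_diff_left)
    then have "dist (s /\<^sub>R t) s = \<bar>inverse t - 1\<bar> * norm s" by (simp add: dist_norm)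
    also have "K * (\<bar>inverse t - 1\<bar> * norm s) \<le> K * ((2 * \<eta>) * (1 + (norm s)^2))"
    proof (intro mult_left_mono mult_mono)
      have "\<bar>inverse t - 1\<bar> = \<bar>t - 1\<bar> / t"
      proof -
        have "inverse t - 1 = (1 - t) / t"
          using \<open>1 / 2 \<le> t\<close> by (simp add: diff_divide_distrib inverse_eq_divide)
        then show ?thesis using \<open>1 / 2 \<le> t\<close> by (simp add: abs_divide abs_minus_commute)
      qed
      also have "... \<le> \<eta> / (1 / 2)" using True \<open>1 / 2 \<le> t\<close> by (intro frac_le) auto
      finally show "\<bar>inverse t - 1\<bar> \<le> 2 * \<eta>" by simp
      have "0 \<le> (norm s - 1)^2 + norm s" by simp
      then show "norm s \<le> 1 + (norm s)^2" by (simp add: power2_eq_square algebra_simps)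
    qed (use that in \<open>auto simp: K_def\<close>)
    moreover have "0 \<le> 2 * B / \<eta>^2 * (t - 1)^2" using \<open>0 \<le> B\<close> by simp
    moreover have "K * ((2 * \<eta>) * (1 + (norm s)^2)) = 2 * K * \<eta> * (1 + (norm s)^2)" by simp
    ultimately show ?thesis by linarith
  next
    \<comment> \<open>This case contains \<open>t = 0\<close>, where the quotient is read as 0; only
      boundedness of \<open>f\<close> is used.\<close>
    case False
    have "\<eta>^2 \<le> \<bar>t - 1\<bar>^2" using False that by (intro power_mono) auto
    then have "2 * B / \<eta>^2 * \<eta>^2 \<le> 2 * B / \<eta>^2 * (t - 1)^2"
      using \<open>0 \<le> B\<close> by (intro mult_left_mono) auto
    then have "2 * B \<le> 2 * B / \<eta>^2 * (t - 1)^2" using that by simp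
    moreover have "0 \<le> 2 * K * \<eta> * (1 + (norm s)^2)" using that by (simp add: K_def)
    ultimately show ?thesis using B[of "s /\<^sub>R t"] B[of s] by linarith
  qed
  have "(\<lambda>n. (\<integral>w. f (Z n w) \<partial>M) - (\<integral>w. f (S n w) \<partial>M)) \<longlonglongrightarrow> 0"
  proof (rule tendstoI)
    fix \<epsilon> :: real assume "0 < \<epsilon>"
    \<comment> \<open>Makes the Lipschitz part at most \<open>\<epsilon> / 2\<close>:
      \<open>1 + V\<close> bounds the mean of \<open>1 + (norm s)^2\<close>, and
      \<open>K + 1\<close> covers \<open>K = 0\<close>.\<close>
    define \<eta> where "\<eta> = min (1 / 2) (\<epsilon> / (4 * (K + 1) * (1 + V)))"
    have "0 \<le> K" by (simp add: K_def)
    have \<eta>: "0 < \<eta>" "\<eta> \<le> 1 / 2"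
      using \<open>0 < \<epsilon>\<close> \<open>0 \<le> K\<close> \<open>0 \<le> V\<close> unfolding \<eta>_def by (simp, intro min.cobounded1)
    have \<eta>K: "2 * K * \<eta> * (1 + V) \<le> \<epsilon> / 2"
    proof -
      have "2 * K * \<eta> * (1 + V) \<le> 2 * (K + 1) * (\<epsilon> / (4 * (K + 1) * (1 + V))) * (1 + V)"
        using \<open>0 < \<epsilon>\<close> \<open>0 \<le> K\<close> \<open>0 \<le> V\<close> \<eta> by (intro mult_mono) (auto simp: \<eta>_def)
      also have "... = \<epsilon> / 2"
      proof -
        have "2 * a * (\<epsilon> / (4 * a * b)) * b = \<epsilon> / 2" if "0 < a" "0 < b" for a b :: real
          using that by (simp add: field_simps)
        from this[of "K + 1" "1 + V"] show ?thesis using \<open>0 \<le> K\<close> \<open>0 \<le> V\<close> by (simp only: add_nonneg_pos add_pos_nonneg zero_less_one)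
      qed
      finally show ?thesis .
    qed
    have "(\<lambda>n. 2 * B / \<eta>^2 * (\<integral>w. (T n w - 1)^2 \<partial>M)) \<longlonglongrightarrow> 2 * B / \<eta>^2 * 0"
      by (intro tendsto_mult_left T)
    then have "eventually (\<lambda>n. 2 * B / \<eta>^2 * (\<integral>w. (T n w - 1)^2 \<partial>M) < \<epsilon> / 2) sequentially"
      using \<open>0 < \<epsilon>\<close> by (intro order_tendstoD) auto
    then show "eventually (\<lambda>n. dist ((\<integral>w. f (Z n w) \<partial>M) - (\<integral>w. f (S n w) \<partial>M)) 0 < \<epsilon>) sequentially"
      using eventually_ge_at_top[of n0]
    proof eventually_elim
      case (elim n)
      have "\<bar>(\<integral>w. f (Z n w) \<partial>M) - (\<integral>w. f (S n w) \<partial>M)\<bar> \<le>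
          (\<integral>w. 2 * K * \<eta> * (1 + (norm (S n w))^2) + 2 * B / \<eta>^2 * (T n w - 1)^2 \<partial>M)"
        by (rule M.integral_abs_diff_le[OF M.integrable_continuous_bounded[OF contf B Z]
              M.integrable_continuous_bounded[OF contf B S]])
          (use elim S2 T2 pw[OF \<eta>] eq in auto)
      also have "... = 2 * K * \<eta> * (1 + (\<integral>w. (norm (S n w))^2 \<partial>M)) +
          2 * B / \<eta>^2 * (\<integral>w. (T n w - 1)^2 \<partial>M)"
        using elim S2 T2 by (simp add: M.prob_space)
      also have "... \<le> 2 * K * \<eta> * (1 + V) + 2 * B / \<eta>^2 * (\<integral>w. (T n w - 1)^2 \<partial>M)"
        using elim V \<open>0 \<le> K\<close> \<eta> by (intro add_mono mult_left_mono order_refl) auto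
      finally show ?case using \<eta>K elim by (simp add: dist_real_def)
    qed
  qed
  from tendsto_add[OF this lim] show ?thesis by simp
qed

section \<open>Gaussian measures on a Hilbert space\<close>

lemma borel_measurable_cis [measurable]: "cis \<in> borel_measurable borel"
  by (intro borel_measurable_continuous_onI continuous_intros)

lemma char_distr:
  assumes "Z \<in> borel_measurable N"
  shows "char (distr N borel Z) t = (\<integral>w. cis (t * Z w) \<partial>N)"
  using assms by (simp add: char_def integral_distr cis_conv_exp)

text \<open>By Levy's uniqueness theorem. The law is written as a scaled standard normal one, so
  that the point mass for \<open>\<sigma> = 0\<close> is included and moments can be
  transported.\<close>

lemma distr_eq_of_gaussian_char:
  assumes "prob_space N" "Z \<in> borel_measurable N"
    and "\<And>t. (\<integral>w. cis (t * Z w) \<partial>N) = complex_of_real (exp (- (t^2 * \<sigma>^2) / 2))"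
  shows "distr N borel Z = distr std_normal_distribution borel (\<lambda>x. \<sigma> * x)"
proof (rule Levy_uniqueness)
  interpret N: prob_space N by fact
  interpret std: prob_space std_normal_distribution by (rule prob_space_normal_density) simp
  show "real_distribution (distr N borel Z)" using assms by (intro N.real_distribution_distr)
  show "real_distribution (distr std_normal_distribution borel (\<lambda>x. \<sigma> * x))"
    by (intro std.real_distribution_distr) simp
  have "(\<integral>x. cis (t * (\<sigma> * x)) \<partial>std_normal_distribution) = char std_normal_distribution (t * \<sigma>)" for t
    by (simp add: char_def cis_conv_exp mult.assoc)
  then have "char (distr std_normal_distribution borel (\<lambda>x. \<sigma> * x)) t =
      complex_of_real (exp (- (t^2 * \<sigma>^2) / 2))" for t
    by (subst char_distr) (auto simp: char_std_normal_distribution power_mult_distrib)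
  then show "char (distr N borel Z) = char (distr std_normal_distribution borel (\<lambda>x. \<sigma> * x))"
    by (intro ext) (simp add: char_distr[OF assms(2)] assms(3))
qed

lemma gaussian_law_scaled_std_normal:
  assumes "0 \<le> \<sigma>"
  shows "gaussian_law (distr std_normal_distribution borel (\<lambda>x. \<sigma> * x))"
proof (cases "\<sigma> = 0")
  case True
  interpret std: prob_space std_normal_distribution by (rule prob_space_normal_density) simp
  have "distr std_normal_distribution borel (\<lambda>x. \<sigma> * x) = return borel 0"
    using True by (simp add: std.distr_const)
  then show ?thesis unfolding gaussian_law_def by blast
next
  case False
  interpret std: prob_space std_normal_distribution by (rule prob_space_normal_density) simp
  have "distributed std_normal_distribution lborel (\<lambda>x. x) std_normal_density"
    unfolding distributed_def by (auto intro!: distr_id2)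
  from std.normal_density_affine[OF this, of \<sigma> 0] False assms
  have "distributed std_normal_distribution lborel (\<lambda>x. \<sigma> * x) (normal_density 0 \<sigma>)" by simp
  then have "distr std_normal_distribution lborel (\<lambda>x. \<sigma> * x) =
      density lborel (\<lambda>t. ennreal (normal_density 0 \<sigma> t))"
    by (simp add: distributed_def)
  moreover have "distr std_normal_distribution lborel (\<lambda>x. \<sigma> * x) =
      distr std_normal_distribution borel (\<lambda>x. \<sigma> * x)"
    by (intro distr_cong) simp_all
  ultimately show ?thesis using False assms unfolding gaussian_law_def
    by (metis less_eq_real_def)
qed

text \<open>The moments come from the identification of the law, not from differentiating the
  characteristic function.\<close>

lemma moments_of_gaussian_char:
  assumes "prob_space N" and Z: "Z \<in> borel_measurable N" and "0 \<le> \<sigma>"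
    and char: "\<And>t. (\<integral>w. cis (t * Z w) \<partial>N) = complex_of_real (exp (- (t^2 * \<sigma>^2) / 2))"
  shows "gaussian_law (distr N borel Z)" "integrable N Z" "(\<integral>w. Z w \<partial>N) = 0"
    "integrable N (\<lambda>w. (Z w)^2)" "(\<integral>w. (Z w)^2 \<partial>N) = \<sigma>^2"
proof -
  note eq = distr_eq_of_gaussian_char[OF assms(1) Z char]
  show "gaussian_law (distr N borel Z)"
    unfolding eq by (rule gaussian_law_scaled_std_normal) fact
  have tr: "integrable N (\<lambda>w. f (Z w)) = integrable std_normal_distribution (\<lambda>x. f (\<sigma> * x))"
    "(\<integral>w. f (Z w) \<partial>N) = (\<integral>x. f (\<sigma> * x) \<partial>std_normal_distribution)"
    if f: "f \<in> borel_measurable borel" for f :: "real \<Rightarrow> real"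
  proof -
    have m: "(\<lambda>x. \<sigma> * x) \<in> borel_measurable std_normal_distribution" by simp
    show "integrable N (\<lambda>w. f (Z w)) = integrable std_normal_distribution (\<lambda>x. f (\<sigma> * x))"
      using integrable_distr_eq[OF Z f] integrable_distr_eq[OF m f] by (simp only: eq)
    show "(\<integral>w. f (Z w) \<partial>N) = (\<integral>x. f (\<sigma> * x) \<partial>std_normal_distribution)"
      using integral_distr[OF Z f] integral_distr[OF m f] by (simp only: eq)
  qed
  note mom = integrable_std_normal_distribution_moment[of 1] integrable_std_normal_distribution_moment[of 2]
    integral_std_normal_distribution_moment_odd[of 1] std_normal_distribution_even_moments(1)[of 1]
  show "integrable N Z" using tr(1)[of "\<lambda>x. x"] mom by simp
  show "(\<integral>w. Z w \<partial>N) = 0" using tr(2)[of "\<lambda>x. x"] mom by simp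
  show "integrable N (\<lambda>w. (Z w)^2)" using tr(1)[of "\<lambda>x. x^2"] mom by (simp add: power_mult_distrib)
  show "(\<integral>w. (Z w)^2 \<partial>N) = \<sigma>^2"
    using tr(2)[of "\<lambda>x. x^2"] mom by (simp add: power_mult_distrib)
qed

section \<open>Gaussian random series\<close>

text \<open>An inequality rather than an identity, because zero vectors swallow their
  coefficients.\<close>

lemma norm_sum_ortho_le:
  assumes "finite F" "ortho_family e F"
  shows "(norm (\<Sum>i\<in>F. c i *\<^sub>R e i))^2 \<le> (\<Sum>i\<in>F. (c i)^2)"
  using assms
proof (induction F rule: finite_induct)
  case (insert i F)
  have "ortho_family e F" using insert.prems by (rule ortho_family_subset) auto
  have 0: "inner (c i *\<^sub>R e i) (\<Sum>j\<in>F. c j *\<^sub>R e j) = 0"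
    using insert by (auto simp: inner_sum_right ortho_family_def intro!: sum.neutral)
  have "e i = 0 \<or> norm (e i) = 1" using insert.prems by (simp add: ortho_family_def)
  then have "(norm (c i *\<^sub>R e i))^2 \<le> (c i)^2" by (auto simp: power_mult_distrib)
  moreover have "(norm (c i *\<^sub>R e i + (\<Sum>j\<in>F. c j *\<^sub>R e j)))^2 =
      (norm (c i *\<^sub>R e i))^2 + (norm (\<Sum>j\<in>F. c j *\<^sub>R e j))^2"
    using 0 by (simp only: power2_norm_eq_inner inner_add_left inner_add_right)
      (simp add: inner_commute)
  ultimately show ?case using insert.IH[OF \<open>ortho_family e F\<close>] insert.hyps by simp
qed simp

lemma summable_ortho_series:
  fixes e :: "nat \<Rightarrow> 'b::{real_inner,banach}"
  assumes "ortho_family e UNIV" "summable (\<lambda>j. (c j)^2)"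
  shows "summable (\<lambda>j. c j *\<^sub>R e j)"
  unfolding summable_Cauchy
proof (intro allI impI)
  fix \<epsilon> :: real assume "0 < \<epsilon>"
  then have "0 < \<epsilon>^2" by simp
  then obtain N where N: "\<And>m n. N \<le> m \<Longrightarrow> norm (sum (\<lambda>j. (c j)^2) {m..<n}) < \<epsilon>^2"
    using assms(2) unfolding summable_Cauchy by blast
  show "\<exists>N. \<forall>m\<ge>N. \<forall>n. norm (\<Sum>j = m..<n. c j *\<^sub>R e j) < \<epsilon>"
  proof (intro exI allI impI)
    fix m n assume "N \<le> m"
    have "(norm (\<Sum>j = m..<n. c j *\<^sub>R e j))^2 \<le> (\<Sum>j = m..<n. (c j)^2)"
      by (intro norm_sum_ortho_le ortho_family_subset[OF assms(1)]) auto
    also have "... < \<epsilon>^2" using N[OF \<open>N \<le> m\<close>, of n] by simp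
    finally show "norm (\<Sum>j = m..<n. c j *\<^sub>R e j) < \<epsilon>"
      using \<open>0 < \<epsilon>\<close> by (simp add: power2_less_imp_less)
  qed
qed

lemma indep_vars_std_normal_sequence:
  defines "\<Omega> \<equiv> PiM (UNIV :: nat set) (\<lambda>_. std_normal_distribution)"
  shows "prob_space \<Omega>" "prob_space.indep_vars \<Omega> (\<lambda>_. borel) (\<lambda>i w. w i) UNIV"
    "distr \<Omega> borel (\<lambda>w. w i) = std_normal_distribution"
    "(\<lambda>w. w i) \<in> borel_measurable \<Omega>"
proof -
  interpret std: prob_space std_normal_distribution by (rule prob_space_normal_density) simp
  interpret P: product_prob_space "\<lambda>_. std_normal_distribution" "UNIV :: nat set"
    by unfold_locales
  interpret \<Omega>: prob_space \<Omega> unfolding \<Omega>_def by (rule P.prob_space_axioms)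
  show "prob_space \<Omega>" by (rule \<Omega>.prob_space_axioms)
  have meas: "(\<lambda>w. w i) \<in> measurable \<Omega> std_normal_distribution" for i
    unfolding \<Omega>_def by (rule measurable_component_singleton) simp
  moreover have "measurable \<Omega> std_normal_distribution = borel_measurable \<Omega>"
    by (rule measurable_cong_sets) simp_all
  ultimately show m: "(\<lambda>w. w i) \<in> borel_measurable \<Omega>" for i by simp
  have comp: "distr \<Omega> borel (\<lambda>w. w i) = std_normal_distribution" for i
  proof -
    have "distr \<Omega> borel (\<lambda>w. w i) = distr \<Omega> std_normal_distribution (\<lambda>w. w i)"
      by (intro distr_cong) simp_all
    then show ?thesis using P.PiM_component[of i] unfolding \<Omega>_def by simp
  qed
  then show "distr \<Omega> borel (\<lambda>w. w i) = std_normal_distribution" .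
  show "\<Omega>.indep_vars (\<lambda>_. borel) (\<lambda>i w. w i) UNIV"
  proof (subst \<Omega>.indep_vars_iff_distr_eq_PiM)
    have s: "sets (PiM UNIV (\<lambda>_::nat. borel :: real measure)) = sets \<Omega>"
      unfolding \<Omega>_def by (intro sets_PiM_cong) simp_all
    have "distr \<Omega> (PiM UNIV (\<lambda>_. borel)) (\<lambda>x. restrict (\<lambda>i. x i) UNIV) = distr \<Omega> \<Omega> (\<lambda>x. x)"
      by (intro distr_cong s) (simp_all add: restrict_UNIV)
    also have "... = \<Omega>" by (rule distr_id)
    also have "... = PiM UNIV (\<lambda>i. distr \<Omega> borel (\<lambda>w. w i))" unfolding comp by (simp add: \<Omega>_def)
    finally show "distr \<Omega> (PiM UNIV (\<lambda>_. borel)) (\<lambda>x. restrict (\<lambda>i. x i) UNIV) =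
      PiM UNIV (\<lambda>i. distr \<Omega> borel (\<lambda>w. w i))" .
  qed (use m in auto)
qed

lemma char_linear_combination_std_normal:
  fixes c :: "nat \<Rightarrow> real"
  defines "\<Omega> \<equiv> PiM (UNIV :: nat set) (\<lambda>_. std_normal_distribution)"
  shows "(\<integral>w. cis (\<Sum>k<n. c k * w k) \<partial>\<Omega>) = complex_of_real (exp (- (\<Sum>k<n. (c k)^2) / 2))"
proof -
  note \<Omega> = indep_vars_std_normal_sequence[folded \<Omega>_def]
  interpret \<Omega>: prob_space \<Omega> by (rule \<Omega>)
  have "\<Omega>.indep_vars (\<lambda>_. borel) (\<lambda>k w. c k * w k) {..<n}"
    by (rule \<Omega>.indep_vars_compose2[OF \<Omega>.indep_vars_subset[OF \<Omega>(2)]]) auto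
  from \<Omega>.char_distr_sum[OF this, of 1]
  have "(\<integral>w. cis (\<Sum>k<n. c k * w k) \<partial>\<Omega>) = (\<Prod>k<n. \<integral>w. cis (c k * w k) \<partial>\<Omega>)"
    using \<Omega>(4) by (simp add: char_distr)
  also have "... = (\<Prod>k<n. char std_normal_distribution (c k))"
  proof (rule prod.cong)
    fix k
    have "char (distr \<Omega> borel (\<lambda>w. w k)) (c k) = (\<integral>w. cis (c k * w k) \<partial>\<Omega>)"
      by (rule char_distr[OF \<Omega>(4)])
    then show "(\<integral>w. cis (c k * w k) \<partial>\<Omega>) = char std_normal_distribution (c k)"
      by (simp only: \<Omega>(3))
  qed simp
  also have "... = complex_of_real (\<Prod>k<n. exp (- ((c k)^2 / 2)))"
    by (simp add: char_std_normal_distribution)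
  also have "(\<Prod>k<n. exp (- ((c k)^2 / 2))) = exp (\<Sum>k<n. - ((c k)^2 / 2))"
    by (rule exp_sum[symmetric]) simp
  also have "(\<Sum>k<n. - ((c k)^2 / 2)) = - (\<Sum>k<n. (c k)^2) / 2"
    by (simp add: sum_negf sum_divide_distrib)
  finally show ?thesis .
qed

text \<open>Stated for nonnegative integrals, which commute with the sum unconditionally;
  integrability of the squared norm can then be read off from finiteness of the right side.\<close>

lemma nn_integral_norm_square_Parseval:
  fixes Z :: "'a \<Rightarrow> 'b::{real_inner,banach,second_countable_topology}"
  assumes [measurable]: "Z \<in> borel_measurable M" and e: "total_family e (UNIV :: nat set)"
  shows "(\<integral>\<^sup>+w. ennreal ((norm (Z w))^2) \<partial>M) = (\<Sum>j. \<integral>\<^sup>+w. ennreal ((inner (e j) (Z w))^2) \<partial>M)"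
proof -
  have "ennreal ((norm v)^2) = (\<Sum>j. ennreal ((inner (e j) v)^2))" for v
    using Parseval_sums[OF e, of v] by (simp add: suminf_ennreal2 sums_iff)
  then show ?thesis by (simp add: nn_integral_suminf)
qed

text \<open>Formally the vector is the sum of \<open>w k *\<^sub>R a k\<close> over independent
  standard normal \<open>w k\<close>, with the Cholesky vectors \<open>a k\<close>. It is expanded
  along \<open>e\<close> instead: by triangularity each coordinate is a finite combination of the
  \<open>w k\<close>, and only the orthogonal series over \<open>j\<close> has to converge. It does
  so almost surely, because the mean of the squared coordinates adds up to the trace.\<close>

theorem exists_gaussian_measure:
  fixes C :: "'b::{real_inner,banach,second_countable_topology} \<Rightarrow> 'b"
  assumes C: "positive_operator C" "bounded_linear C" and e: "total_family e (UNIV :: nat set)"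
    and tr: "summable (\<lambda>j. inner (C (e j)) (e j))"
  shows "\<exists>N :: 'b measure. prob_space N \<and> sets N = sets borel \<and>
    (\<forall>u. (\<integral>w. cis (inner u w) \<partial>N) = complex_of_real (exp (- inner (C u) u / 2))) \<and>
    integrable N (\<lambda>w. (norm w)^2) \<and> (\<integral>w. (norm w)^2 \<partial>N) = (\<Sum>j. inner (C (e j)) (e j))"
proof -
  define \<Omega> where "\<Omega> = PiM (UNIV :: nat set) (\<lambda>_. std_normal_distribution)"
  note \<Omega> = indep_vars_std_normal_sequence[folded \<Omega>_def]
  interpret \<Omega>: prob_space \<Omega> by (rule \<Omega>)
  have [measurable]: "(\<lambda>w. w i) \<in> borel_measurable \<Omega>" for i by (rule \<Omega>)
  define a where "a = chol_vector C e"
  have o: "ortho_family e UNIV" using e by (rule total_family_ortho)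
  have nn: "0 \<le> inner (C u) u" for u using C(1) by (auto simp: positive_operator_def)
  define x where "x j w = (\<Sum>k<Suc j. inner (a k) (e j) * w k)" for j and w :: "nat \<Rightarrow> real"
  have [measurable]: "x j \<in> borel_measurable \<Omega>" for j unfolding x_def by measurable
  \<comment> \<open>Where the series diverges the value of \<open>suminf\<close> is irrelevant; this
    happens on a null set only.\<close>
  define W where "W w = (\<Sum>j. x j w *\<^sub>R e j)" for w
  have Wm [measurable]: "W \<in> borel_measurable \<Omega>" unfolding W_def by measurable
  \<comment> \<open>For \<open>j < n\<close> the coordinate \<open>x j\<close> may be summed up to
    \<open>n\<close>, since \<open>a k\<close> is orthogonal to \<open>e j\<close> for
    \<open>k > j\<close>. Exchanging the sums collects the projection of \<open>u\<close>.\<close>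
  have partial: "inner u (\<Sum>j<n. x j w *\<^sub>R e j) = (\<Sum>k<n. inner (a k) (fproj e {..<n} u) * w k)" for u n w
  proof -
    have x: "x j w = (\<Sum>k<n. inner (a k) (e j) * w k)" if "j < n" for j
      unfolding x_def
      by (rule sum.mono_neutral_left)
        (use that inner_chol_vector_eq_0[OF C(1), of j] in \<open>auto simp: a_def\<close>)
    have "inner u (\<Sum>j<n. x j w *\<^sub>R e j) = (\<Sum>j<n. (\<Sum>k<n. inner (a k) (e j) * w k) * inner u (e j))"
      by (simp add: inner_sum_right x)
    also have "... = (\<Sum>k<n. \<Sum>j<n. inner (a k) (e j) * w k * inner u (e j))"
      by (simp only: sum_distrib_right) (rule sum.swap)
    also have "... = (\<Sum>k<n. inner (a k) (fproj e {..<n} u) * w k)"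
      by (simp add: fproj_def inner_sum_right sum_distrib_left sum_distrib_right inner_commute mult_ac)
    finally show ?thesis .
  qed
  \<comment> \<open>On the span of the first \<open>n\<close> vectors the finite factorisation is
    exact, so the partial sum has the form of \<open>C\<close> evaluated at the projection of
    \<open>u\<close>.\<close>
  have char_partial: "(\<integral>w. cis (inner u (\<Sum>j<n. x j w *\<^sub>R e j)) \<partial>\<Omega>) =
      complex_of_real (exp (- inner (C (fproj e {..<n} u)) (fproj e {..<n} u) / 2))" for u n
    unfolding partial char_linear_combination_std_normal[folded \<Omega>_def]
    using chol_finite[OF C(1) fproj_in_span] by (simp add: a_def)
  have x2: "integrable \<Omega> (\<lambda>w. (x j w)^2)" "(\<integral>w. (x j w)^2 \<partial>\<Omega>) = inner (C (e j)) (e j)" for j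
  proof -
    let ?\<sigma> = "sqrt (inner (C (e j)) (e j))"
    have "(\<integral>w. cis (t * x j w) \<partial>\<Omega>) = complex_of_real (exp (- (t^2 * ?\<sigma>^2) / 2))" for t
    proof -
      have "(\<integral>w. cis (t * x j w) \<partial>\<Omega>) = (\<integral>w. cis (\<Sum>k<Suc j. (t * inner (a k) (e j)) * w k) \<partial>\<Omega>)"
        unfolding x_def by (simp only: sum_distrib_left mult.assoc)
      also have "(\<Sum>k<Suc j. (t * inner (a k) (e j))^2) = t^2 * inner (C (e j)) (e j)"
        using chol_finite[OF C(1), of "e j" e "Suc j"]
        by (simp only: power_mult_distrib sum_distrib_left[symmetric] a_def) (simp add: span_base)
      ultimately show ?thesis
        using char_linear_combination_std_normal[folded \<Omega>_def, of "\<lambda>k. t * inner (a k) (e j)" "Suc j"]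
        by (simp only: real_sqrt_pow2[OF nn])
    qed
    from moments_of_gaussian_char(4,5)[OF \<Omega>(1) _ _ this] show
      "integrable \<Omega> (\<lambda>w. (x j w)^2)" "(\<integral>w. (x j w)^2 \<partial>\<Omega>) = inner (C (e j)) (e j)"
      by (simp_all add: nn)
  qed
  have nnx: "(\<integral>\<^sup>+w. (\<Sum>j. ennreal ((x j w)^2)) \<partial>\<Omega>) = ennreal (\<Sum>j. inner (C (e j)) (e j))"
  proof -
    have "(\<integral>\<^sup>+w. (\<Sum>j. ennreal ((x j w)^2)) \<partial>\<Omega>) = (\<Sum>j. \<integral>\<^sup>+w. ennreal ((x j w)^2) \<partial>\<Omega>)"
      by (intro nn_integral_suminf) simp
    also have "... = (\<Sum>j. ennreal (inner (C (e j)) (e j)))"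
      by (simp add: nn_integral_eq_integral[OF x2(1)] x2(2))
    also have "... = ennreal (\<Sum>j. inner (C (e j)) (e j))"
      by (intro suminf_ennreal2 nn tr)
    finally show ?thesis .
  qed
  have "AE w in \<Omega>. (\<Sum>j. ennreal ((x j w)^2)) \<noteq> \<infinity>"
    by (intro nn_integral_noteq_infinite) (use nnx in simp_all)
  then have AE_sum: "AE w in \<Omega>. summable (\<lambda>j. (x j w)^2)"
    by eventually_elim (rule summable_suminf_not_top, simp_all)
  then have AE_W: "AE w in \<Omega>. (\<lambda>j. x j w *\<^sub>R e j) sums W w"
    by eventually_elim (simp add: W_def summable_sums summable_ortho_series[OF o])
  \<comment> \<open>Two limits of the same characteristic functions: dominated convergence along the
    series, and continuity of the quadratic form of \<open>C\<close> along the projections of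
    \<open>u\<close>.\<close>
  have charW: "(\<integral>w. cis (inner u (W w)) \<partial>\<Omega>) = complex_of_real (exp (- inner (C u) u / 2))" for u
  proof (rule LIMSEQ_unique)
    show "(\<lambda>n. \<integral>w. cis (inner u (\<Sum>j<n. x j w *\<^sub>R e j)) \<partial>\<Omega>) \<longlonglongrightarrow> (\<integral>w. cis (inner u (W w)) \<partial>\<Omega>)"
    proof (rule integral_dominated_convergence[where w="\<lambda>_. 1"])
      show "AE w in \<Omega>. (\<lambda>n. cis (inner u (\<Sum>j<n. x j w *\<^sub>R e j))) \<longlonglongrightarrow> cis (inner u (W w))"
        using AE_W
      proof eventually_elim
        case (elim w)
        have "continuous_on UNIV (\<lambda>w. cis (inner u w))" by (intro continuous_intros)
        then have "isCont (\<lambda>w. cis (inner u w)) (W w)" by (simp add: continuous_on_eq_continuous_at)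
        then show ?case using elim unfolding sums_def by (rule isCont_tendsto_compose)
      qed
    qed simp_all
    have "(\<lambda>n. inner (C (fproj e {..<n} u)) (fproj e {..<n} u)) \<longlonglongrightarrow> inner (C u) u"
      by (intro tendsto_inner bounded_linear.tendsto[OF C(2)] fproj_tendsto[OF e])
    then show "(\<lambda>n. \<integral>w. cis (inner u (\<Sum>j<n. x j w *\<^sub>R e j)) \<partial>\<Omega>)
        \<longlonglongrightarrow> complex_of_real (exp (- inner (C u) u / 2))"
      unfolding char_partial
      by (intro tendsto_of_real tendsto_exp tendsto_divide tendsto_minus tendsto_const) simp_all
  qed
  have inner_W: "integrable \<Omega> (\<lambda>w. (inner u (W w))^2)"
    "(\<integral>w. (inner u (W w))^2 \<partial>\<Omega>) = inner (C u) u" for u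
  proof -
    have "(\<integral>w. cis (t * inner u (W w)) \<partial>\<Omega>) =
        complex_of_real (exp (- (t^2 * (sqrt (inner (C u) u))^2) / 2))" for t
    proof -
      have "inner (C (t *\<^sub>R u)) (t *\<^sub>R u) = t^2 * inner (C u) u"
        by (simp add: linear_scale[OF bounded_linear.linear[OF C(2)]] power2_eq_square)
      then show ?thesis using charW[of "t *\<^sub>R u"] by (simp add: nn)
    qed
    from moments_of_gaussian_char(4,5)[OF \<Omega>(1) _ _ this]
    show "integrable \<Omega> (\<lambda>w. (inner u (W w))^2)"
      "(\<integral>w. (inner u (W w))^2 \<partial>\<Omega>) = inner (C u) u"
      by (simp_all add: nn)
  qed
  have nW: "(\<integral>\<^sup>+w. ennreal ((norm (W w))^2) \<partial>\<Omega>) = ennreal (\<Sum>j. inner (C (e j)) (e j))"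
  proof -
    have "(\<integral>\<^sup>+w. ennreal ((norm (W w))^2) \<partial>\<Omega>) =
        (\<Sum>j. \<integral>\<^sup>+w. ennreal ((inner (e j) (W w))^2) \<partial>\<Omega>)"
      by (rule nn_integral_norm_square_Parseval[OF Wm e])
    also have "... = (\<Sum>j. ennreal (inner (C (e j)) (e j)))"
      by (simp add: nn_integral_eq_integral[OF inner_W(1)] inner_W(2))
    also have "... = ennreal (\<Sum>j. inner (C (e j)) (e j))"
      by (intro suminf_ennreal2 nn tr)
    finally show ?thesis .
  qed
  have "0 \<le> (\<Sum>j. inner (C (e j)) (e j))" by (intro suminf_nonneg tr nn)
  then have W2: "has_bochner_integral \<Omega> (\<lambda>w. (norm (W w))^2) (\<Sum>j. inner (C (e j)) (e j))"
    using nW by (intro has_bochner_integral_nn_integral) auto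
  show ?thesis
  proof (intro exI[of _ "distr \<Omega> borel W"] conjI allI)
    show "prob_space (distr \<Omega> borel W)" by (rule \<Omega>.prob_space_distr[OF Wm])
  qed (use W2 charW in \<open>auto simp: integral_distr integrable_distr_eq has_bochner_integral_iff\<close>)
qed

section \<open>Disintegration and second moments\<close>

text \<open>The condition on the kernel is agreement on rectangles, a generator stable under
  intersections, so two measures on the product coincide. Nonnegative \<open>f\<close> avoids
  questions of integrability.\<close>

lemma joint_law_disintegration:
  assumes "prob_space M" and X: "X \<in> M \<rightarrow>\<^sub>M C" and Y: "Y \<in> M \<rightarrow>\<^sub>M R"
    and \<kappa>: "regular_conditional_distribution M C X R Y \<kappa>"
    and f: "f \<in> borel_measurable (C \<Otimes>\<^sub>M R)"
  shows "(\<integral>\<^sup>+w. f (X w, Y w) \<partial>M) = (\<integral>\<^sup>+w. (\<integral>\<^sup>+y. f (X w, y) \<partial>\<kappa> (X w)) \<partial>M)"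
proof -
  interpret M: prob_space M by fact
  let ?P = "C \<Otimes>\<^sub>M R"
  let ?\<mu> = "distr M C X"
  interpret \<mu>: prob_space ?\<mu> by (rule M.prob_space_distr[OF X])
  have \<kappa>p: "\<kappa> \<in> C \<rightarrow>\<^sub>M prob_algebra R" using \<kappa> by (simp add: regular_conditional_distribution_def)
  have \<kappa>m [measurable]: "\<kappa> \<in> C \<rightarrow>\<^sub>M subprob_algebra R" by (rule measurable_prob_algebraD[OF \<kappa>p])
  have set\<kappa>: "sets (\<kappa> z) = sets R" if "z \<in> space C" for z
    by (rule sets_kernel[OF \<kappa>m that])
  \<comment> \<open>\<open>\<tau> z\<close> is the law of \<open>(z, y)\<close> with
    \<open>y\<close> drawn from \<open>\<kappa> z\<close>; binding it to the law of \<open>X\<close>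
    gives the candidate for the joint law.\<close>
  define \<tau> where "\<tau> z = \<kappa> z \<bind> (\<lambda>y. return ?P (z, y))" for z
  have \<tau>m [measurable]: "\<tau> \<in> C \<rightarrow>\<^sub>M subprob_algebra ?P" unfolding \<tau>_def by measurable
  have \<tau>: "(\<integral>\<^sup>+p. g p \<partial>\<tau> z) = (\<integral>\<^sup>+y. g (z, y) \<partial>\<kappa> z)"
    if "z \<in> space C" and g [measurable]: "g \<in> borel_measurable ?P" for g z
  proof -
    have r: "(\<lambda>y. return ?P (z, y)) \<in> \<kappa> z \<rightarrow>\<^sub>M subprob_algebra ?P"
      using that(1) by (simp add: measurable_cong_sets[OF set\<kappa> refl])
    have "space (\<kappa> z) \<noteq> {}"
      using measurable_space[OF \<kappa>p that(1)] by (simp add: space_prob_algebra prob_space.not_empty)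
    have "(\<integral>\<^sup>+p. g p \<partial>\<tau> z) = (\<integral>\<^sup>+y. (\<integral>\<^sup>+p. g p \<partial>return ?P (z, y)) \<partial>\<kappa> z)"
      unfolding \<tau>_def by (rule nn_integral_bind[OF g r])
    also have "... = (\<integral>\<^sup>+y. g (z, y) \<partial>\<kappa> z)"
      using that sets_eq_imp_space_eq[OF set\<kappa>[OF that(1)]]
      by (intro nn_integral_cong nn_integral_return) (auto simp: space_pair_measure)
    finally show ?thesis .
  qed
  have \<tau>\<mu>: "\<tau> \<in> ?\<mu> \<rightarrow>\<^sub>M subprob_algebra ?P" by simp
  have XY: "(\<lambda>w. (X w, Y w)) \<in> M \<rightarrow>\<^sub>M ?P" using X Y by simp
  have "distr M ?P (\<lambda>w. (X w, Y w)) = ?\<mu> \<bind> \<tau>"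
  proof (rule measure_eqI_generator_eq[OF Int_stable_pair_measure_generator,
        where \<Omega>="space C \<times> space R" and A="\<lambda>_. space C \<times> space R"])
    show "{a \<times> b |a b. a \<in> sets C \<and> b \<in> sets R} \<subseteq> Pow (space C \<times> space R)"
      using sets.sets_into_space[of _ C] sets.sets_into_space[of _ R] by blast
    have "sets (?\<mu> \<bind> \<tau>) = sets ?P" by (rule sets_bind[OF sets_kernel[OF \<tau>\<mu>]]) (simp_all add: \<mu>.not_empty[simplified])
    then show "sets (?\<mu> \<bind> \<tau>) = sigma_sets (space C \<times> space R) {a \<times> b |a b. a \<in> sets C \<and> b \<in> sets R}"
      by (simp add: sets_pair_measure)
    show "sets (distr M ?P (\<lambda>w. (X w, Y w))) =
        sigma_sets (space C \<times> space R) {a \<times> b |a b. a \<in> sets C \<and> b \<in> sets R}"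
      by (simp add: sets_pair_measure)
    show "emeasure (distr M ?P (\<lambda>w. (X w, Y w))) (space C \<times> space R) \<noteq> \<infinity>"
      using finite_measure.emeasure_finite[OF M.finite_measure_distr[OF XY]] by simp
    fix Q assume "Q \<in> {a \<times> b |a b. a \<in> sets C \<and> b \<in> sets R}"
    then obtain A B where Q: "Q = A \<times> B" and A [measurable]: "A \<in> sets C" and B [measurable]: "B \<in> sets R"
      by blast
    have "emeasure (?\<mu> \<bind> \<tau>) Q = (\<integral>\<^sup>+z. emeasure (\<tau> z) Q \<partial>?\<mu>)"
      unfolding Q by (rule emeasure_bind[OF _ \<tau>\<mu>]) (use \<mu>.not_empty in auto)
    also have "... = (\<integral>\<^sup>+z. emeasure (\<kappa> z) B * indicator A z \<partial>?\<mu>)"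
    proof (rule nn_integral_cong)
      fix z assume "z \<in> space ?\<mu>"
      then have z: "z \<in> space C" by simp
      have "emeasure (\<tau> z) Q = (\<integral>\<^sup>+p. indicator Q p \<partial>\<tau> z)"
        unfolding Q using sets_kernel[OF \<tau>m z] by (intro nn_integral_indicator[symmetric]) auto
      also have "... = (\<integral>\<^sup>+y. indicator Q (z, y) \<partial>\<kappa> z)"
        unfolding Q by (rule \<tau>[OF z]) measurable
      also have "... = (\<integral>\<^sup>+y. indicator A z * indicator B y \<partial>\<kappa> z)"
        by (simp add: Q indicator_times)
      also have "... = emeasure (\<kappa> z) B * indicator A z"
        using B set\<kappa>[OF z] by (subst nn_integral_cmult_indicator) (auto simp: mult.commute)
      finally show "emeasure (\<tau> z) Q = emeasure (\<kappa> z) B * indicator A z" .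
    qed
    also have "... = emeasure M {w\<in>space M. X w \<in> A \<and> Y w \<in> B}"
      using \<kappa> A B unfolding regular_conditional_distribution_def by simp
    also have "... = emeasure (distr M ?P (\<lambda>w. (X w, Y w))) Q"
      unfolding Q by (subst emeasure_distr[OF XY]) (auto intro!: arg_cong[where f="emeasure M"])
    finally show "emeasure (distr M ?P (\<lambda>w. (X w, Y w))) Q = emeasure (?\<mu> \<bind> \<tau>) Q" by simp
  qed auto
  moreover have "(\<integral>\<^sup>+p. f p \<partial>distr M ?P (\<lambda>w. (X w, Y w))) = (\<integral>\<^sup>+w. f (X w, Y w) \<partial>M)"
    by (rule nn_integral_distr[OF XY]) (simp add: f)
  ultimately have "(\<integral>\<^sup>+w. f (X w, Y w) \<partial>M) = (\<integral>\<^sup>+p. f p \<partial>(?\<mu> \<bind> \<tau>))" by simp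
  also have "... = (\<integral>\<^sup>+z. (\<integral>\<^sup>+p. f p \<partial>\<tau> z) \<partial>?\<mu>)" by (rule nn_integral_bind[OF f \<tau>\<mu>])
  also have "... = (\<integral>\<^sup>+z. (\<integral>\<^sup>+y. f (z, y) \<partial>\<kappa> z) \<partial>?\<mu>)"
    by (intro nn_integral_cong \<tau> f) simp
  also have "... = (\<integral>\<^sup>+w. (\<integral>\<^sup>+y. f (X w, y) \<partial>\<kappa> (X w)) \<partial>M)"
    by (rule nn_integral_distr[OF X]) (simp, rule nn_integral_measurable_subprob_algebra2[OF _ \<kappa>m], use f in simp)
  finally show ?thesis .
qed

lemma cond_mean_measurable:
  fixes G :: "'r \<Rightarrow> 'g::{banach,second_countable_topology}"
  assumes "\<kappa> \<in> C \<rightarrow>\<^sub>M prob_algebra R" "G \<in> borel_measurable R"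
  shows "cond_mean \<kappa> G \<in> borel_measurable C"
  unfolding cond_mean_def
  by (rule measurable_compose[OF measurable_prob_algebraD[OF assms(1)] integral_measurable_subprob_algebra[OF assms(2)]])

text \<open>\<open>t powr p \<le> 1 + t powr \<nu>\<close> for \<open>t \<ge> 0\<close>. The
  resulting bound depends on \<open>c\<close> alone and is therefore uniform over conditional
  laws.\<close>

lemma (in prob_space) powr_moment_bounds:
  fixes Z :: "'a \<Rightarrow> 'g::{banach,second_countable_topology}"
  assumes Z [measurable]: "Z \<in> borel_measurable M" and "0 \<le> p" "p \<le> \<nu>"
    and c: "(\<integral>\<^sup>+w. ennreal (norm (Z w) powr \<nu>) \<partial>M) \<le> ennreal c" "0 \<le> c"
  shows "integrable M (\<lambda>w. norm (Z w) powr p)"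
    "(\<integral>\<^sup>+w. ennreal (norm (Z w) powr p) \<partial>M) \<le> ennreal (1 + c)"
proof -
  have le: "norm (Z w) powr p \<le> 1 + norm (Z w) powr \<nu>" for w
  proof (cases "norm (Z w) \<le> 1")
    case True
    then have "norm (Z w) powr p \<le> 1" using assms by (intro powr_le1) auto
    then show ?thesis by (simp add: add_increasing2)
  next
    case False
    then have "norm (Z w) powr p \<le> norm (Z w) powr \<nu>" using assms by (intro powr_mono) auto
    then show ?thesis by simp
  qed
  have "(\<integral>\<^sup>+w. ennreal (norm (Z w) powr p) \<partial>M) \<le> (\<integral>\<^sup>+w. 1 + ennreal (norm (Z w) powr \<nu>) \<partial>M)"
    using le by (intro nn_integral_mono) (simp add: ennreal_plus[symmetric] del: ennreal_plus flip: ennreal_1)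
  also have "... = 1 + (\<integral>\<^sup>+w. ennreal (norm (Z w) powr \<nu>) \<partial>M)"
    by (subst nn_integral_add) (auto simp: emeasure_space_1)
  also have "... \<le> ennreal (1 + c)" using c by (simp add: add_left_mono flip: ennreal_1)
  finally show bd: "(\<integral>\<^sup>+w. ennreal (norm (Z w) powr p) \<partial>M) \<le> ennreal (1 + c)" .
  show "integrable M (\<lambda>w. norm (Z w) powr p)"
  proof (rule integrableI_bounded)
    have "(\<integral>\<^sup>+w. ennreal (norm (norm (Z w) powr p)) \<partial>M) \<le> ennreal (1 + c)" using bd by simp
    then show "(\<integral>\<^sup>+w. ennreal (norm (norm (Z w) powr p)) \<partial>M) < \<infinity>"
      by (rule le_less_trans) simp
  qed simp
qed

section \<open>Covariances of vectors with square integrable norm\<close>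

lemma integral_norm_square_sums:
  fixes Z :: "'a \<Rightarrow> 'b::{real_inner,banach,second_countable_topology}"
  assumes Z: "Z \<in> borel_measurable M" "integrable M (\<lambda>w. (norm (Z w))^2)"
    and e: "total_family e (UNIV :: nat set)"
  shows "(\<lambda>j. \<integral>w. (inner (e j) (Z w))^2 \<partial>M) sums (\<integral>w. (norm (Z w))^2 \<partial>M)"
proof -
  have "(\<Sum>j. ennreal (\<integral>w. (inner (e j) (Z w))^2 \<partial>M)) = ennreal (\<integral>w. (norm (Z w))^2 \<partial>M)"
    using nn_integral_norm_square_Parseval[OF Z(1) e]
    by (simp add: nn_integral_eq_integral Z(2) integrable_inner_square[OF Z])
  moreover have "(\<lambda>j. ennreal (\<integral>w. (inner (e j) (Z w))^2 \<partial>M)) sums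
      (\<Sum>j. ennreal (\<integral>w. (inner (e j) (Z w))^2 \<partial>M))" by (simp add: summable_sums)
  ultimately have "(\<lambda>j. ennreal (\<integral>w. (inner (e j) (Z w))^2 \<partial>M)) sums
      ennreal (\<integral>w. (norm (Z w))^2 \<partial>M)" by simp
  then show ?thesis by (subst (asm) sums_ennreal) auto
qed

text \<open>The operator that represents the form is given directly as a Bochner integral, instead
  of through a representation theorem.\<close>

lemma covariance_operator:
  fixes Z :: "'a \<Rightarrow> 'b::{real_inner,banach,second_countable_topology}"
  assumes [measurable]: "Z \<in> borel_measurable M" and Z2: "integrable M (\<lambda>w. (norm (Z w))^2)"
  defines "C u \<equiv> \<integral>w. inner u (Z w) *\<^sub>R Z w \<partial>M"
  shows "bounded_linear C" "positive_operator C"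
    "\<And>u v. inner (C u) v = (\<integral>w. inner u (Z w) * inner v (Z w) \<partial>M)"
proof -
  have int: "integrable M (\<lambda>w. inner u (Z w) *\<^sub>R Z w)" for u
  proof (rule Bochner_Integration.integrable_bound)
    show "integrable M (\<lambda>w. norm u * (norm (Z w))^2)" using Z2 by simp
    have "\<bar>inner u w\<bar> * norm w \<le> norm u * (norm w)^2" for w
      using mult_right_mono[OF Cauchy_Schwarz_ineq2[of u w], of "norm w"]
      by (simp add: power2_eq_square mult.assoc)
    then show "AE w in M. norm (inner u (Z w) *\<^sub>R Z w) \<le> norm (norm u * (norm (Z w))^2)"
      by simp
  qed simp
  have inner_C: "inner (C u) v = (\<integral>w. inner u (Z w) * inner v (Z w) \<partial>M)" for u v
    unfolding C_def using int[of u]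
    by (subst integral_inner_left[symmetric]) (auto simp: inner_commute)
  then show "\<And>u v. inner (C u) v = (\<integral>w. inner u (Z w) * inner v (Z w) \<partial>M)" .
  show bl: "bounded_linear C"
  proof (rule bounded_linear_intro)
    show "C (u + v) = C u + C v" for u v
      unfolding C_def by (simp add: inner_add_left scaleR_add_left int)
    show "C (r *\<^sub>R u) = r *\<^sub>R C u" for r u
      unfolding C_def by (simp add: int flip: integral_scaleR_right)
    show "norm (C u) \<le> norm u * (\<integral>w. (norm (Z w))^2 \<partial>M)" for u
    proof -
      have "norm (C u) \<le> (\<integral>w. norm (inner u (Z w) *\<^sub>R Z w) \<partial>M)"
        unfolding C_def by (rule integral_norm_bound)
      also have "... \<le> (\<integral>w. norm u * (norm (Z w))^2 \<partial>M)"
      proof (rule integral_mono)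
        show "norm (inner u (Z w) *\<^sub>R Z w) \<le> norm u * (norm (Z w))^2" for w
          using mult_right_mono[OF Cauchy_Schwarz_ineq2[of u "Z w"], of "norm (Z w)"]
          by (simp add: power2_eq_square mult.assoc)
      qed (use integrable_norm[OF int] Z2 in \<open>simp_all del: norm_scaleR\<close>)
      finally show ?thesis by simp
    qed
  qed
  have "inner (C u) v = inner u (C v)" for u v
    unfolding inner_commute[of u] inner_C by (simp add: mult.commute)
  moreover have "0 \<le> inner (C u) u" for u
    unfolding inner_C by simp
  ultimately show "positive_operator C"
    using bounded_linear.linear[OF bl] by (simp add: positive_operator_def)
qed

lemma (in prob_space) integral_square_sum_indep:
  fixes X :: "'i \<Rightarrow> 'a \<Rightarrow> real"
  assumes "finite I" and ind: "indep_vars (\<lambda>_. borel) X I"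
    and X2: "\<And>i. i \<in> I \<Longrightarrow> integrable M (\<lambda>w. (X i w)^2)" and X0: "\<And>i. i \<in> I \<Longrightarrow> (\<integral>w. X i w \<partial>M) = 0"
  shows "integrable M (\<lambda>w. (\<Sum>i\<in>I. X i w)^2)"
    "(\<integral>w. (\<Sum>i\<in>I. X i w)^2 \<partial>M) = (\<Sum>i\<in>I. \<integral>w. (X i w)^2 \<partial>M)"
proof -
  have Xm: "X i \<in> borel_measurable M" if "i \<in> I" for i
    using ind that by (auto simp: indep_vars_def2)
  have Xi: "integrable M (X i)" if "i \<in> I" for i
    by (rule square_integrable_imp_integrable[OF Xm[OF that] X2[OF that]])
  have off: "integrable M (\<lambda>w. X i w * X j w)" "(\<integral>w. X i w * X j w \<partial>M) = 0"
    if "i \<in> I" "j \<in> I" "i \<noteq> j" for i j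
  proof -
    have "indep_var borel (X i) borel (X j)" 
      using indep_vars_sum[OF _ _ indep_vars_subset[OF ind], of "{j}" i] that by simp
    from indep_var_lebesgue_integral[OF this Xi[OF that(1)] Xi[OF that(2)]]
      indep_var_integrable[OF this Xi[OF that(1)] Xi[OF that(2)]]
    show "integrable M (\<lambda>w. X i w * X j w)" "(\<integral>w. X i w * X j w \<partial>M) = 0"
      using X0[OF that(1)] by auto
  qed
  have int: "integrable M (\<lambda>w. X i w * X j w)" if "i \<in> I" "j \<in> I" for i j
    using off(1)[OF that] X2[OF that(1)] by (cases "i = j") (auto simp: power2_eq_square)
  have eq: "(\<Sum>i\<in>I. X i w)^2 = (\<Sum>i\<in>I. \<Sum>j\<in>I. X i w * X j w)" for w
    by (simp add: power2_eq_square sum_product)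
  show "integrable M (\<lambda>w. (\<Sum>i\<in>I. X i w)^2)"
    unfolding eq by (intro Bochner_Integration.integrable_sum int)
  have "(\<integral>w. (\<Sum>i\<in>I. X i w)^2 \<partial>M) = (\<Sum>i\<in>I. \<Sum>j\<in>I. \<integral>w. X i w * X j w \<partial>M)"
    unfolding eq by (subst Bochner_Integration.integral_sum,
        simp add: int, intro sum.cong refl, subst Bochner_Integration.integral_sum) (auto simp: int)
  also have "... = (\<Sum>i\<in>I. \<Sum>j\<in>I. if j = i then \<integral>w. (X i w)^2 \<partial>M else 0)"
    using off(2) by (intro sum.cong refl) (auto simp: power2_eq_square)
  also have "... = (\<Sum>i\<in>I. \<integral>w. (X i w)^2 \<partial>M)"
    using \<open>finite I\<close> by simp
  finally show "(\<integral>w. (\<Sum>i\<in>I. X i w)^2 \<partial>M) = (\<Sum>i\<in>I. \<integral>w. (X i w)^2 \<partial>M)" .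
qed

section \<open>Rows of independent, identically distributed vectors\<close>

lemma exp_minus_bounds:
  fixes a :: real
  assumes "0 \<le> a"
  shows "\<bar>exp (- a) - (1 - a)\<bar> \<le> a^2"
proof -
  have "1 - a \<le> exp (- a)" using exp_ge_add_one_self[of "- a"] by simp
  moreover have "exp (- a) \<le> 1 - a + a^2"
  proof -
    have "exp (- a) \<le> 1 / (1 + a)"
      using exp_ge_add_one_self[of a] assms by (simp add: exp_minus inverse_eq_divide frac_le)
    \<comment> \<open>The product on the right equals \<open>1 + a^3\<close>.\<close>
    also have "1 \<le> (1 - a + a^2) * (1 + a)"
      using assms by (simp add: power2_eq_square algebra_simps)
    then have "1 / (1 + a) \<le> 1 - a + a^2" using assms by (simp add: pos_divide_le_eq)
    finally show ?thesis .
  qed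
  ultimately show ?thesis by (simp add: abs_le_iff)
qed

text \<open>The Taylor remainder, one sixth of the minimum of \<open>6 * Z^2\<close> and
  \<open>\<bar>Z\<bar>^3\<close>, is at most \<open>\<bar>Z\<bar> powr p\<close>: the cube serves
  for \<open>\<bar>Z\<bar> \<le> 1\<close>, the square otherwise. The squared variance is the cost
  of replacing \<open>1 - v / 2\<close> by \<open>exp (- v / 2)\<close>.\<close>

lemma (in prob_space) cis_expectation_approx:
  fixes Z :: "'a \<Rightarrow> real"
  assumes [measurable]: "Z \<in> borel_measurable M" and Z2: "integrable M (\<lambda>w. (Z w)^2)"
    and Z0: "(\<integral>w. Z w \<partial>M) = 0" and p: "2 < p" "p \<le> 3"
    and Zp: "integrable M (\<lambda>w. \<bar>Z w\<bar> powr p)"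
  shows "norm ((\<integral>w. cis (Z w) \<partial>M) - complex_of_real (exp (- (\<integral>w. (Z w)^2 \<partial>M) / 2)))
    \<le> (\<integral>w. \<bar>Z w\<bar> powr p \<partial>M) + (\<integral>w. (Z w)^2 \<partial>M)^2"
proof -
  let ?v = "\<integral>w. (Z w)^2 \<partial>M"
  have Z1: "integrable M Z" by (rule square_integrable_imp_integrable[OF _ Z2]) simp
  have "norm (char (distr M borel Z) 1 - complex_of_real (1 - 1^2 * ?v / 2)) \<le>
      (1^2 / 6) * expectation (\<lambda>w. min (6 * (Z w)^2) (\<bar>1\<bar> * \<bar>Z w\<bar> ^ 3))"
    by (rule char_approx3') (use Z0 Z1 Z2 in auto)
  also have "... \<le> (1^2 / 6) * expectation (\<lambda>w. 6 * \<bar>Z w\<bar> powr p)"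
  proof (intro mult_left_mono integral_mono)
    show "integrable M (\<lambda>w. min (6 * (Z w)^2) (\<bar>1\<bar> * \<bar>Z w\<bar> ^ 3))"
      by (rule Bochner_Integration.integrable_bound[where f="\<lambda>w. 6 * (Z w)^2"]) (use Z2 in auto)
    show "min (6 * (Z w)^2) (\<bar>1\<bar> * \<bar>Z w\<bar> ^ 3) \<le> 6 * \<bar>Z w\<bar> powr p" for w
    proof (cases "\<bar>Z w\<bar> \<le> 1")
      case True
      have "\<bar>Z w\<bar> ^ 3 \<le> \<bar>Z w\<bar> powr p"
      proof (cases "Z w = 0")
        case False
        then have "\<bar>Z w\<bar> ^ 3 = \<bar>Z w\<bar> powr 3" by (simp flip: powr_numeral)
        also have "... \<le> \<bar>Z w\<bar> powr p" using True p False by (intro powr_mono') auto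
        finally show ?thesis .
      qed simp
      moreover have "0 \<le> \<bar>Z w\<bar> powr p" by simp
      ultimately have "\<bar>Z w\<bar> ^ 3 \<le> 6 * \<bar>Z w\<bar> powr p" by linarith
      then show ?thesis by (simp add: min.coboundedI2)
    next
      case False
      have "(Z w)^2 = \<bar>Z w\<bar> powr 2" using False by (subst powr_numeral) auto
      also have "... \<le> \<bar>Z w\<bar> powr p" using False p by (intro powr_mono) auto
      finally show ?thesis by (simp add: min.coboundedI1)
    qed
  qed (use Zp in auto)
  finally have 1: "norm ((\<integral>w. cis (Z w) \<partial>M) - complex_of_real (1 - ?v / 2)) \<le> (\<integral>w. \<bar>Z w\<bar> powr p \<partial>M)"
    by (simp add: char_distr)
  have "norm (complex_of_real (1 - ?v / 2) - complex_of_real (exp (- ?v / 2))) =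
      \<bar>exp (- (?v / 2)) - (1 - ?v / 2)\<bar>"
    unfolding of_real_diff[symmetric] norm_of_real by (simp add: abs_minus_commute)
  also have "... \<le> (?v / 2)^2" by (rule exp_minus_bounds) simp
  also have "... \<le> ?v^2" by (simp add: power_divide)
  finally show ?thesis
    using 1 norm_triangle_ineq[of "(\<integral>w. cis (Z w) \<partial>M) - complex_of_real (1 - ?v / 2)"
        "complex_of_real (1 - ?v / 2) - complex_of_real (exp (- ?v / 2))"] by simp
qed

text \<open>Powers of numbers in the unit disc satisfy
  \<open>norm (z ^ n - w ^ n) \<le> n * norm (z - w)\<close>, so \<open>n\<close> times the error
  for a single summand has to vanish.\<close>

lemma (in prob_space) Lyapunov_char_tendsto:
  fixes Z :: "nat \<Rightarrow> 'a \<Rightarrow> real"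
  assumes Zm: "\<And>n. n0 \<le> n \<Longrightarrow> Z n \<in> borel_measurable M"
    and Z2: "\<And>n. n0 \<le> n \<Longrightarrow> integrable M (\<lambda>w. (Z n w)^2)"
    and Z0: "\<And>n. n0 \<le> n \<Longrightarrow> (\<integral>w. Z n w \<partial>M) = 0" and p: "2 < p" "p \<le> 3"
    and Zp: "\<And>n. n0 \<le> n \<Longrightarrow> integrable M (\<lambda>w. \<bar>Z n w\<bar> powr p)"
    and var: "(\<lambda>n. real n * (\<integral>w. (Z n w)^2 \<partial>M)) \<longlonglongrightarrow> c"
    and Lyapunov: "(\<lambda>n. real n * (\<integral>w. \<bar>Z n w\<bar> powr p \<partial>M)) \<longlonglongrightarrow> 0"
  shows "(\<lambda>n. (\<integral>w. cis (Z n w) \<partial>M) ^ n) \<longlonglongrightarrow> complex_of_real (exp (- c / 2))"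
proof -
  define v where "v n = (\<integral>w. (Z n w)^2 \<partial>M)" for n
  \<comment> \<open>The term \<open>n * (v n)^2\<close> is split this way because
    \<open>n * v n\<close> converges, leaving a factor \<open>1 / n\<close>.\<close>
  define b where "b n = real n * (\<integral>w. \<bar>Z n w\<bar> powr p \<partial>M) + (real n * v n) * (real n * v n) * inverse (real n)" for n
  have b0: "b \<longlonglongrightarrow> 0"
  proof -
    have "b \<longlonglongrightarrow> 0 + c * c * 0"
      unfolding b_def v_def
      by (intro tendsto_add tendsto_mult Lyapunov var LIMSEQ_inverse_real_of_nat_add[of 0, simplified]
          lim_inverse_n)
    then show ?thesis by simp
  qed
  have close: "norm ((\<integral>w. cis (Z n w) \<partial>M) ^ n - complex_of_real (exp (- (real n * v n) / 2))) \<le> b n"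
    if n: "max 1 n0 \<le> n" for n
  proof -
    have m: "Z n \<in> borel_measurable M" using n Zm by simp
    have "norm (\<integral>w. cis (Z n w) \<partial>M) \<le> (\<integral>w. norm (cis (Z n w)) \<partial>M)"
      by (rule integral_norm_bound)
    then have 1: "norm (\<integral>w. cis (Z n w) \<partial>M) \<le> 1" by (simp add: prob_space)
    have "0 \<le> v n" by (simp add: v_def)
    then have 2: "norm (complex_of_real (exp (- v n / 2))) \<le> 1" by simp
    have "complex_of_real (exp (- (real n * v n) / 2)) = (complex_of_real (exp (- v n / 2))) ^ n"
      by (simp flip: of_real_power exp_of_nat_mult)
    then have "norm ((\<integral>w. cis (Z n w) \<partial>M) ^ n - complex_of_real (exp (- (real n * v n) / 2))) \<le>
        real n * norm ((\<integral>w. cis (Z n w) \<partial>M) - complex_of_real (exp (- v n / 2)))"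
      using norm_power_diff[OF 1 2, of n] by simp
    also have "... \<le> real n * ((\<integral>w. \<bar>Z n w\<bar> powr p \<partial>M) + (v n)^2)"
      unfolding v_def
      by (intro mult_left_mono cis_expectation_approx[OF m Z2 Z0 p Zp]) (use n in auto)
    also have "... = b n" using n by (simp add: b_def power2_eq_square field_simps)
    finally show ?thesis .
  qed
  have "(\<lambda>n. (\<integral>w. cis (Z n w) \<partial>M) ^ n - complex_of_real (exp (- (real n * v n) / 2))) \<longlonglongrightarrow> 0"
    by (rule Lim_null_comparison[OF _ b0])
      (use close in \<open>auto intro!: eventually_sequentiallyI[of "max 1 n0"]\<close>)
  moreover have "(\<lambda>n. complex_of_real (exp (- (real n * v n) / 2))) \<longlonglongrightarrow> complex_of_real (exp (- c / 2))"
    using var unfolding v_def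
    by (intro tendsto_of_real tendsto_exp tendsto_divide tendsto_minus tendsto_const) simp_all
  ultimately show ?thesis using tendsto_add by fastforce
qed

section \<open>Sums over a row of independent copies\<close>

context prob_space
begin

context
  fixes \<xi> :: "nat \<Rightarrow> 'a \<Rightarrow> 'b::{real_inner,banach,second_countable_topology}" and \<zeta> :: "'a \<Rightarrow> 'b" and n :: nat
  assumes ind: "indep_vars (\<lambda>_. borel) \<xi> {1..n}"
    and id: "\<And>i. i \<in> {1..n} \<Longrightarrow> distr M borel (\<xi> i) = distr M borel \<zeta>"
    and \<zeta>: "\<zeta> \<in> borel_measurable M"
begin

lemma iid_row_measurable: "i \<in> {1..n} \<Longrightarrow> \<xi> i \<in> borel_measurable M"
  using ind by (auto simp: indep_vars_def2)

lemma iid_row_integral: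
  fixes f :: "'b \<Rightarrow> 'd::{banach,second_countable_topology}"
  assumes i: "i \<in> {1..n}" and f: "f \<in> borel_measurable borel"
  shows "(\<integral>w. f (\<xi> i w) \<partial>M) = (\<integral>w. f (\<zeta> w) \<partial>M)"
    "integrable M (\<lambda>w. f (\<xi> i w)) \<longleftrightarrow> integrable M (\<lambda>w. f (\<zeta> w))"
  using integral_distr[OF iid_row_measurable[OF i] f] integral_distr[OF \<zeta> f]
    integrable_distr_eq[OF iid_row_measurable[OF i] f] integrable_distr_eq[OF \<zeta> f]
  by (simp_all only: id[OF i])

lemma iid_row_indep_inner: "indep_vars (\<lambda>_. borel) (\<lambda>i w. inner u (\<xi> i w)) {1..n}"
  by (rule indep_vars_compose2[OF ind]) simp

lemma iid_row_char: "(\<integral>w. cis (inner u (\<Sum>i=1..n. \<xi> i w)) \<partial>M) = (\<integral>w. cis (inner u (\<zeta> w)) \<partial>M) ^ n"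
proof -
  have [measurable]: "\<xi> i \<in> borel_measurable M" if "i \<in> {1..n}" for i
    by (rule iid_row_measurable[OF that])
  have "(\<integral>w. cis (inner u (\<Sum>i=1..n. \<xi> i w)) \<partial>M) = char (distr M borel (\<lambda>w. \<Sum>i=1..n. inner u (\<xi> i w))) 1"
    by (subst char_distr) (auto simp: inner_sum_right intro!: borel_measurable_sum)
  also have "... = (\<Prod>i=1..n. char (distr M borel (\<lambda>w. inner u (\<xi> i w))) 1)"
    by (rule char_distr_sum[OF iid_row_indep_inner])
  also have "... = (\<Prod>i=1..n. \<integral>w. cis (inner u (\<zeta> w)) \<partial>M)"
  proof (rule prod.cong)
    fix i assume i: "i \<in> {1..n}"
    then show "char (distr M borel (\<lambda>w. inner u (\<xi> i w))) 1 = (\<integral>w. cis (inner u (\<zeta> w)) \<partial>M)"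
      using iid_row_integral(1)[OF i, of "\<lambda>w. cis (inner u w)"] by (subst char_distr) simp_all
  qed simp
  finally show ?thesis by simp
qed

context
  assumes \<zeta>2: "integrable M (\<lambda>w. (norm (\<zeta> w))^2)" and mean: "\<And>u. (\<integral>w. inner u (\<zeta> w) \<partial>M) = 0"
begin

lemma iid_row_inner_square:
  "integrable M (\<lambda>w. (inner u (\<Sum>i=1..n. \<xi> i w))^2)"
  "(\<integral>w. (inner u (\<Sum>i=1..n. \<xi> i w))^2 \<partial>M) = real n * (\<integral>w. (inner u (\<zeta> w))^2 \<partial>M)"
proof -
  have i2: "integrable M (\<lambda>w. (inner u (\<xi> i w))^2)" "(\<integral>w. (inner u (\<xi> i w))^2 \<partial>M) = (\<integral>w. (inner u (\<zeta> w))^2 \<partial>M)"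
    if "i \<in> {1..n}" for i
    using iid_row_integral[OF that, of "\<lambda>w. (inner u w)^2"] integrable_inner_square[OF \<zeta> \<zeta>2] by simp_all
  have i0: "(\<integral>w. inner u (\<xi> i w) \<partial>M) = 0" if "i \<in> {1..n}" for i
    using iid_row_integral(1)[OF that, of "inner u"] mean by simp
  note sq = integral_square_sum_indep[OF finite_atLeastAtMost iid_row_indep_inner[of u] i2(1) i0]
  show "integrable M (\<lambda>w. (inner u (\<Sum>i=1..n. \<xi> i w))^2)"
    using sq(1) by (simp add: inner_sum_right)
  show "(\<integral>w. (inner u (\<Sum>i=1..n. \<xi> i w))^2 \<partial>M) = real n * (\<integral>w. (inner u (\<zeta> w))^2 \<partial>M)"
    using sq(2) i2(2) by (simp add: inner_sum_right)
qed

text \<open>Parseval reduces the claim to coordinates, where independence removes the cross terms;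
  nonnegative integrals yield integrability of the sum at the same time.\<close>

lemma iid_row_norm_square:
  "integrable M (\<lambda>w. (norm (\<Sum>i=1..n. \<xi> i w))^2)"
  "(\<integral>w. (norm (\<Sum>i=1..n. \<xi> i w))^2 \<partial>M) = real n * (\<integral>w. (norm (\<zeta> w))^2 \<partial>M)"
proof -
  obtain e :: "nat \<Rightarrow> 'b" where e: "total_family e UNIV" using exists_total_family by blast
  have S: "(\<lambda>w. \<Sum>i=1..n. \<xi> i w) \<in> borel_measurable M"
    using iid_row_measurable by (intro borel_measurable_sum) auto
  have "(\<integral>\<^sup>+w. ennreal ((norm (\<Sum>i=1..n. \<xi> i w))^2) \<partial>M) =
      (\<Sum>j. ennreal (real n * (\<integral>w. (inner (e j) (\<zeta> w))^2 \<partial>M)))"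
    unfolding nn_integral_norm_square_Parseval[OF S e]
    by (subst nn_integral_eq_integral[OF iid_row_inner_square(1)]) (simp_all only: iid_row_inner_square(2) zero_le_power2 AE_I2)
  also have "... = ennreal (real n * (\<integral>w. (norm (\<zeta> w))^2 \<partial>M))"
    by (intro suminf_ennreal_eq sums_mult integral_norm_square_sums[OF \<zeta> \<zeta>2 e]) simp
  finally have "has_bochner_integral M (\<lambda>w. (norm (\<Sum>i=1..n. \<xi> i w))^2) (real n * (\<integral>w. (norm (\<zeta> w))^2 \<partial>M))"
    using S by (intro has_bochner_integral_nn_integral) auto
  then show "integrable M (\<lambda>w. (norm (\<Sum>i=1..n. \<xi> i w))^2)"
    "(\<integral>w. (norm (\<Sum>i=1..n. \<xi> i w))^2 \<partial>M) = real n * (\<integral>w. (norm (\<zeta> w))^2 \<partial>M)"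
    by (simp_all add: has_bochner_integral_iff)
qed

end

end

end

section \<open>The kernel estimator\<close>

text \<open>Inserting \<open>t *\<^sub>R u\<close> into the characteristic functional gives the
  characteristic function of the marginal in direction \<open>u\<close>, to which the
  one-dimensional results apply.\<close>

lemma gaussian_measure_properties:
  fixes N :: "'b::{real_inner,banach,second_countable_topology} measure"
  assumes "prob_space N" and [simp]: "sets N = sets borel" and C: "positive_operator C"
    and char: "\<And>u. (\<integral>w. cis (inner u w) \<partial>N) = complex_of_real (exp (- inner (C u) u / 2))"
    and norm2: "integrable N (\<lambda>w. (norm w)^2)"
  shows "gaussian_element N (\<lambda>w. w)" "has_mean N (\<lambda>w. w) 0"
    "has_covariance N (\<lambda>w. w) (\<lambda>u v. inner (C u) v)"
    "\<And>u. (\<integral>w. (inner u w)^2 \<partial>N) = inner (C u) u"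
proof -
  interpret prob_space N by fact
  have m: "(\<lambda>w. w) \<in> borel_measurable N" by (simp add: measurable_cong_sets[of N borel])
  have lin: "linear C" and sym: "\<And>u v. inner (C u) v = inner u (C v)" and nn: "\<And>u. 0 \<le> inner (C u) u"
    using C by (auto simp: positive_operator_def)
  have inner_m: "(\<lambda>w. inner u w) \<in> borel_measurable N" for u
    by (intro borel_measurable_inner m) simp
  have "(\<integral>w. cis (t * inner u w) \<partial>N) =
      complex_of_real (exp (- (t^2 * (sqrt (inner (C u) u))^2) / 2))" for t u
    using char[of "t *\<^sub>R u"] by (simp add: linear_scale[OF lin] power2_eq_square nn)
  note mom = moments_of_gaussian_char[OF prob_space_axioms inner_m _ this]
  have sq: "integrable N (\<lambda>w. (inner u w)^2)" "(\<integral>w. (inner u w)^2 \<partial>N) = inner (C u) u" for u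
    using mom(4,5)[of u] by (simp_all add: nn)
  then show "\<And>u. (\<integral>w. (inner u w)^2 \<partial>N) = inner (C u) u" by simp
  show "gaussian_element N (\<lambda>w. w)"
    using mom(1) m by (simp add: gaussian_element_def prob_space_axioms nn)
  have int: "integrable N (\<lambda>w. w)"
  proof (rule Bochner_Integration.integrable_bound[OF _ m])
    show "integrable N (\<lambda>w. 1 + (norm w)^2)" using norm2 by simp
    have "norm w \<le> 1 + (norm w)^2" for w :: 'b
    proof -
      have "0 \<le> (norm w - 1)^2 + norm w" by simp
      then show ?thesis by (simp add: power2_eq_square algebra_simps)
    qed
    then show "AE w in N. norm w \<le> norm (1 + (norm w)^2)"
      by (intro AE_I2) (metis abs_ge_self order_trans real_norm_def)
  qed
  have "inner u (\<integral>w. w \<partial>N) = 0" for u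
    using mom(3)[of u] int by (simp add: nn)
  then have mean: "(\<integral>w. w \<partial>N) = 0" by (metis inner_eq_zero_iff)
  with int show "has_mean N (\<lambda>w. w) 0" by (simp add: has_mean_def)
  have "has_bochner_integral N (\<lambda>w. inner u w * inner v w) (inner (C u) v)" for u v
  proof -
    \<comment> \<open>Polarisation, since only variances are known so far.\<close>
    have "has_bochner_integral N (\<lambda>w. ((inner (u + v) w)^2 - (inner (u - v) w)^2) / 4)
        ((inner (C (u + v)) (u + v) - inner (C (u - v)) (u - v)) / 4)"
      by (intro has_bochner_integral_divide_zero has_bochner_integral_diff)
        (simp_all add: has_bochner_integral_iff sq)
    moreover have "inner (C v) u = inner (C u) v" using sym[of v u] by (simp add: inner_commute)
    ultimately show ?thesis
      by (simp add: linear_add[OF lin] linear_diff[OF lin] inner_add_left inner_diff_left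
          inner_add_right inner_diff_right power2_eq_square algebra_simps)
  qed
  then show "has_covariance N (\<lambda>w. w) (\<lambda>u v. inner (C u) v)"
    by (simp add: has_covariance_def mean)
qed

section \<open>The setting and the kernel weights\<close>

text \<open>The neighbourhood of \<open>x\<close> is a ball of radius \<open>\<delta>\<close>, and
  \<open>c\<close> is nonnegative. A moment bound on the nonnegative integral asserts finiteness as
  well.\<close>

locale kernel_estimator = prob_space M
  for M :: "'a measure" +
  fixes R :: "'r measure"
    and X :: "'a \<Rightarrow> 'c::polish_space" and Y :: "'a \<Rightarrow> 'r"
    and Xs :: "nat \<Rightarrow> 'a \<Rightarrow> 'c" and Ys :: "nat \<Rightarrow> 'a \<Rightarrow> 'r"
    and \<kappa> :: "'c \<Rightarrow> 'r measure" and x :: 'c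
    and K :: "real \<Rightarrow> real" and h :: "nat \<Rightarrow> real"
    and G :: "'r \<Rightarrow> 'g::{banach,second_countable_topology}"
    and L :: "'g \<Rightarrow> 'b::{real_inner,banach,second_countable_topology}"
    and l u \<nu> \<delta> c :: real
  assumes X [measurable]: "X \<in> M \<rightarrow>\<^sub>M borel" and Y [measurable]: "Y \<in> M \<rightarrow>\<^sub>M R"
    and iid: "iid_copies M (borel \<Otimes>\<^sub>M R) (\<lambda>w. (X w, Y w)) (\<lambda>i w. (Xs i w, Ys i w))"
    and rcd: "regular_conditional_distribution M borel X R Y \<kappa>"
    and G [measurable]: "G \<in> R \<rightarrow>\<^sub>M borel" and L: "bounded_linear L"
    and Km: "K \<in> borel_measurable (restrict_space borel {0..})" and K0: "\<And>t. 0 \<le> t \<Longrightarrow> 0 \<le> K t"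
    and l: "0 < l"
    and Kl: "\<And>t. 0 \<le> t \<Longrightarrow> t \<le> 1 \<Longrightarrow> l \<le> K t"
    and Ku: "\<And>t. 0 \<le> t \<Longrightarrow> t \<le> 1 \<Longrightarrow> K t \<le> u"
    and K1: "\<And>t. 1 < t \<Longrightarrow> K t = 0"
    and h: "\<And>n. 1 \<le> n \<Longrightarrow> 0 < h n" and h0: "h \<longlonglongrightarrow> 0"
    and n\<phi>: "filterlim (\<lambda>n. real n * small_ball M X x (h n)) at_top sequentially"
    and \<nu>: "2 < \<nu>" and \<delta>: "0 < \<delta>" and c: "0 \<le> c"
    and int_G: "\<And>z. dist x z < \<delta> \<Longrightarrow> integrable (\<kappa> z) G"
    and moment: "\<And>z. dist x z < \<delta> \<Longrightarrow>
      (\<integral>\<^sup>+y. ennreal (norm (G y - cond_mean \<kappa> G z) powr \<nu>) \<partial>\<kappa> z) \<le> ennreal c"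
    and trace: "tendsto_trace_norm (cond_cov \<kappa> G L) (cond_cov \<kappa> G L x) (at x)"
begin

abbreviation resid :: "'c \<Rightarrow> 'r \<Rightarrow> 'b" where
  "resid z y \<equiv> L (G y - cond_mean \<kappa> G z)"

abbreviation weight :: "nat \<Rightarrow> 'c \<Rightarrow> real" where
  "weight n z \<equiv> K (dist x z / h n)"

abbreviation \<phi> :: "nat \<Rightarrow> real" where
  "\<phi> n \<equiv> small_ball M X x (h n)"

text \<open>\<open>q1\<close> and \<open>q2\<close> are the numerators of \<open>E_stat\<close>; the
  small ball probabilities in the normalisation cancel, so the argument runs with these.\<close>

definition q1 :: "nat \<Rightarrow> real" where "q1 n = (\<integral>w. weight n (X w) \<partial>M)"
definition q2 :: "nat \<Rightarrow> real" where "q2 n = (\<integral>w. (weight n (X w))^2 \<partial>M)"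

lemma \<kappa>_prob: "\<kappa> \<in> borel \<rightarrow>\<^sub>M prob_algebra R"
  using rcd by (simp add: regular_conditional_distribution_def)

lemma prob_space_\<kappa>: "prob_space (\<kappa> z)"
  using measurable_space[OF \<kappa>_prob, of z] by (simp add: space_prob_algebra)

lemma sets_\<kappa> [simp, measurable_cong]: "sets (\<kappa> z) = sets R"
  using measurable_space[OF \<kappa>_prob, of z] by (simp add: space_prob_algebra)

lemma cond_mean_borel [measurable]: "cond_mean \<kappa> G \<in> borel_measurable borel"
  by (rule cond_mean_measurable[OF \<kappa>_prob G])

lemma L_borel [measurable]: "L \<in> borel_measurable borel"
  by (intro borel_measurable_continuous_onI linear_continuous_on L)

lemma resid_pair [measurable]: "(\<lambda>(z, y). resid z y) \<in> borel_measurable (borel \<Otimes>\<^sub>M R)"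
  by measurable

lemma resid_borel [measurable]: "resid z \<in> borel_measurable R"
  by measurable

text \<open>\<open>K\<close> is measurable on the half-line only, where \<open>h n > 0\<close> keeps
  its argument. Nothing is known about \<open>h 0\<close>, hence the condition
  \<open>1 \<le> n\<close> from here on.\<close>

lemma weight_borel: "1 \<le> n \<Longrightarrow> weight n \<in> borel_measurable borel"
proof -
  assume "1 \<le> n"
  have "(\<lambda>z. dist x z / h n) \<in> borel \<rightarrow>\<^sub>M restrict_space borel {0..}"
    using h[OF \<open>1 \<le> n\<close>] by (intro measurable_restrict_space2) auto
  from measurable_compose[OF this Km] show ?thesis .
qed

lemma u_ge_l: "l \<le> u" using Kl[of 0] Ku[of 0] by simp

lemma weight_nonneg: "1 \<le> n \<Longrightarrow> 0 \<le> weight n z"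
  using h[of n] by (intro K0) simp

lemma weight_outside: "1 \<le> n \<Longrightarrow> h n < dist x z \<Longrightarrow> weight n z = 0"
  using h[of n] by (intro K1) (simp add: pos_less_divide_eq)

lemma weight_inside: "1 \<le> n \<Longrightarrow> dist x z \<le> h n \<Longrightarrow> l \<le> weight n z \<and> weight n z \<le> u"
  using h[of n] by (intro conjI Kl Ku) (auto simp: pos_divide_le_eq)

lemma weight_le: "1 \<le> n \<Longrightarrow> weight n z \<le> u"
  using weight_inside[of n z] weight_outside[of n z] u_ge_l l by (cases "dist x z \<le> h n") auto

lemma small_ball_integral: "(\<integral>w. indicator {z. dist x z \<le> r} (X w) \<partial>M) = small_ball M X x r"
proof -
  have "(\<integral>w. indicator {z. dist x z \<le> r} (X w) \<partial>M) =
      (\<integral>w. indicator {w\<in>space M. dist x (X w) \<le> r} w \<partial>M)"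
    by (intro Bochner_Integration.integral_cong) (auto simp: indicator_def)
  also have "... = small_ball M X x r"
    by (simp add: small_ball_def)
  finally show ?thesis .
qed

lemma integrable_weight_powr:
  assumes "1 \<le> n" "0 < p"
  shows "integrable M (\<lambda>w. weight n (X w) powr p)"
    "(\<integral>w. weight n (X w) powr p \<partial>M) \<le> u powr p * \<phi> n"
    "l powr p * \<phi> n \<le> (\<integral>w. weight n (X w) powr p \<partial>M)"
proof -
  note [measurable] = weight_borel[OF assms(1)]
  let ?I = "\<lambda>w. indicator {z. dist x z \<le> h n} (X w) :: real"
  have I: "integrable M ?I"
    by (rule integrable_const_bound[where B=1]) (auto simp: indicator_def)
  show int: "integrable M (\<lambda>w. weight n (X w) powr p)"
    using weight_nonneg[OF assms(1)] weight_le[OF assms(1)] assms(2)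
    by (intro integrable_const_bound[where B="u powr p"]) (auto intro!: powr_mono2)
  have "(\<integral>w. weight n (X w) powr p \<partial>M) \<le> (\<integral>w. u powr p * ?I w \<partial>M)"
    using weight_nonneg[OF assms(1)] weight_le[OF assms(1)] weight_outside[OF assms(1)] assms(2)
    by (intro integral_mono int integrable_mult_right I) (auto simp: indicator_def intro!: powr_mono2)
  then show "(\<integral>w. weight n (X w) powr p \<partial>M) \<le> u powr p * \<phi> n" by (simp add: small_ball_integral)
  have "(\<integral>w. l powr p * ?I w \<partial>M) \<le> (\<integral>w. weight n (X w) powr p \<partial>M)"
    using weight_inside[OF assms(1)] l assms(2)
    by (intro integral_mono int integrable_mult_right I) (auto simp: indicator_def intro!: powr_mono2)
  then show "l powr p * \<phi> n \<le> (\<integral>w. weight n (X w) powr p \<partial>M)" by (simp add: small_ball_integral)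
qed

lemma integrable_weight:
  assumes "1 \<le> n"
  shows "integrable M (\<lambda>w. weight n (X w))" "integrable M (\<lambda>w. (weight n (X w))^2)"
    "l * \<phi> n \<le> q1 n" "q2 n \<le> u^2 * \<phi> n" "l^2 * \<phi> n \<le> q2 n"
proof -
  have eq: "t powr 2 = t^2" "t powr 1 = t" if "0 \<le> t" for t :: real
    using that by (auto simp: powr_numeral)
  note w = eq[OF weight_nonneg[OF assms]]
  show "integrable M (\<lambda>w. weight n (X w))" "integrable M (\<lambda>w. (weight n (X w))^2)"
    "l * \<phi> n \<le> q1 n" "q2 n \<le> u^2 * \<phi> n" "l^2 * \<phi> n \<le> q2 n"
    using integrable_weight_powr[OF assms, of 1] integrable_weight_powr[OF assms, of 2] l u_ge_l
    by (simp_all add: q1_def q2_def w eq abs_of_nonneg[OF weight_nonneg[OF assms]])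
qed

lemma eventually_n\<phi>: "eventually (\<lambda>n. 1 \<le> n \<and> h n < \<delta> \<and> 0 < \<phi> n) sequentially"
proof -
  have "eventually (\<lambda>n. 0 < real n * \<phi> n) sequentially"
    using n\<phi> by (auto simp: filterlim_at_top_dense)
  moreover have "eventually (\<lambda>n. h n < \<delta>) sequentially"
    using h0 \<delta> by (rule order_tendstoD)
  ultimately show ?thesis using eventually_ge_at_top[of 1]
    by eventually_elim (auto simp: zero_less_mult_iff)
qed

section \<open>Local averages of conditional expectations\<close>

text \<open>Conditioning on \<open>X\<close> replaces \<open>g\<close> by its conditional integral,
  and since \<open>W\<close> vanishes off the ball of radius \<open>h n\<close>, bounds on that ball
  suffice.\<close>

lemma weighted_average:
  assumes W [measurable]: "W \<in> borel_measurable borel" "\<And>z. 0 \<le> W z" "\<And>z. h n < dist x z \<Longrightarrow> W z = 0"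
    and WX: "integrable M (\<lambda>w. W (X w))"
    and g [measurable]: "(\<lambda>(z, y). g z y) \<in> borel_measurable (borel \<Otimes>\<^sub>M R)"
  shows "(\<And>z. dist x z \<le> h n \<Longrightarrow> (\<integral>\<^sup>+y. ennreal (g z y) \<partial>\<kappa> z) \<le> ennreal b) \<Longrightarrow> 0 \<le> b \<Longrightarrow>
      (\<integral>\<^sup>+w. ennreal (W (X w)) * ennreal (g (X w) (Y w)) \<partial>M) \<le> ennreal (b * (\<integral>w. W (X w) \<partial>M))"
    "(\<And>z. dist x z \<le> h n \<Longrightarrow> ennreal a \<le> (\<integral>\<^sup>+y. ennreal (g z y) \<partial>\<kappa> z)) \<Longrightarrow> 0 \<le> a \<Longrightarrow>
      ennreal (a * (\<integral>w. W (X w) \<partial>M)) \<le> (\<integral>\<^sup>+w. ennreal (W (X w)) * ennreal (g (X w) (Y w)) \<partial>M)"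
proof -
  have g1: "g z \<in> borel_measurable R" for z using measurable_Pair2[OF g, of z] by simp
  have "(\<integral>\<^sup>+w. (\<lambda>(z, y). ennreal (W z) * ennreal (g z y)) (X w, Y w) \<partial>M) =
      (\<integral>\<^sup>+w. (\<integral>\<^sup>+y. (\<lambda>(z, y). ennreal (W z) * ennreal (g z y)) (X w, y) \<partial>\<kappa> (X w)) \<partial>M)"
    by (rule joint_law_disintegration[OF prob_space_axioms X Y rcd]) measurable
  then have eq: "(\<integral>\<^sup>+w. ennreal (W (X w)) * ennreal (g (X w) (Y w)) \<partial>M) =
      (\<integral>\<^sup>+w. ennreal (W (X w)) * (\<integral>\<^sup>+y. ennreal (g (X w) y) \<partial>\<kappa> (X w)) \<partial>M)"
    using g1 by (simp add: nn_integral_cmult)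
  have const: "(\<integral>\<^sup>+w. ennreal (W (X w)) * ennreal t \<partial>M) = ennreal (t * (\<integral>w. W (X w) \<partial>M))" if "0 \<le> t" for t
    using WX W(2) that
    by (simp add: nn_integral_multc nn_integral_eq_integral ennreal_mult[symmetric] mult.commute)
  show "(\<integral>\<^sup>+w. ennreal (W (X w)) * ennreal (g (X w) (Y w)) \<partial>M) \<le> ennreal (b * (\<integral>w. W (X w) \<partial>M))"
    if "\<And>z. dist x z \<le> h n \<Longrightarrow> (\<integral>\<^sup>+y. ennreal (g z y) \<partial>\<kappa> z) \<le> ennreal b" "0 \<le> b"
    unfolding eq const[OF that(2), symmetric]
  proof (rule nn_integral_mono)
    show "ennreal (W (X w)) * (\<integral>\<^sup>+y. ennreal (g (X w) y) \<partial>\<kappa> (X w)) \<le> ennreal (W (X w)) * ennreal b" for w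
      using that(1)[of "X w"] W(3)[of "X w"] by (cases "dist x (X w) \<le> h n") (auto intro: mult_left_mono)
  qed
  show "ennreal (a * (\<integral>w. W (X w) \<partial>M)) \<le> (\<integral>\<^sup>+w. ennreal (W (X w)) * ennreal (g (X w) (Y w)) \<partial>M)"
    if "\<And>z. dist x z \<le> h n \<Longrightarrow> ennreal a \<le> (\<integral>\<^sup>+y. ennreal (g z y) \<partial>\<kappa> z)" "0 \<le> a"
    unfolding eq const[OF that(2), symmetric]
  proof (rule nn_integral_mono)
    show "ennreal (W (X w)) * ennreal a \<le> ennreal (W (X w)) * (\<integral>\<^sup>+y. ennreal (g (X w) y) \<partial>\<kappa> (X w))" for w
      using that(1)[of "X w"] W(3)[of "X w"] by (cases "dist x (X w) \<le> h n") (auto intro: mult_left_mono)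
  qed
qed

lemma integrable_weighted:
  assumes n: "1 \<le> n" and g [measurable]: "(\<lambda>(z, y). g z y) \<in> borel_measurable (borel \<Otimes>\<^sub>M R)"
    and g0: "\<And>z y. 0 \<le> g z y"
    and b: "\<And>z. dist x z \<le> h n \<Longrightarrow> (\<integral>\<^sup>+y. ennreal (g z y) \<partial>\<kappa> z) \<le> ennreal b" "0 \<le> b" and p: "0 < p"
  shows "integrable M (\<lambda>w. weight n (X w) powr p * g (X w) (Y w))"
    "(\<integral>w. weight n (X w) powr p * g (X w) (Y w) \<partial>M) \<le> b * (\<integral>w. weight n (X w) powr p \<partial>M)"
proof -
  note [measurable] = weight_borel[OF n]
  let ?f = "\<lambda>w. weight n (X w) powr p * g (X w) (Y w)"
  have fm: "?f \<in> borel_measurable M" by measurable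
  have "(\<integral>\<^sup>+w. ennreal (weight n (X w) powr p) * ennreal (g (X w) (Y w)) \<partial>M) \<le>
      ennreal (b * (\<integral>w. weight n (X w) powr p \<partial>M))"
    by (rule weighted_average(1)[OF _ _ _ integrable_weight_powr(1)[OF n p] g b])
      (use weight_outside[OF n] in auto)
  then have le: "(\<integral>\<^sup>+w. ennreal (?f w) \<partial>M) \<le> ennreal (b * (\<integral>w. weight n (X w) powr p \<partial>M))"
    by (simp add: ennreal_mult' g0)
  show int: "integrable M ?f"
  proof (rule integrableI_bounded[OF fm])
    have "(\<integral>\<^sup>+w. ennreal (norm (?f w)) \<partial>M) = (\<integral>\<^sup>+w. ennreal (?f w) \<partial>M)" by (simp add: g0 abs_mult)
    also have "... < \<infinity>" using le by (rule le_less_trans) simp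
    finally show "(\<integral>\<^sup>+w. ennreal (norm (?f w)) \<partial>M) < \<infinity>" .
  qed
  have "ennreal (\<integral>w. ?f w \<partial>M) \<le> ennreal (b * (\<integral>w. weight n (X w) powr p \<partial>M))"
    using le by (subst (asm) nn_integral_eq_integral[OF int]) (simp_all add: g0)
  then show "(\<integral>w. ?f w \<partial>M) \<le> b * (\<integral>w. weight n (X w) powr p \<partial>M)"
    using b(2) by (subst (asm) ennreal_le_iff) (auto intro!: mult_nonneg_nonneg Bochner_Integration.integral_nonneg)
qed

text \<open>The ball that carries the weights shrinks to \<open>x\<close>, so the average is
  squeezed between \<open>I x - \<epsilon>\<close> and \<open>I x + \<epsilon>\<close>, where
  \<open>I z\<close> is the conditional integral of \<open>g z\<close>.\<close>

lemma weighted_average_tendsto: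
  assumes g [measurable]: "(\<lambda>(z, y). g z y) \<in> borel_measurable (borel \<Otimes>\<^sub>M R)"
    and g0: "\<And>z y. 0 \<le> g z y"
    and int: "\<And>z. dist x z < \<delta> \<Longrightarrow> integrable (\<kappa> z) (g z)"
    and lim: "((\<lambda>z. \<integral>y. g z y \<partial>\<kappa> z) \<longlongrightarrow> (\<integral>y. g x y \<partial>\<kappa> x)) (at x)"
  shows "(\<lambda>n. (\<integral>w. (weight n (X w))^2 * g (X w) (Y w) \<partial>M) / q2 n) \<longlonglongrightarrow> (\<integral>y. g x y \<partial>\<kappa> x)"
proof (rule tendstoI)
  fix \<epsilon>' :: real assume "0 < \<epsilon>'"
  define \<epsilon> where "\<epsilon> = \<epsilon>' / 2"
  have "0 < \<epsilon>" using \<open>0 < \<epsilon>'\<close> by (simp add: \<epsilon>_def)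
  define I where "I z = (\<integral>y. g z y \<partial>\<kappa> z)" for z
  have I0: "0 \<le> I z" for z unfolding I_def by (rule Bochner_Integration.integral_nonneg) (rule g0)
  have "eventually (\<lambda>z. dist (I z) (I x) < \<epsilon>) (at x)" using lim \<open>0 < \<epsilon>\<close> unfolding I_def by (rule tendstoD)
  then obtain d where d: "0 < d" "\<And>z. z \<noteq> x \<Longrightarrow> dist z x < d \<Longrightarrow> dist (I z) (I x) < \<epsilon>"
    unfolding eventually_at by auto
  \<comment> \<open>The filter \<open>at x\<close> says nothing about \<open>z = x\<close> itself;
    there the difference is 0.\<close>
  have close: "\<bar>I z - I x\<bar> \<le> \<epsilon>" if "dist x z < d" for z
    using d(2)[of z] that \<open>0 < \<epsilon>\<close> by (cases "z = x") (auto simp: dist_real_def dist_commute)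
  have "eventually (\<lambda>n. h n < d) sequentially" using h0 d(1) by (rule order_tendstoD)
  with eventually_n\<phi> show "eventually (\<lambda>n. dist ((\<integral>w. (weight n (X w))^2 * g (X w) (Y w) \<partial>M) / q2 n) (\<integral>y. g x y \<partial>\<kappa> x) < \<epsilon>') sequentially"
  proof eventually_elim
    case (elim n)
    then have n: "1 \<le> n" by simp
    have sq: "weight n z powr 2 = (weight n z)^2" for z
      using weight_nonneg[OF n, of z] by (cases "weight n z = 0") auto
    have nn: "(\<integral>\<^sup>+y. ennreal (g z y) \<partial>\<kappa> z) = ennreal (I z)" if "dist x z \<le> h n" for z
      unfolding I_def using that elim g0 by (intro nn_integral_eq_integral int) auto
    have up: "(\<integral>\<^sup>+y. ennreal (g z y) \<partial>\<kappa> z) \<le> ennreal (I x + \<epsilon>)" if "dist x z \<le> h n" for z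
      unfolding nn[OF that] using close[of z] that elim by (intro ennreal_leI) auto
    \<comment> \<open>The truncation at 0 keeps the bound within the range where
      \<open>ennreal\<close> is faithful; it costs nothing because \<open>I z\<close> is
      nonnegative.\<close>
    have lo: "ennreal (max 0 (I x - \<epsilon>)) \<le> (\<integral>\<^sup>+y. ennreal (g z y) \<partial>\<kappa> z)" if "dist x z \<le> h n" for z
      unfolding nn[OF that] using close[of z] that elim I0[of z] by (intro ennreal_leI) auto
    note int2 = integrable_weighted[OF n g g0 up, of 2, simplified sq q2_def[symmetric]]
    let ?A = "\<integral>w. (weight n (X w))^2 * g (X w) (Y w) \<partial>M"
    have A1: "?A \<le> (I x + \<epsilon>) * q2 n" using int2(2) I0[of x] \<open>0 < \<epsilon>\<close> by simp
    have intA: "integrable M (\<lambda>w. (weight n (X w))^2 * g (X w) (Y w))"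
      using int2(1) I0[of x] \<open>0 < \<epsilon>\<close> by simp
    have "ennreal (max 0 (I x - \<epsilon>) * (\<integral>w. (weight n (X w))^2 \<partial>M)) \<le>
        (\<integral>\<^sup>+w. ennreal ((weight n (X w))^2) * ennreal (g (X w) (Y w)) \<partial>M)"
      by (rule weighted_average(2)[OF _ _ _ integrable_weight(2)[OF n] g lo])
        (use weight_outside[OF n] weight_borel[OF n] in auto)
    also have "... = (\<integral>\<^sup>+w. ennreal ((weight n (X w))^2 * g (X w) (Y w)) \<partial>M)"
      by (simp add: ennreal_mult' g0)
    also have "... = ennreal ?A" by (rule nn_integral_eq_integral[OF intA]) (simp add: g0)
    finally have "max 0 (I x - \<epsilon>) * q2 n \<le> ?A"
      by (subst (asm) ennreal_le_iff) (auto simp: q2_def g0 intro!: Bochner_Integration.integral_nonneg)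
    moreover have "0 < q2 n" using integrable_weight(5)[OF n] elim l by (smt (verit) mult_pos_pos zero_less_power)
    ultimately have "max 0 (I x - \<epsilon>) \<le> ?A / q2 n" "?A / q2 n \<le> I x + \<epsilon>"
      using A1 by (simp_all only: pos_le_divide_eq pos_divide_le_eq)
    then show ?case using \<open>0 < \<epsilon>'\<close> unfolding I_def[symmetric] \<epsilon>_def dist_real_def by linarith
  qed
qed

text \<open>The Taylor estimate for characteristic functions uses moments of order at most 3.\<close>

definition p :: real where "p = min \<nu> 3"

lemma p: "2 < p" "p \<le> 3" "p \<le> \<nu>"
  using \<nu> by (auto simp: p_def)

definition L_bound :: real where
  "L_bound = (SOME B. 0 < B \<and> (\<forall>v. norm (L v) \<le> norm v * B))"

lemma L_bound: "0 < L_bound" "norm (L v) \<le> norm v * L_bound"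
  using someI_ex[OF bounded_linear.pos_bounded[OF L]] unfolding L_bound_def by auto

lemma resid_moment:
  assumes z: "dist x z < \<delta>" and q: "0 \<le> q" "q \<le> \<nu>"
  shows "integrable (\<kappa> z) (\<lambda>y. norm (resid z y) powr q)"
    "(\<integral>\<^sup>+y. ennreal (norm (resid z y) powr q) \<partial>\<kappa> z) \<le> ennreal (L_bound powr q * (1 + c))"
proof -
  interpret \<kappa>: prob_space "\<kappa> z" by (rule prob_space_\<kappa>)
  have m: "(\<lambda>y. G y - cond_mean \<kappa> G z) \<in> borel_measurable (\<kappa> z)" by measurable
  note mom = \<kappa>.powr_moment_bounds[OF m q moment[OF z] c]
  have le: "norm (resid z y) powr q \<le> L_bound powr q * norm (G y - cond_mean \<kappa> G z) powr q" for y
    using L_bound(2)[of "G y - cond_mean \<kappa> G z"] L_bound(1) q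
    by (subst powr_mult[symmetric]) (auto intro!: powr_mono2 simp: mult.commute)
  show "integrable (\<kappa> z) (\<lambda>y. norm (resid z y) powr q)"
  proof (rule Bochner_Integration.integrable_bound)
    show "integrable (\<kappa> z) (\<lambda>y. L_bound powr q * norm (G y - cond_mean \<kappa> G z) powr q)"
      by (intro integrable_mult_right mom)
    show "AE y in \<kappa> z. norm (norm (resid z y) powr q) \<le> norm (L_bound powr q * norm (G y - cond_mean \<kappa> G z) powr q)"
      using le by simp
  qed measurable
  have "(\<integral>\<^sup>+y. ennreal (norm (resid z y) powr q) \<partial>\<kappa> z) \<le>
      (\<integral>\<^sup>+y. ennreal (L_bound powr q) * ennreal (norm (G y - cond_mean \<kappa> G z) powr q) \<partial>\<kappa> z)"
    using le by (intro nn_integral_mono) (simp add: ennreal_mult[symmetric])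
  also have "... = ennreal (L_bound powr q) * (\<integral>\<^sup>+y. ennreal (norm (G y - cond_mean \<kappa> G z) powr q) \<partial>\<kappa> z)"
    by (intro nn_integral_cmult) measurable
  also have "... \<le> ennreal (L_bound powr q) * ennreal (1 + c)" by (intro mult_left_mono mom) simp
  finally show "(\<integral>\<^sup>+y. ennreal (norm (resid z y) powr q) \<partial>\<kappa> z) \<le> ennreal (L_bound powr q * (1 + c))"
    using c by (simp add: ennreal_mult)
qed

lemma resid_square_integrable:
  assumes "dist x z < \<delta>" shows "integrable (\<kappa> z) (\<lambda>y. (norm (resid z y))^2)"
proof -
  have "norm v powr 2 = (norm v)^2" for v :: 'b by (cases "v = 0") auto
  then show ?thesis using resid_moment(1)[OF assms, of 2] \<nu> by simp
qed

lemma resid_inner_mean: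
  assumes z: "dist x z < \<delta>"
  shows "integrable (\<kappa> z) (\<lambda>y. inner v (resid z y))" "(\<integral>y. inner v (resid z y) \<partial>\<kappa> z) = 0"
proof -
  interpret \<kappa>: prob_space "\<kappa> z" by (rule prob_space_\<kappa>)
  have bl: "bounded_linear (\<lambda>w. inner v (L w))"
    by (rule bounded_linear_compose[OF bounded_linear_inner_right L])
  have i: "integrable (\<kappa> z) (\<lambda>y. G y - cond_mean \<kappa> G z)"
    using int_G[OF z] by simp
  show "integrable (\<kappa> z) (\<lambda>y. inner v (resid z y))"
    by (rule integrable_bounded_linear[OF bl i])
  have "(\<integral>y. inner v (resid z y) \<partial>\<kappa> z) = inner v (L (\<integral>y. G y - cond_mean \<kappa> G z \<partial>\<kappa> z))"
    by (rule integral_bounded_linear[OF bl i])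
  also have "(\<integral>y. G y - cond_mean \<kappa> G z \<partial>\<kappa> z) = 0"
    using int_G[OF z] by (simp add: cond_mean_def \<kappa>.prob_space)
  finally show "(\<integral>y. inner v (resid z y) \<partial>\<kappa> z) = 0"
    using linear_0[OF bounded_linear.linear[OF L]] by simp
qed

lemma cond_cov_commute: "cond_cov \<kappa> G L z v w = cond_cov \<kappa> G L z w v"
  by (simp add: cond_cov_def mult.commute)

lemma cond_cov_square: "cond_cov \<kappa> G L z v v = (\<integral>y. (inner v (resid z y))^2 \<partial>\<kappa> z)"
  by (simp add: cond_cov_def power2_eq_square)

lemma eventually_at_\<delta>: "eventually (\<lambda>z. dist x z < \<delta>) (at x)"
  unfolding eventually_at using \<delta> by (auto simp: dist_commute)

lemma inner_square_tendsto:
  "((\<lambda>z. \<integral>y. (inner v (resid z y))^2 \<partial>\<kappa> z) \<longlongrightarrow> (\<integral>y. (inner v (resid x y))^2 \<partial>\<kappa> x)) (at x)"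
proof (rule tendstoI)
  fix \<epsilon> :: real assume "0 < \<epsilon>"
  define \<epsilon>' where "\<epsilon>' = \<epsilon> / ((norm v)^2 + 1)"
  have pos: "0 < (norm v)^2 + 1" by (simp add: add_nonneg_pos)
  then have "0 < \<epsilon>'" using \<open>0 < \<epsilon>\<close> by (simp add: \<epsilon>'_def)
  with trace have "eventually (\<lambda>z. \<exists>t<\<epsilon>'. has_trace_norm
      (\<lambda>u v. cond_cov \<kappa> G L z u v - cond_cov \<kappa> G L x u v) t) (at x)"
    unfolding tendsto_trace_norm_def by blast
  then show "eventually (\<lambda>z. dist (\<integral>y. (inner v (resid z y))^2 \<partial>\<kappa> z) (\<integral>y. (inner v (resid x y))^2 \<partial>\<kappa> x) < \<epsilon>) (at x)"
  proof eventually_elim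
    case (elim z)
    then obtain t where t: "t < \<epsilon>'" "has_trace_norm (\<lambda>u v. cond_cov \<kappa> G L z u v - cond_cov \<kappa> G L x u v) t"
      by blast
    have "\<bar>cond_cov \<kappa> G L z v v - cond_cov \<kappa> G L x v v\<bar> \<le> t * (norm v)^2"
      by (rule trace_norm_bound_quadratic[OF t(2)]) (simp only: cond_cov_commute)
    also have "... \<le> \<epsilon>' * (norm v)^2" using t(1) by (intro mult_right_mono) auto
    also have "... < \<epsilon>' * ((norm v)^2 + 1)" using \<open>0 < \<epsilon>'\<close> by simp
    also have "... = \<epsilon>" using pos by (simp add: \<epsilon>'_def)
    finally show ?case by (simp add: cond_cov_square dist_real_def)
  qed
qed

text \<open>The squared norm sums infinitely many directional variances, so convergence in each
  direction is not enough. The trace norm bounds all partial sums of the differences, uniformly in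
  the number of directions.\<close>

lemma norm_square_tendsto:
  "((\<lambda>z. \<integral>y. (norm (resid z y))^2 \<partial>\<kappa> z) \<longlongrightarrow> (\<integral>y. (norm (resid x y))^2 \<partial>\<kappa> x)) (at x)"
proof (rule tendstoI)
  obtain e :: "nat \<Rightarrow> 'b" where e: "total_family e UNIV" using exists_total_family by blast
  have o: "ortho_family e {..<k}" for k
    using e ortho_family_subset total_family_ortho by (metis subset_UNIV)
  have sums: "(\<lambda>j. cond_cov \<kappa> G L z (e j) (e j)) sums (\<integral>y. (norm (resid z y))^2 \<partial>\<kappa> z)"
    if "dist x z < \<delta>" for z
    unfolding cond_cov_square
    by (intro integral_norm_square_sums resid_square_integrable that e) measurable
  fix \<epsilon> :: real assume "0 < \<epsilon>"
  with trace have "eventually (\<lambda>z. \<exists>t<\<epsilon>. has_trace_norm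
      (\<lambda>u v. cond_cov \<kappa> G L z u v - cond_cov \<kappa> G L x u v) t) (at x)"
    unfolding tendsto_trace_norm_def by blast
  with eventually_at_\<delta>
  show "eventually (\<lambda>z. dist (\<integral>y. (norm (resid z y))^2 \<partial>\<kappa> z) (\<integral>y. (norm (resid x y))^2 \<partial>\<kappa> x) < \<epsilon>) (at x)"
  proof eventually_elim
    case (elim z)
    then obtain t where t: "t < \<epsilon>" "has_trace_norm (\<lambda>u v. cond_cov \<kappa> G L z u v - cond_cov \<kappa> G L x u v) t"
      by blast
    have "(\<lambda>j. cond_cov \<kappa> G L z (e j) (e j) - cond_cov \<kappa> G L x (e j) (e j)) sums
        ((\<integral>y. (norm (resid z y))^2 \<partial>\<kappa> z) - (\<integral>y. (norm (resid x y))^2 \<partial>\<kappa> x))"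
      using elim \<delta> by (intro sums_diff sums) auto
    then have "(\<lambda>k. \<bar>\<Sum>j<k. cond_cov \<kappa> G L z (e j) (e j) - cond_cov \<kappa> G L x (e j) (e j)\<bar>) \<longlonglongrightarrow>
        \<bar>(\<integral>y. (norm (resid z y))^2 \<partial>\<kappa> z) - (\<integral>y. (norm (resid x y))^2 \<partial>\<kappa> x)\<bar>"
      unfolding sums_def by (rule tendsto_rabs)
    then have "\<bar>(\<integral>y. (norm (resid z y))^2 \<partial>\<kappa> z) - (\<integral>y. (norm (resid x y))^2 \<partial>\<kappa> x)\<bar> \<le> t"
    proof (rule LIMSEQ_le_const2, intro exI allI impI)
      show "\<bar>\<Sum>j<k. cond_cov \<kappa> G L z (e j) (e j) - cond_cov \<kappa> G L x (e j) (e j)\<bar> \<le> t" for k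
        by (rule trace_norm_bound[OF t(2) _ _ o]) (simp_all only: cond_cov_commute finite_lessThan)
    qed
    with t(1) show ?case by (simp add: dist_real_def)
  qed
qed

section \<open>The normalised summands of the numerator\<close>

text \<open>Dividing by \<open>sqrt (real n * q2 n)\<close> turns \<open>n\<close> times the second
  moments into averages of conditional ones with weight \<open>(weight n (X w))^2 / q2 n\<close>, as
  in \<open>weighted_average_tendsto\<close>.\<close>

definition score :: "nat \<Rightarrow> 'c \<times> 'r \<Rightarrow> 'b" where
  "score n = (\<lambda>(z, y). (weight n z / sqrt (real n * q2 n)) *\<^sub>R resid z y)"

lemma score_borel [measurable]: "1 \<le> n \<Longrightarrow> score n \<in> borel_measurable (borel \<Otimes>\<^sub>M R)"
proof -
  assume "1 \<le> n"
  note [measurable] = weight_borel[OF this]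
  show ?thesis unfolding score_def by measurable
qed

lemma q2_pos: "1 \<le> n \<Longrightarrow> 0 < \<phi> n \<Longrightarrow> 0 < q2 n"
  using less_le_trans[OF mult_pos_pos[of "l^2" "\<phi> n"] integrable_weight(5)[of n]] l by simp

lemma q1_pos: "1 \<le> n \<Longrightarrow> 0 < \<phi> n \<Longrightarrow> 0 < q1 n"
  using less_le_trans[OF mult_pos_pos[of l "\<phi> n"] integrable_weight(3)[of n]] l by simp

lemma weight_powr2: "1 \<le> n \<Longrightarrow> weight n z powr 2 = (weight n z)^2"
  using weight_nonneg[of n z] by (cases "weight n z = 0") auto

lemma integrable_weight_resid:
  assumes n: "1 \<le> n" "h n < \<delta>"
  shows "integrable M (\<lambda>w. (weight n (X w))^2 * (norm (resid (X w) (Y w)))^2)"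
proof -
  have eq: "norm v powr 2 = (norm v)^2" for v :: 'b by (cases "v = 0") auto
  have "integrable M (\<lambda>w. weight n (X w) powr 2 * norm (resid (X w) (Y w)) powr 2)"
  proof (rule integrable_weighted(1)[OF n(1)])
    show "(\<integral>\<^sup>+y. ennreal (norm (resid z y) powr 2) \<partial>\<kappa> z) \<le> ennreal (L_bound powr 2 * (1 + c))"
      if "dist x z \<le> h n" for z
      by (rule resid_moment(2)) (use that n \<nu> in auto)
  qed (use c in \<open>auto, measurable\<close>)
  then show ?thesis by (simp only: eq weight_powr2[OF n(1)])
qed

lemma score_norm_square:
  assumes n: "1 \<le> n" "h n < \<delta>" "0 < \<phi> n"
  shows "integrable M (\<lambda>w. (norm (score n (X w, Y w)))^2)"
    "real n * (\<integral>w. (norm (score n (X w, Y w)))^2 \<partial>M) =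
      (\<integral>w. (weight n (X w))^2 * (norm (resid (X w) (Y w)))^2 \<partial>M) / q2 n"
proof -
  have eq: "(norm (score n (X w, Y w)))^2 =
      (weight n (X w))^2 * (norm (resid (X w) (Y w)))^2 / (real n * q2 n)" for w
    using q2_pos[OF n(1,3)] by (simp add: score_def power_mult_distrib power_divide)
  show "integrable M (\<lambda>w. (norm (score n (X w, Y w)))^2)"
    unfolding eq using integrable_weight_resid[OF n(1,2)] by simp
  show "real n * (\<integral>w. (norm (score n (X w, Y w)))^2 \<partial>M) =
      (\<integral>w. (weight n (X w))^2 * (norm (resid (X w) (Y w)))^2 \<partial>M) / q2 n"
    unfolding eq using n by simp
qed

lemma score_inner_square:
  assumes n: "1 \<le> n" "h n < \<delta>" "0 < \<phi> n"
  shows "real n * (\<integral>w. (inner v (score n (X w, Y w)))^2 \<partial>M) =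
      (\<integral>w. (weight n (X w))^2 * (inner v (resid (X w) (Y w)))^2 \<partial>M) / q2 n"
proof -
  have eq: "(inner v (score n (X w, Y w)))^2 =
      (weight n (X w))^2 * (inner v (resid (X w) (Y w)))^2 / (real n * q2 n)" for w
    using q2_pos[OF n(1,3)] by (simp add: score_def power_mult_distrib power_divide)
  show ?thesis unfolding eq using n by simp
qed

lemma score_norm_square_tendsto:
  "(\<lambda>n. real n * (\<integral>w. (norm (score n (X w, Y w)))^2 \<partial>M)) \<longlonglongrightarrow> (\<integral>y. (norm (resid x y))^2 \<partial>\<kappa> x)"
proof (rule Lim_transform_eventually)
  show "(\<lambda>n. (\<integral>w. (weight n (X w))^2 * (norm (resid (X w) (Y w)))^2 \<partial>M) / q2 n)
      \<longlonglongrightarrow> (\<integral>y. (norm (resid x y))^2 \<partial>\<kappa> x)"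
    by (rule weighted_average_tendsto[OF _ _ resid_square_integrable norm_square_tendsto]) auto
  show "eventually (\<lambda>n. (\<integral>w. (weight n (X w))^2 * (norm (resid (X w) (Y w)))^2 \<partial>M) / q2 n =
      real n * (\<integral>w. (norm (score n (X w, Y w)))^2 \<partial>M)) sequentially"
    using eventually_n\<phi> by eventually_elim (simp only: score_norm_square)
qed

lemma score_inner_square_tendsto:
  "(\<lambda>n. real n * (\<integral>w. (inner v (score n (X w, Y w)))^2 \<partial>M)) \<longlonglongrightarrow> (\<integral>y. (inner v (resid x y))^2 \<partial>\<kappa> x)"
proof (rule Lim_transform_eventually)
  show "(\<lambda>n. (\<integral>w. (weight n (X w))^2 * (inner v (resid (X w) (Y w)))^2 \<partial>M) / q2 n)
      \<longlonglongrightarrow> (\<integral>y. (inner v (resid x y))^2 \<partial>\<kappa> x)"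
    by (rule weighted_average_tendsto[OF _ _ integrable_inner_square[OF _ resid_square_integrable] inner_square_tendsto])
      auto
  show "eventually (\<lambda>n. (\<integral>w. (weight n (X w))^2 * (inner v (resid (X w) (Y w)))^2 \<partial>M) / q2 n =
      real n * (\<integral>w. (inner v (score n (X w, Y w)))^2 \<partial>M)) sequentially"
    using eventually_n\<phi> by eventually_elim (simp only: score_inner_square)
qed

text \<open>The disintegration is available for nonnegative functions, so the positive and negative
  parts are conditioned separately and shown to have equal integrals.\<close>

lemma score_mean:
  assumes n: "1 \<le> n" "h n < \<delta>" "0 < \<phi> n"
  shows "(\<integral>w. inner v (score n (X w, Y w)) \<partial>M) = 0"
proof -
  note [measurable] = weight_borel[OF n(1)]
  have m: "(\<lambda>w. score n (X w, Y w)) \<in> borel_measurable M" using n by measurable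
  define a where "a z = weight n z / sqrt (real n * q2 n)" for z
  have a [measurable]: "a \<in> borel_measurable borel" unfolding a_def by measurable
  have a0: "0 \<le> a z" for z using weight_nonneg[OF n(1)] q2_pos[OF n(1,3)] by (simp add: a_def)
  have int: "integrable M (\<lambda>w. inner v (score n (X w, Y w)))"
    by (rule square_integrable_imp_integrable[OF borel_measurable_inner[OF borel_measurable_const m]
          integrable_inner_square[OF m score_norm_square(1)[OF n]]])
  \<comment> \<open>\<open>ennreal\<close> cuts off negative values, so \<open>v' = v\<close> yields
    the positive part and \<open>v' = - v\<close> the negative part.\<close>
  have half: "(\<integral>\<^sup>+w. ennreal (a (X w) * inner v' (resid (X w) (Y w))) \<partial>M) =
      (\<integral>\<^sup>+w. ennreal (a (X w)) * (\<integral>\<^sup>+y. ennreal (inner v' (resid (X w) y)) \<partial>\<kappa> (X w)) \<partial>M)" for v'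
  proof -
    have "(\<integral>\<^sup>+w. (\<lambda>(z, y). ennreal (a z) * ennreal (inner v' (resid z y))) (X w, Y w) \<partial>M) =
      (\<integral>\<^sup>+w. (\<integral>\<^sup>+y. (\<lambda>(z, y). ennreal (a z) * ennreal (inner v' (resid z y))) (X w, y) \<partial>\<kappa> (X w)) \<partial>M)"
      by (rule joint_law_disintegration[OF prob_space_axioms X Y rcd]) measurable
    then show ?thesis by (simp add: nn_integral_cmult ennreal_mult' a0)
  qed
  have "(\<integral>\<^sup>+w. ennreal (a (X w) * inner v (resid (X w) (Y w))) \<partial>M) =
      (\<integral>\<^sup>+w. ennreal (a (X w) * inner (- v) (resid (X w) (Y w))) \<partial>M)"
    unfolding half
  proof (rule nn_integral_cong)
    fix w
    let ?z = "X w"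
    show "ennreal (a ?z) * (\<integral>\<^sup>+y. ennreal (inner v (resid ?z y)) \<partial>\<kappa> ?z) =
        ennreal (a ?z) * (\<integral>\<^sup>+y. ennreal (inner (- v) (resid ?z y)) \<partial>\<kappa> ?z)"
    proof (cases "dist x ?z \<le> h n")
      case True
      then have z: "dist x ?z < \<delta>" using n(2) by simp
      note i = resid_inner_mean[OF z, of v]
      have fin: "(\<integral>\<^sup>+y. ennreal (inner v' (resid ?z y)) \<partial>\<kappa> ?z) < \<infinity>" for v'
      proof -
        have "(\<integral>\<^sup>+y. ennreal (inner v' (resid ?z y)) \<partial>\<kappa> ?z) \<le> (\<integral>\<^sup>+y. ennreal (norm (inner v' (resid ?z y))) \<partial>\<kappa> ?z)"
          by (intro nn_integral_mono ennreal_leI) simp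
        also have "... < \<infinity>" using resid_inner_mean(1)[OF z, of v'] by (simp add: integrable_iff_bounded)
        finally show ?thesis .
      qed
      \<comment> \<open>The conditional mean is 0, hence its two parts agree; their finiteness
        allows the return from reals to \<open>ennreal\<close>.\<close>
      have "enn2real (\<integral>\<^sup>+y. ennreal (inner v (resid ?z y)) \<partial>\<kappa> ?z) =
          enn2real (\<integral>\<^sup>+y. ennreal (inner (- v) (resid ?z y)) \<partial>\<kappa> ?z)"
        using i(2) unfolding real_lebesgue_integral_def[OF i(1)] by simp
      from arg_cong[OF this, of ennreal]
      have "(\<integral>\<^sup>+y. ennreal (inner v (resid ?z y)) \<partial>\<kappa> ?z) = (\<integral>\<^sup>+y. ennreal (inner (- v) (resid ?z y)) \<partial>\<kappa> ?z)"
        unfolding ennreal_enn2real[OF fin[unfolded infinity_ennreal_def]] .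
      then show ?thesis by simp
    next
      case False
      then have "a ?z = 0" using weight_outside[OF n(1)] by (simp add: a_def)
      then show ?thesis by simp
    qed
  qed
  moreover have "inner v (score n (X w, Y w)) = a (X w) * inner v (resid (X w) (Y w))" for w
    by (simp add: score_def a_def)
  ultimately show ?thesis
    unfolding real_lebesgue_integral_def[OF int] by simp
qed

text \<open>Conditional moments of order \<open>p\<close> are bounded on the ball, so the sum is at
  most a constant times \<open>n * \<phi> n\<close> divided by its power \<open>p / 2\<close>; the
  exponent \<open>1 - p / 2\<close> is negative.\<close>

lemma score_Lyapunov:
  "\<And>n. 1 \<le> n \<Longrightarrow> h n < \<delta> \<Longrightarrow> 0 < \<phi> n \<Longrightarrow> integrable M (\<lambda>w. \<bar>inner v (score n (X w, Y w))\<bar> powr p)"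
  "(\<lambda>n. real n * (\<integral>w. \<bar>inner v (score n (X w, Y w))\<bar> powr p \<partial>M)) \<longlonglongrightarrow> 0"
proof -
  define D where "D = norm v powr p * (L_bound powr p * (1 + c))"
  have "0 \<le> D" using c by (simp add: D_def)
  have key: "integrable M (\<lambda>w. \<bar>inner v (score n (X w, Y w))\<bar> powr p) \<and>
      real n * (\<integral>w. \<bar>inner v (score n (X w, Y w))\<bar> powr p \<partial>M) \<le>
      D * u powr p / l powr p * (real n * \<phi> n) powr (1 - p / 2)"
    if n: "1 \<le> n" "h n < \<delta>" "0 < \<phi> n" for n
  proof -
    note [measurable] = weight_borel[OF n(1)]
    define s where "s = sqrt (real n * q2 n)"
    have s: "0 < s" using q2_pos[OF n(1,3)] n by (simp add: s_def)
    have eq: "\<bar>inner v (score n (X w, Y w))\<bar> powr p =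
        weight n (X w) powr p * \<bar>inner v (resid (X w) (Y w))\<bar> powr p / s powr p" for w
      using weight_nonneg[OF n(1), of "X w"] s
      by (simp add: score_def s_def[symmetric] abs_mult powr_mult powr_divide)
    have bd: "(\<integral>\<^sup>+y. ennreal (\<bar>inner v (resid z y)\<bar> powr p) \<partial>\<kappa> z) \<le> ennreal D" if "dist x z \<le> h n" for z
    proof -
      have "(\<integral>\<^sup>+y. ennreal (\<bar>inner v (resid z y)\<bar> powr p) \<partial>\<kappa> z) \<le>
          (\<integral>\<^sup>+y. ennreal (norm v powr p) * ennreal (norm (resid z y) powr p) \<partial>\<kappa> z)"
        using Cauchy_Schwarz_ineq2[of v] p
        by (intro nn_integral_mono) (auto simp: ennreal_mult[symmetric] powr_mult[symmetric] intro!: powr_mono2 ennreal_leI)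
      also have "... = ennreal (norm v powr p) * (\<integral>\<^sup>+y. ennreal (norm (resid z y) powr p) \<partial>\<kappa> z)"
        by (intro nn_integral_cmult) measurable
      also have "... \<le> ennreal (norm v powr p) * ennreal (L_bound powr p * (1 + c))"
        using that n p by (intro mult_left_mono resid_moment(2)) auto
      finally show ?thesis using c by (simp add: D_def ennreal_mult)
    qed
    note iw = integrable_weighted[OF n(1) _ _ bd \<open>0 \<le> D\<close>, of p]
    have i: "integrable M (\<lambda>w. weight n (X w) powr p * \<bar>inner v (resid (X w) (Y w))\<bar> powr p)"
      using p by (intro iw(1)) auto
    have "(\<integral>w. weight n (X w) powr p * \<bar>inner v (resid (X w) (Y w))\<bar> powr p \<partial>M) \<le>
        D * (\<integral>w. weight n (X w) powr p \<partial>M)"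
      using p by (intro iw(2)) auto
    also have "... \<le> D * (u powr p * \<phi> n)"
      using p \<open>0 \<le> D\<close> by (intro mult_left_mono integrable_weight_powr n) auto
    finally have le: "(\<integral>w. weight n (X w) powr p * \<bar>inner v (resid (X w) (Y w))\<bar> powr p \<partial>M) \<le> D * (u powr p * \<phi> n)" .
    have "l * sqrt (real n * \<phi> n) = sqrt (real n * (l^2 * \<phi> n))" using l by (simp add: real_sqrt_mult)
    also have "... \<le> s" unfolding s_def using integrable_weight(5)[OF n(1)] by (intro real_sqrt_le_mono mult_left_mono) auto
    finally have ls: "l * sqrt (real n * \<phi> n) \<le> s" .
    have n\<phi>0: "0 < real n * \<phi> n" using n by simp
    have "real n * (\<integral>w. \<bar>inner v (score n (X w, Y w))\<bar> powr p \<partial>M) =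
        real n * (\<integral>w. weight n (X w) powr p * \<bar>inner v (resid (X w) (Y w))\<bar> powr p \<partial>M) / s powr p"
      unfolding eq by simp
    also have "... \<le> real n * (D * (u powr p * \<phi> n)) / s powr p"
      using le by (intro divide_right_mono mult_left_mono) auto
    also have "... \<le> real n * (D * (u powr p * \<phi> n)) / (l * sqrt (real n * \<phi> n)) powr p"
      using ls l s n\<phi>0 \<open>0 \<le> D\<close> p n by (intro divide_left_mono powr_mono2 mult_pos_pos) auto
    also have "(l * sqrt (real n * \<phi> n)) powr p = l powr p * (real n * \<phi> n) powr (p / 2)"
      using l n\<phi>0 by (simp add: powr_mult powr_half_sqrt[symmetric] powr_powr)
    also have "real n * (D * (u powr p * \<phi> n)) / (l powr p * (real n * \<phi> n) powr (p / 2)) =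
        D * u powr p / l powr p * ((real n * \<phi> n) / (real n * \<phi> n) powr (p / 2))"
      by (simp add: divide_simps)
    also have "(real n * \<phi> n) / (real n * \<phi> n) powr (p / 2) = (real n * \<phi> n) powr (1 - p / 2)"
      using n\<phi>0 by (simp add: powr_diff)
    finally show ?thesis using i unfolding eq by simp
  qed
  then show "integrable M (\<lambda>w. \<bar>inner v (score n (X w, Y w))\<bar> powr p)"
    if "1 \<le> n" "h n < \<delta>" "0 < \<phi> n" for n using that by blast
  show "(\<lambda>n. real n * (\<integral>w. \<bar>inner v (score n (X w, Y w))\<bar> powr p \<partial>M)) \<longlonglongrightarrow> 0"
  proof (rule real_tendsto_sandwich)
    show "eventually (\<lambda>n. 0 \<le> real n * (\<integral>w. \<bar>inner v (score n (X w, Y w))\<bar> powr p \<partial>M)) sequentially"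
      by simp
    show "eventually (\<lambda>n. real n * (\<integral>w. \<bar>inner v (score n (X w, Y w))\<bar> powr p \<partial>M) \<le>
        D * u powr p / l powr p * (real n * \<phi> n) powr (1 - p / 2)) sequentially"
      using eventually_n\<phi> by eventually_elim (use key in blast)
    have "(\<lambda>n. (real n * \<phi> n) powr (1 - p / 2)) \<longlonglongrightarrow> 0"
      using p by (intro tendsto_neg_powr n\<phi>) simp
    then show "(\<lambda>n. D * u powr p / l powr p * (real n * \<phi> n) powr (1 - p / 2)) \<longlonglongrightarrow> 0"
      by (rule tendsto_mult_right_zero)
  qed simp
qed

section \<open>Numerator and denominator built from the independent copies\<close>

lemma copies_measurable: "1 \<le> i \<Longrightarrow> (\<lambda>w. (Xs i w, Ys i w)) \<in> M \<rightarrow>\<^sub>M borel \<Otimes>\<^sub>M R"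
  using iid by (simp add: iid_copies_def indep_vars_def2)

lemma copies_indep:
  assumes "f \<in> borel \<Otimes>\<^sub>M R \<rightarrow>\<^sub>M Q"
  shows "indep_vars (\<lambda>_. Q) (\<lambda>i w. f (Xs i w, Ys i w)) {1..n}"
proof -
  have "indep_vars (\<lambda>_. borel \<Otimes>\<^sub>M R) (\<lambda>i w. (Xs i w, Ys i w)) {1..}"
    using iid by (simp add: iid_copies_def)
  then have "indep_vars (\<lambda>_. borel \<Otimes>\<^sub>M R) (\<lambda>i w. (Xs i w, Ys i w)) {1..n}"
    by (rule indep_vars_subset) simp
  then show ?thesis by (rule indep_vars_compose2[where Y="\<lambda>_. f"]) (rule assms)
qed

lemma copies_distr:
  assumes "1 \<le> i" and f: "f \<in> borel \<Otimes>\<^sub>M R \<rightarrow>\<^sub>M Q"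
  shows "distr M Q (\<lambda>w. f (Xs i w, Ys i w)) = distr M Q (\<lambda>w. f (X w, Y w))"
proof -
  have "distr (distr M (borel \<Otimes>\<^sub>M R) (\<lambda>w. (Xs i w, Ys i w))) Q f =
      distr (distr M (borel \<Otimes>\<^sub>M R) (\<lambda>w. (X w, Y w))) Q f"
    using iid assms(1) by (simp add: iid_copies_def)
  then show ?thesis
    by (simp add: distr_distr[OF f copies_measurable[OF assms(1)]] distr_distr[OF f] comp_def)
qed

lemma copies_integral:
  fixes f :: "'c \<times> 'r \<Rightarrow> real"
  assumes i: "1 \<le> i" and f: "f \<in> borel_measurable (borel \<Otimes>\<^sub>M R)"
  shows "(\<integral>w. f (Xs i w, Ys i w) \<partial>M) = (\<integral>w. f (X w, Y w) \<partial>M)"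
    "integrable M (\<lambda>w. f (Xs i w, Ys i w)) \<longleftrightarrow> integrable M (\<lambda>w. f (X w, Y w))"
proof -
  have XY: "(\<lambda>w. (X w, Y w)) \<in> M \<rightarrow>\<^sub>M borel \<Otimes>\<^sub>M R" by measurable
  have eq: "distr M (borel \<Otimes>\<^sub>M R) (\<lambda>w. (Xs i w, Ys i w)) = distr M (borel \<Otimes>\<^sub>M R) (\<lambda>w. (X w, Y w))"
    using iid i by (simp add: iid_copies_def)
  show "(\<integral>w. f (Xs i w, Ys i w) \<partial>M) = (\<integral>w. f (X w, Y w) \<partial>M)"
    using integral_distr[OF copies_measurable[OF i] f] integral_distr[OF XY f] by (simp only: eq)
  show "integrable M (\<lambda>w. f (Xs i w, Ys i w)) \<longleftrightarrow> integrable M (\<lambda>w. f (X w, Y w))"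
    using integrable_distr_eq[OF copies_measurable[OF i] f] integrable_distr_eq[OF XY f] by (simp only: eq)
qed

definition S_stat :: "nat \<Rightarrow> 'a \<Rightarrow> 'b" where
  "S_stat n w = (\<Sum>i=1..n. score n (Xs i w, Ys i w))"

definition T_stat :: "nat \<Rightarrow> 'a \<Rightarrow> real" where
  "T_stat n w = (\<Sum>i=1..n. weight n (Xs i w)) / (real n * q1 n)"

definition Z_stat :: "nat \<Rightarrow> 'a \<Rightarrow> 'b" where
  "Z_stat n w = (sqrt (real n * small_ball M X x (h n)) / sqrt (E_stat M X K h x 2 n) *
     E_stat M X K h x 1 n) *\<^sub>R V_stat \<kappa> G L K h x Xs Ys n w"

lemma Xs_measurable: "1 \<le> i \<Longrightarrow> Xs i \<in> borel_measurable M"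
  using measurable_compose[OF copies_measurable measurable_fst] by simp

lemma S_stat_measurable: "S_stat n \<in> borel_measurable M"
  unfolding S_stat_def
proof (intro borel_measurable_sum)
  fix i assume "i \<in> {1..n}"
  then show "(\<lambda>w. score n (Xs i w, Ys i w)) \<in> borel_measurable M"
    by (intro measurable_compose[OF copies_measurable score_borel]) auto
qed

lemma V_stat_eq:
  "V_stat \<kappa> G L K h x Xs Ys n w =
    (\<Sum>i=1..n. weight n (Xs i w) *\<^sub>R resid (Xs i w) (Ys i w)) /\<^sub>R (\<Sum>i=1..n. weight n (Xs i w))"
proof -
  have lin: "linear L" by (rule bounded_linear.linear[OF L])
  show ?thesis by (simp add: V_stat_def linear_scale[OF lin] linear_sum[OF lin])
qed

lemma Z_stat_measurable: "Z_stat n \<in> borel_measurable M"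
proof -
  have [measurable]: "(\<lambda>w. weight n (Xs i w)) \<in> borel_measurable M"
    "(\<lambda>w. resid (Xs i w) (Ys i w)) \<in> borel_measurable M" if "i \<in> {1..n}" for i
  proof -
    \<comment> \<open>An index in \<open>{1..n}\<close> forces \<open>1 \<le> n\<close>. For
      \<open>n = 0\<close> the sums are empty, so no weight with bandwidth \<open>h 0\<close>
      occurs.\<close>
    have i: "1 \<le> i" "1 \<le> n" using that by auto
    show "(\<lambda>w. weight n (Xs i w)) \<in> borel_measurable M"
      by (rule measurable_compose[OF Xs_measurable[OF i(1)] weight_borel[OF i(2)]])
    show "(\<lambda>w. resid (Xs i w) (Ys i w)) \<in> borel_measurable M"
      using measurable_compose[OF copies_measurable[OF i(1)] resid_pair] by simp
  qed
  show ?thesis unfolding Z_stat_def V_stat_eq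
    by (intro borel_measurable_scaleR borel_measurable_inverse borel_measurable_sum
        borel_measurable_const) auto
qed

text \<open>The small ball probability cancels from the normalisation. Where all weights vanish,
  both sides are 0 because \<open>inverse 0 = 0\<close>.\<close>

lemma Z_stat_eq:
  assumes n: "1 \<le> n" "0 < \<phi> n"
  shows "Z_stat n w = S_stat n w /\<^sub>R T_stat n w"
proof -
  have q: "0 < q1 n" "0 < q2 n" using q1_pos[OF n] q2_pos[OF n] by auto
  have "sqrt (real n * \<phi> n) / sqrt (q2 n / \<phi> n) * (q1 n / \<phi> n) = real n * q1 n / sqrt (real n * q2 n)"
  proof -
    have "\<phi> n = sqrt (\<phi> n) * sqrt (\<phi> n)" "real n = sqrt (real n) * sqrt (real n)" using n by auto
    then show ?thesis using n q by (simp add: real_sqrt_mult real_sqrt_divide field_simps)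
  qed
  moreover have "E_stat M X K h x 2 n = q2 n / \<phi> n" "E_stat M X K h x 1 n = q1 n / \<phi> n"
    by (simp_all add: E_stat_def q1_def q2_def)
  moreover define A where "A = (\<Sum>i=1..n. weight n (Xs i w) *\<^sub>R resid (Xs i w) (Ys i w))"
  moreover define s where "s = (\<Sum>i=1..n. weight n (Xs i w))"
  moreover have "S_stat n w = (1 / sqrt (real n * q2 n)) *\<^sub>R A"
    by (simp add: S_stat_def score_def scaleR_sum_right A_def)
  ultimately show ?thesis
    unfolding Z_stat_def V_stat_eq T_stat_def by (auto simp: divide_inverse mult_ac)
qed

text \<open>The variance of an average of independent terms relative to the squared mean is at most
  \<open>q2 n / (n * (q1 n)^2)\<close>, with \<open>q2 n \<le> u^2 * \<phi> n\<close> and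
  \<open>q1 n \<ge> l * \<phi> n\<close>.\<close>

lemma T_stat_square:
  assumes n: "1 \<le> n" "0 < \<phi> n"
  shows "integrable M (\<lambda>w. (T_stat n w - 1)^2)"
    "(\<integral>w. (T_stat n w - 1)^2 \<partial>M) \<le> u^2 / l^2 * inverse (real n * \<phi> n)"
proof -
  note [measurable] = weight_borel[OF n(1)]
  have q: "0 < q1 n" "0 < q2 n" using q1_pos[OF n] q2_pos[OF n] by auto
  define r where "r = real n * q1 n"
  have r: "0 < r" using q n by (simp add: r_def)
  \<comment> \<open>The centred summand, defined on pairs although it depends on \<open>z\<close>
    alone, so that independence of the pairs applies.\<close>
  define d where "d = (\<lambda>(z, y :: 'r). (weight n z - q1 n) / r)"
  have d [measurable]: "d \<in> borel_measurable (borel \<Otimes>\<^sub>M R)" unfolding d_def by measurable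
  have T: "T_stat n w - 1 = (\<Sum>i=1..n. d (Xs i w, Ys i w))" for w
  proof -
    have "(\<Sum>i=1..n. d (Xs i w, Ys i w)) = ((\<Sum>i=1..n. weight n (Xs i w)) - real n * q1 n) / r"
      by (simp add: d_def sum_divide_distrib[symmetric] sum_subtractf)
    moreover have "real n * q1 n / r = 1" using r by (simp add: r_def[symmetric])
    ultimately show ?thesis by (simp only: T_stat_def r_def[symmetric] diff_divide_distrib)
  qed
  have sq: "(d (X w, Y w))^2 = ((weight n (X w))^2 - 2 * q1 n * weight n (X w) + (q1 n)^2) / r^2" for w
    by (simp add: d_def power_divide power2_diff algebra_simps)
  note iw = integrable_weight[OF n(1)]
  have d2: "integrable M (\<lambda>w. (d (X w, Y w))^2)"
    unfolding sq using iw by simp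
  have d2i: "(\<integral>w. (d (X w, Y w))^2 \<partial>M) = (q2 n - (q1 n)^2) / r^2"
  proof -
    have "(\<integral>w. (d (X w, Y w))^2 \<partial>M) = (q2 n - 2 * q1 n * q1 n + (q1 n)^2) / r^2"
      unfolding sq using iw by (simp add: prob_space q1_def[symmetric] q2_def[symmetric])
    then show ?thesis by (simp add: power2_eq_square)
  qed
  have d1: "(\<integral>w. d (X w, Y w) \<partial>M) = 0"
    using iw by (simp add: d_def prob_space q1_def[symmetric])
  have ind: "indep_vars (\<lambda>_. borel) (\<lambda>i w. d (Xs i w, Ys i w)) {1..n}"
    by (rule copies_indep[OF d])
  have i2: "integrable M (\<lambda>w. (d (Xs i w, Ys i w))^2)"
    "(\<integral>w. (d (Xs i w, Ys i w))^2 \<partial>M) = (q2 n - (q1 n)^2) / r^2"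
    "(\<integral>w. d (Xs i w, Ys i w) \<partial>M) = 0" if "i \<in> {1..n}" for i
    using copies_integral[of i "\<lambda>p. (d p)^2"] copies_integral(1)[of i d] that d2 d2i d1 by auto
  note sum = integral_square_sum_indep[OF finite_atLeastAtMost ind i2(1,3)]
  show "integrable M (\<lambda>w. (T_stat n w - 1)^2)" unfolding T using sum(1) by simp
  have "(\<integral>w. (T_stat n w - 1)^2 \<partial>M) = real n * ((q2 n - (q1 n)^2) / r^2)"
    unfolding T using sum(2) i2(2) by simp
  also have "... \<le> real n * ((u^2 * \<phi> n) / (real n * (l * \<phi> n))^2)"
  proof (intro mult_left_mono frac_le)
    show "q2 n - (q1 n)^2 \<le> u^2 * \<phi> n" using iw(4) zero_le_power2[of "q1 n"] by linarith
    show "(real n * (l * \<phi> n))^2 \<le> r^2"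
      unfolding r_def using n l iw(3) by (intro power_mono mult_left_mono) auto
  qed (use n l in auto)
  also have "... = u^2 / l^2 * inverse (real n * \<phi> n)"
    using n l by (simp add: power2_eq_square field_simps)
  finally show "(\<integral>w. (T_stat n w - 1)^2 \<partial>M) \<le> u^2 / l^2 * inverse (real n * \<phi> n)" .
qed

lemma T_stat_tendsto: "(\<lambda>n. \<integral>w. (T_stat n w - 1)^2 \<partial>M) \<longlonglongrightarrow> 0"
proof (rule real_tendsto_sandwich)
  show "eventually (\<lambda>n. 0 \<le> (\<integral>w. (T_stat n w - 1)^2 \<partial>M)) sequentially" by simp
  show "eventually (\<lambda>n. (\<integral>w. (T_stat n w - 1)^2 \<partial>M) \<le> u^2 / l^2 * inverse (real n * \<phi> n)) sequentially"
    using eventually_n\<phi> by eventually_elim (use T_stat_square(2) in blast)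
  show "(\<lambda>n. u^2 / l^2 * inverse (real n * \<phi> n)) \<longlonglongrightarrow> 0"
    by (intro tendsto_mult_right_zero tendsto_inverse_0_at_top n\<phi>)
qed simp

section \<open>The limit theorem\<close>

text \<open>The limit is realised canonically: \<open>N\<close> is the Gaussian law on the Hilbert
  space and \<open>W\<close> the identity. Its covariance has finite trace because the residual at
  \<open>x\<close> has a finite second moment.\<close>

theorem kernel_estimator_CLT:
  "\<exists>(N :: 'b measure) (W :: 'b \<Rightarrow> 'b).
     gaussian_element N W \<and> has_mean N W 0 \<and> has_covariance N W (cond_cov \<kappa> G L x) \<and>
     converges_in_distribution M Z_stat N W"
proof -
  have dx: "dist x x < \<delta>" using \<delta> by simp
  have rm: "resid x \<in> borel_measurable (\<kappa> x)" by measurable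
  define C where "C v = (\<integral>y. inner v (resid x y) *\<^sub>R resid x y \<partial>\<kappa> x)" for v
  note cov = covariance_operator[OF rm resid_square_integrable[OF dx], folded C_def]
  have C_cov: "cond_cov \<kappa> G L x = (\<lambda>v w. inner (C v) w)"
    by (intro ext) (simp add: cov(3) cond_cov_def)
  obtain e :: "nat \<Rightarrow> 'b" where e: "total_family e UNIV" using exists_total_family by blast
  have trace: "(\<lambda>j. inner (C (e j)) (e j)) sums (\<integral>y. (norm (resid x y))^2 \<partial>\<kappa> x)"
    using integral_norm_square_sums[OF rm resid_square_integrable[OF dx] e]
    by (simp add: cov(3) power2_eq_square)
  obtain N :: "'b measure" where N: "prob_space N" "sets N = sets borel"
    "\<And>v. (\<integral>w. cis (inner v w) \<partial>N) = complex_of_real (exp (- inner (C v) v / 2))"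
    "integrable N (\<lambda>w. (norm w)^2)" "(\<integral>w. (norm w)^2 \<partial>N) = (\<integral>y. (norm (resid x y))^2 \<partial>\<kappa> x)"
    using exists_gaussian_measure[OF cov(2,1) e sums_summable[OF trace]]
    unfolding sums_unique[OF trace, symmetric] by blast
  note gauss = gaussian_measure_properties[OF N(1,2) cov(2) N(3,4)]
  have W: "(\<lambda>w. w) \<in> borel_measurable N" using gauss(1) by (simp add: gaussian_element_def)
  \<comment> \<open>The estimates for \<open>score n\<close> require a ball inside the neighbourhood
    and of positive probability, which holds from some index on.\<close>
  obtain n0 where n0: "\<And>n. n0 \<le> n \<Longrightarrow> 1 \<le> n \<and> h n < \<delta> \<and> 0 < \<phi> n"
    using eventually_n\<phi> unfolding eventually_sequentially by blast
  have sm: "(\<lambda>w. score n (X w, Y w)) \<in> borel_measurable M" if "n0 \<le> n" for n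
  proof -
    have "(\<lambda>w. (X w, Y w)) \<in> M \<rightarrow>\<^sub>M borel \<Otimes>\<^sub>M R" by measurable
    then show ?thesis by (rule measurable_compose) (use n0[OF that] score_borel in blast)
  qed
  have row: "indep_vars (\<lambda>_. borel) (\<lambda>i w. score n (Xs i w, Ys i w)) {1..n}"
    "\<And>i. i \<in> {1..n} \<Longrightarrow> distr M borel (\<lambda>w. score n (Xs i w, Ys i w)) = distr M borel (\<lambda>w. score n (X w, Y w))"
    if "n0 \<le> n" for n
  proof -
    have m: "score n \<in> borel_measurable (borel \<Otimes>\<^sub>M R)" using n0[OF that] score_borel by blast
    show "indep_vars (\<lambda>_. borel) (\<lambda>i w. score n (Xs i w, Ys i w)) {1..n}" by (rule copies_indep[OF m])
    show "distr M borel (\<lambda>w. score n (Xs i w, Ys i w)) = distr M borel (\<lambda>w. score n (X w, Y w))"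
      if "i \<in> {1..n}" for i
      using that by (intro copies_distr[OF _ m]) simp
  qed
  have sc2: "integrable M (\<lambda>w. (norm (score n (X w, Y w)))^2)"
    "(\<integral>w. inner v (score n (X w, Y w)) \<partial>M) = 0" if "n0 \<le> n" for n v
    using n0[OF that] score_norm_square(1) score_mean by auto
  have S2: "integrable M (\<lambda>w. (norm (S_stat n w))^2)"
    "(\<integral>w. (norm (S_stat n w))^2 \<partial>M) = real n * (\<integral>w. (norm (score n (X w, Y w)))^2 \<partial>M)"
    "(\<integral>w. (inner v (S_stat n w))^2 \<partial>M) = real n * (\<integral>w. (inner v (score n (X w, Y w)))^2 \<partial>M)"
    "(\<integral>w. cis (inner v (S_stat n w)) \<partial>M) = (\<integral>w. cis (inner v (score n (X w, Y w))) \<partial>M) ^ n"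
    if "n0 \<le> n" for n v
    unfolding S_stat_def
    by (rule iid_row_norm_square[OF row[OF that] sm[OF that] sc2[OF that]]
        iid_row_inner_square(2)[OF row[OF that] sm[OF that] sc2[OF that]]
        iid_row_char[OF row[OF that] sm[OF that]]; assumption)+
  have ev: "f \<longlonglongrightarrow> a \<Longrightarrow> (\<And>n. n0 \<le> n \<Longrightarrow> f n = g n) \<Longrightarrow> g \<longlonglongrightarrow> a" for f g :: "nat \<Rightarrow> 'z::topological_space" and a
    by (rule Lim_transform_eventually) (auto intro: eventually_sequentiallyI)
  have norm2: "(\<lambda>n. \<integral>w. (norm (S_stat n w))^2 \<partial>M) \<longlonglongrightarrow> (\<integral>w. (norm w)^2 \<partial>N)"
    unfolding N(5) by (rule ev[OF score_norm_square_tendsto]) (simp only: S2)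
  have Cv: "inner (C v) v = (\<integral>y. (inner v (resid x y))^2 \<partial>\<kappa> x)" for v
    by (simp add: cov(3) power2_eq_square)
  have inner2: "(\<lambda>n. \<integral>w. (inner v (S_stat n w))^2 \<partial>M) \<longlonglongrightarrow> (\<integral>w. (inner v w)^2 \<partial>N)" for v
    unfolding gauss(4) Cv by (rule ev[OF score_inner_square_tendsto]) (simp only: S2)
  have char: "(\<lambda>n. \<integral>w. cis (inner v (S_stat n w)) \<partial>M) \<longlonglongrightarrow> (\<integral>w. cis (inner v w) \<partial>N)" for v
  proof (rule ev)
    show "(\<lambda>n. (\<integral>w. cis (inner v (score n (X w, Y w))) \<partial>M) ^ n) \<longlonglongrightarrow> (\<integral>w. cis (inner v w) \<partial>N)"
      unfolding N(3) Cv
    proof (rule Lyapunov_char_tendsto[where p=p and ?n0.0=n0, OF _ _ _ p(1,2) _ score_inner_square_tendsto score_Lyapunov(2)])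
      fix n assume n: "n0 \<le> n"
      show "(\<lambda>w. inner v (score n (X w, Y w))) \<in> borel_measurable M"
        by (rule borel_measurable_inner[OF borel_measurable_const sm[OF n]])
      show "integrable M (\<lambda>w. (inner v (score n (X w, Y w)))^2)"
        by (rule integrable_inner_square[OF sm[OF n] sc2(1)[OF n]])
      show "(\<integral>w. inner v (score n (X w, Y w)) \<partial>M) = 0" by (rule sc2(2)[OF n])
      show "integrable M (\<lambda>w. \<bar>inner v (score n (X w, Y w))\<bar> powr p)"
        using n0[OF n] score_Lyapunov(1) by blast
    qed
  qed (simp only: S2)
  \<comment> \<open>A bound on the second moments of the numerator that is uniform in
    \<open>n\<close>, as the division by \<open>T_stat\<close> demands.\<close>
  obtain n1 where n1: "\<And>n. n1 \<le> n \<Longrightarrow> (\<integral>w. (norm (S_stat n w))^2 \<partial>M) < (\<integral>w. (norm w)^2 \<partial>N) + 1"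
    using order_tendstoD(2)[OF norm2, of "(\<integral>w. (norm w)^2 \<partial>N) + 1"] unfolding eventually_sequentially by auto
  have "converges_in_distribution M Z_stat N (\<lambda>w. w)"
  proof (rule converges_in_distribution_lipschitz[OF prob_space_axioms N(1) Z_stat_measurable W])
    fix f :: "'b \<Rightarrow> real" and B C' assume f: "\<And>x. \<bar>f x\<bar> \<le> B" "\<And>x y. \<bar>f x - f y\<bar> \<le> C' * dist x y"
    have lim: "(\<lambda>n. \<integral>w. f (S_stat n w) \<partial>M) \<longlonglongrightarrow> (\<integral>w. f w \<partial>N)"
      by (rule lipschitz_integral_tendsto[OF prob_space_axioms N(1) S_stat_measurable W S2(1) N(4) char norm2 inner2 f])
    show "(\<lambda>n. \<integral>w. f (Z_stat n w) \<partial>M) \<longlonglongrightarrow> (\<integral>w. f w \<partial>N)"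
    proof (rule Slutsky_lipschitz[where ?n0.0="max n0 n1", OF prob_space_axioms S_stat_measurable Z_stat_measurable _ _ _ T_stat_tendsto _ f lim])
      fix n assume n: "max n0 n1 \<le> n"
      show "integrable M (\<lambda>w. (norm (S_stat n w))^2)" using S2(1) n by simp
      show "(\<integral>w. (norm (S_stat n w))^2 \<partial>M) \<le> (\<integral>w. (norm w)^2 \<partial>N) + 1" using n1[of n] n by simp
      show "integrable M (\<lambda>w. (T_stat n w - 1)^2)" using n0[of n] n T_stat_square(1) by simp
      show "Z_stat n w = S_stat n w /\<^sub>R T_stat n w" for w using n0[of n] n Z_stat_eq by simp
    qed
  qed
  then show ?thesis using gauss(1-3) C_cov by metis
qed

end

theorem theorem4:
  fixes M :: "'a measure" and R :: "'r measure"
    and X :: "'a \<Rightarrow> 'c::polish_space" and Y :: "'a \<Rightarrow> 'r"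
    and Xs :: "nat \<Rightarrow> 'a \<Rightarrow> 'c" and Ys :: "nat \<Rightarrow> 'a \<Rightarrow> 'r"
    and \<kappa> :: "'c \<Rightarrow> 'r measure" and x :: 'c
    and K :: "real \<Rightarrow> real" and h :: "nat \<Rightarrow> real"
    and G :: "'r \<Rightarrow> 'g::{banach,second_countable_topology}"
    and L :: "'g \<Rightarrow> 'b::{real_inner,banach,second_countable_topology}"
    and l u \<nu> :: real
  assumes "prob_space M"
    and "X \<in> M \<rightarrow>\<^sub>M borel" and "Y \<in> M \<rightarrow>\<^sub>M R"
    and "iid_copies M (borel \<Otimes>\<^sub>M R) (\<lambda>\<omega>. (X \<omega>, Y \<omega>)) (\<lambda>i \<omega>. (Xs i \<omega>, Ys i \<omega>))"
    and "regular_conditional_distribution M borel X R Y \<kappa>"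
    and "G \<in> R \<rightarrow>\<^sub>M borel" and "bounded_linear L"
    and "K \<in> borel_measurable (restrict_space borel {0..})" and "\<And>t. 0 \<le> t \<Longrightarrow> 0 \<le> K t"
    and "0 < l" and "l \<le> u"
    and "\<And>t. 0 \<le> t \<Longrightarrow> t \<le> 1 \<Longrightarrow> l \<le> K t \<and> K t \<le> u" and "\<And>t. 1 < t \<Longrightarrow> K t = 0"
    and "\<And>n. 1 \<le> n \<Longrightarrow> 0 < h n" and "h \<longlonglongrightarrow> 0"
    and "filterlim (\<lambda>n. real n * small_ball M X x (h n)) at_top sequentially"
    and "2 < \<nu>"
    and "\<exists>S c. open S \<and> x \<in> S \<and>
           (\<forall>z\<in>S. integrable (\<kappa> z) G \<and>
              (\<integral>\<^sup>+y. ennreal (norm (G y - cond_mean \<kappa> G z) powr \<nu>) \<partial>\<kappa> z) \<le> ennreal c)"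
    and "tendsto_trace_norm (cond_cov \<kappa> G L) (cond_cov \<kappa> G L x) (at x)"
    and "bounded_bilinear (cond_cov \<kappa> G L x)"
    and "\<And>v. v \<noteq> 0 \<Longrightarrow> 0 < cond_cov \<kappa> G L x v v"
  shows "\<exists>(N :: 'b measure) (W :: 'b \<Rightarrow> 'b).
           gaussian_element N W \<and> has_mean N W 0 \<and> has_covariance N W (cond_cov \<kappa> G L x) \<and>
           converges_in_distribution M
             (\<lambda>n \<omega>. (sqrt (real n * small_ball M X x (h n)) / sqrt (E_stat M X K h x 2 n) *
                     E_stat M X K h x 1 n) *\<^sub>R V_stat \<kappa> G L K h x Xs Ys n \<omega>) N W"
proof -
  from assms(18) obtain S c where S: "open S" "x \<in> S"
    "\<And>z. z \<in> S \<Longrightarrow> integrable (\<kappa> z) G"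
    "\<And>z. z \<in> S \<Longrightarrow> (\<integral>\<^sup>+y. ennreal (norm (G y - cond_mean \<kappa> G z) powr \<nu>) \<partial>\<kappa> z) \<le> ennreal c"
    by blast
  obtain \<delta> where \<delta>: "0 < \<delta>" "\<And>z. dist z x < \<delta> \<Longrightarrow> z \<in> S"
    using S(1,2) unfolding open_dist by blast
  \<comment> \<open>A negative \<open>c\<close> stands for the bound \<open>ennreal c = 0\<close>,
    so passing to \<open>max c 0\<close> leaves the bound unchanged.\<close>
  have c: "ennreal c \<le> ennreal (max c 0)" by (rule ennreal_leI) simp
  interpret kernel_estimator M R X Y Xs Ys \<kappa> x K h G L l u \<nu> \<delta> "max c 0"
  proof (intro kernel_estimator.intro kernel_estimator_axioms.intro)
    show "prob_space M" by fact
    show "X \<in> M \<rightarrow>\<^sub>M borel" "Y \<in> M \<rightarrow>\<^sub>M R" by fact+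
    show "iid_copies M (borel \<Otimes>\<^sub>M R) (\<lambda>\<omega>. (X \<omega>, Y \<omega>)) (\<lambda>i \<omega>. (Xs i \<omega>, Ys i \<omega>))"
      "regular_conditional_distribution M borel X R Y \<kappa>" by fact+
    show "G \<in> R \<rightarrow>\<^sub>M borel" by fact
    show "bounded_linear L" by fact
    show "0 < l" by fact
    show "h \<longlonglongrightarrow> 0" by fact
    show "2 < \<nu>" by fact
    show "0 < \<delta>" by fact
    show "K \<in> borel_measurable (restrict_space borel {0..})" by fact
    show "filterlim (\<lambda>n. real n * small_ball M X x (h n)) at_top sequentially"
      "tendsto_trace_norm (cond_cov \<kappa> G L) (cond_cov \<kappa> G L x) (at x)" by fact+
    show "0 \<le> K t" if "0 \<le> t" for t using assms(9) that .
    show "l \<le> K t" "K t \<le> u" if "0 \<le> t" "t \<le> 1" for t using assms(12)[OF that] by auto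
    show "K t = 0" if "1 < t" for t using assms(13) that .
    show "0 < h n" if "1 \<le> n" for n using assms(14) that .
    show "0 \<le> max c 0" by simp
    fix z assume "dist x z < \<delta>"
    then have "z \<in> S" using \<delta>(2) by (simp add: dist_commute)
    then show "integrable (\<kappa> z) G"
      "(\<integral>\<^sup>+y. ennreal (norm (G y - cond_mean \<kappa> G z) powr \<nu>) \<partial>\<kappa> z) \<le> ennreal (max c 0)"
      using S(3,4) c order_trans by blast+
  qed
  show ?thesis using kernel_estimator_CLT unfolding Z_stat_def .
qed

end
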